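(* For each integer $k\ge 1$ there is a constant $K_k$ such that for any $C^*$-algebras $A,B$, any bounded linear operator $u\colon A\to B$, any $n\ge 1$ and any family $\{a_J \mid J\in[n]^k\}$ in $A$ we have $$[(u(a_J))]_{(k)} \le K_k\,\|u\|\,[(a_J)]_{(k)} .$$ Moreover, $K_k\le 2^{(3k/2)-1}$.
   Context: Notation: $[n]=\{1,\dots,n\}$. A $C^*$-algebra $A$ is regarded as embedded as a $C^*$-subalgebra of $B(H)$ for some Hilbert space $H$ (similarly $B\subset B(K)$). For $\alpha\subset\{1,\dots,k\}$ let $\alpha^c$ be its complement and let $\pi_\alpha\colon[n]^k\to[n]^\alpha$ be the canonical projection $\pi_\alpha(j_1,\dots,j_k)=(j_i)_{i\in\alpha}$. For a family $(a_J)_{J\in[n]^k}$ in $A$ and $\alpha\subset\{1,\dots,k\}$ with $\alpha\neq\emptyset$, $\alpha^c\ne\emptyset$, define $$\|(a_J)\|_\alpha=\sup\Big|\sum_{J\in[n]^k}\langle a_J x_{\pi_\alpha(J)},\,y_{\pi_{\alpha^c}(J)}\rangle\Big|,$$ the supremum being over all families $\{x_\ell\mid \ell\in[n]^\alpha\}$ and $\{y_m\mid m\in[n]^{\alpha^c}\}$ in $H$ with $\sum\|x_\ell\|^2\le1$ and $\sum\|y_m\|^2\le 1$ (i.e. the norm of $(a_J)$ viewed as a matrix acting from $\ell_2([n]^\alpha,H)$ to $\ell_2([n]^{\alpha^c},H)$). For $\alpha=\emptyset$ set $\|(a_J)\|_\emptyset=\big\|\big(\sum_J a_J^*a_J\big)^{1/2}\big\|$,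 and for $\alpha=\{1,\dots,k\}$ set $\|(a_J)\|_\alpha=\big\|\big(\sum_J a_Ja_J^*\big)^{1/2}\big\|$. Finally $$[(a_J)]_{(k)}=\max_{\alpha\subset\{1,\dots,k\}}\|(a_J)\|_\alpha .$$ The same definitions are used for families in $B$. *)

theory Defs
  imports "HOL-Analysis.Analysis"
begin

class complex_vector = real_vector +
  fixes scaleC :: "complex \<Rightarrow> 'a \<Rightarrow> 'a"  (infixr "*\<^sub>C" 75)
  assumes scaleC_add_right: "c *\<^sub>C (x + y) = c *\<^sub>C x + c *\<^sub>C y"
    and scaleC_add_left: "(c + d) *\<^sub>C x = c *\<^sub>C x + d *\<^sub>C x"
    and scaleC_scaleC: "c *\<^sub>C d *\<^sub>C x = (c * d) *\<^sub>C x"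
    and scaleC_of_real: "complex_of_real r *\<^sub>C x = r *\<^sub>R x"

(* The norm of real_inner is determined by the real inner product, so the last axiom makes
   norm x the square root of cinner x x, and it gives positive definiteness of cinner. *)
class complex_hilbert = complex_vector + real_inner + complete_space +
  fixes cinner :: "'a \<Rightarrow> 'a \<Rightarrow> complex"
  assumes cinner_commute: "cinner x y = cnj (cinner y x)"
    and cinner_add_left: "cinner (x + y) z = cinner x z + cinner y z"
    and cinner_scaleC_left: "cinner (c *\<^sub>C x) y = c * cinner x y"
    and Re_cinner: "Re (cinner x y) = inner x y"

instantiation complex :: complex_hilbert
begin

definition scaleC_complex :: "complex \<Rightarrow> complex \<Rightarrow> complex"
  where "scaleC_complex c z = c * z"

definition cinner_complex :: "complex \<Rightarrow> complex \<Rightarrow> complex"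
  where "cinner_complex z w = z * cnj w"

instance
  by standard
    (auto simp: scaleC_complex_def cinner_complex_def inner_complex_def algebra_simps scaleR_conv_of_real)

end

lemma norm_scaleC:
  fixes x :: "'a :: complex_hilbert"
  shows "norm (c *\<^sub>C x) = cmod c * norm x"
proof -
  have "cinner x (c *\<^sub>C x) = cnj c * cinner x x"
    by (metis cinner_commute cinner_scaleC_left complex_cnj_mult)
  then have "cinner (c *\<^sub>C x) (c *\<^sub>C x) = (c * cnj c) * cinner x x"
    by (simp add: cinner_scaleC_left)
  then have "cinner (c *\<^sub>C x) (c *\<^sub>C x) = complex_of_real ((cmod c)\<^sup>2) * cinner x x"
    by (simp only: complex_norm_square)
  then have "Re (cinner (c *\<^sub>C x) (c *\<^sub>C x)) = (cmod c)\<^sup>2 * Re (cinner x x)"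
    by simp
  then show ?thesis
    by (simp add: Re_cinner norm_eq_sqrt_inner real_sqrt_mult)
qed

lemma bounded_linear_scaleC:
  "bounded_linear (\<lambda>x :: 'a :: complex_hilbert. c *\<^sub>C x)"
proof (rule bounded_linear_intro)
  fix r and x :: 'a
  show "c *\<^sub>C r *\<^sub>R x = r *\<^sub>R c *\<^sub>C x"
    by (metis mult.commute scaleC_of_real scaleC_scaleC)
  show "norm (c *\<^sub>C x) \<le> norm x * cmod c"
    by (simp add: norm_scaleC)
qed (rule scaleC_add_right)

instantiation blinfun :: (real_normed_vector, complex_hilbert) complex_vector
begin

lift_definition scaleC_blinfun :: "complex \<Rightarrow> 'a \<Rightarrow>\<^sub>L 'b \<Rightarrow> 'a \<Rightarrow>\<^sub>L 'b"
  is "\<lambda>c f x. c *\<^sub>C f x"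
  by (rule bounded_linear_compose[OF bounded_linear_scaleC])

instance
  by standard
    (transfer, simp add: scaleC_add_right scaleC_add_left scaleC_scaleC scaleC_of_real)+

end

(* Elements of 'h =>L 'h are only real-linear; B(H) consists of those satisfying this predicate,
   and the operator norm is the same in both cases. *)
definition complex_linear_op :: "('h :: complex_hilbert \<Rightarrow>\<^sub>L 'h) \<Rightarrow> bool"
  where "complex_linear_op T \<longleftrightarrow> (\<forall>c x. T (c *\<^sub>C x) = c *\<^sub>C T x)"

definition op_adjoint :: "('h :: complex_hilbert \<Rightarrow>\<^sub>L 'h) \<Rightarrow> 'h \<Rightarrow>\<^sub>L 'h"
  where "op_adjoint T = (THE S :: 'h \<Rightarrow>\<^sub>L 'h. \<forall>x y. cinner (T x) y = cinner x (S y))"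

definition positive_op :: "('h :: complex_hilbert \<Rightarrow>\<^sub>L 'h) \<Rightarrow> bool"
  where "positive_op T \<longleftrightarrow> complex_linear_op T \<and> (\<forall>x. cinner (T x) x \<in> \<real>\<^sub>\<ge>\<^sub>0)"

definition op_sqrt :: "('h :: complex_hilbert \<Rightarrow>\<^sub>L 'h) \<Rightarrow> 'h \<Rightarrow>\<^sub>L 'h"
  where "op_sqrt T = (THE S. positive_op S \<and> S o\<^sub>L S = T)"

(* Not required to be unital. *)
definition cstar_subalgebra :: "('h :: complex_hilbert \<Rightarrow>\<^sub>L 'h) set \<Rightarrow> bool"
  where "cstar_subalgebra A \<longleftrightarrow>
    (\<forall>S\<in>A. complex_linear_op S) \<and>
    0 \<in> A \<and>
    (\<forall>S\<in>A. \<forall>T\<in>A. S + T \<in> A) \<and>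
    (\<forall>c. \<forall>S\<in>A. c *\<^sub>C S \<in> A) \<and>
    (\<forall>S\<in>A. \<forall>T\<in>A. S o\<^sub>L T \<in> A) \<and>
    (\<forall>S\<in>A. op_adjoint S \<in> A) \<and>
    closed A"

definition bounded_complex_linear_on ::
    "('h :: complex_hilbert \<Rightarrow>\<^sub>L 'h) set \<Rightarrow> ('g :: complex_hilbert \<Rightarrow>\<^sub>L 'g) set \<Rightarrow>
      (('h \<Rightarrow>\<^sub>L 'h) \<Rightarrow> 'g \<Rightarrow>\<^sub>L 'g) \<Rightarrow> bool"
  where "bounded_complex_linear_on A B u \<longleftrightarrow>
    (\<forall>S\<in>A. u S \<in> B) \<and>
    (\<forall>S\<in>A. \<forall>T\<in>A. u (S + T) = u S + u T) \<and>
    (\<forall>c. \<forall>S\<in>A. u (c *\<^sub>C S) = c *\<^sub>C u S) \<and>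
    (\<exists>M. \<forall>S\<in>A. norm (u S) \<le> M * norm S)"

definition norm_on :: "'a :: real_normed_vector set \<Rightarrow> ('a \<Rightarrow> 'b :: real_normed_vector) \<Rightarrow> real"
  where "norm_on A u = (SUP S\<in>{S \<in> A. norm S \<le> 1}. norm (u S))"

(* The set of alpha-indexed tuples with entries in [n] = {1..n}; the canonical projection of
   a multi-index J in multi_index n {1..k} onto multi_index n alpha is restrict J alpha. *)
definition multi_index :: "nat \<Rightarrow> nat set \<Rightarrow> (nat \<Rightarrow> nat) set"
  where "multi_index n \<alpha> = \<alpha> \<rightarrow>\<^sub>E {1..n}"

definition family_norm ::
    "nat \<Rightarrow> nat \<Rightarrow> nat set \<Rightarrow> ((nat \<Rightarrow> nat) \<Rightarrow> 'h :: complex_hilbert \<Rightarrow>\<^sub>L 'h) \<Rightarrow> real"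
  where "family_norm k n \<alpha> a =
    (if \<alpha> = {} then
       norm (op_sqrt (\<Sum>J\<in>multi_index n {1..k}. op_adjoint (a J) o\<^sub>L a J))
     else if \<alpha> = {1..k} then
       norm (op_sqrt (\<Sum>J\<in>multi_index n {1..k}. a J o\<^sub>L op_adjoint (a J)))
     else
       (SUP (x, y) \<in> {(x, y).
            (\<Sum>l\<in>multi_index n \<alpha>. (norm (x l))\<^sup>2) \<le> 1 \<and>
            (\<Sum>m\<in>multi_index n ({1..k} - \<alpha>). (norm (y m))\<^sup>2) \<le> 1}.
          cmod (\<Sum>J\<in>multi_index n {1..k}.
            cinner (a J (x (restrict J \<alpha>))) (y (restrict J ({1..k} - \<alpha>))))))"

definition max_norm ::
    "nat \<Rightarrow> nat \<Rightarrow> ((nat \<Rightarrow> nat) \<Rightarrow> 'h :: complex_hilbert \<Rightarrow>\<^sub>L 'h) \<Rightarrow> real"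
  where "max_norm k n a = (MAX \<alpha>\<in>Pow {1..k}. family_norm k n \<alpha> a)"

end

(* [(a_J)]_(k) is the norm of sum_J a_J (x) e_J in the minimal tensor product of A with k copies of
   E, the n-dimensional operator space "intersection of row and column" (max_alpha ranges over the choices of
   row or column in each factor).  Let F be the algebra generated by n free semicircular operators
   s_i = l_i + l_i^* on the full Fock space.  The map e_i -> s_i has completely bounded norm at most 2,
   and, because the vacuum state is a trace on F, the map x -> (<x vacuum, s_i vacuum>)_i from F to E
   is completely contractive and inverts it.  The little Grothendieck inequality, in Haagerup's form
     sum |u(a_j)|^2 <= |u|^2 (|sum a_j^* a_j| + |sum a_j a_j^*|)
   for Hilbert space valued u, says that u (x) id : A (x) E -> B (x) E has norm at most sqrt 2 |u|.
   This is the case k = 1; replacing u by the map A (x) F -> B (x) E obtained from the two facts passes from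
   k to k + 1 at the cost of a factor 2 sqrt 2, which yields sqrt 2 (2 sqrt 2)^(k - 1) = 2^(3k/2 - 1).
   The Grothendieck inequality needs no closedness, so F (x) A is replaced by a *-algebra of operators.
   To keep all algebras of the induction on one Hilbert space, H is first replaced by l_2(H), which
   absorbs the Fock space. *)
theory Submission
  imports Defs
begin

section \<open>Operators on complex Hilbert spaces\<close>

text \<open>The usual variational proof of Haagerup's inequality differentiates at a unitary where u
  attains its norm. The algebras of the induction need have neither limits nor a unit, so the
  argument runs at a contraction V that is only almost extremal, and V is completed to a unitary on
  H x H. The completion contains square roots that may leave the algebra, but they cancel in the
  corners that are used: these are polynomials in V, a and their adjoints. The 2 has two halves. The
  creation part of s_i is controlled by the norm with the new index as a column index, the
  annihilation part by the norm with it as a row index, and both norms occur in the maximum. The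
  sqrt 2 comes from the two terms of Haagerup's inequality, a column and a row term. For the vacuum
  coefficients of x the column term is at most |x|^2 by Bessel's inequality; for the row term this
  fails for general operators and is where the trace property enters. No copy of E is formed on the
  target side: once \<alpha> is given, the new index is absorbed into the operators as a row or as a
  column.\<close>

lemma cinner_scaleC_right:
  fixes x :: "'a :: complex_hilbert"
  shows "cinner x (c *\<^sub>C y) = cnj c * cinner x y"
  by (metis cinner_commute cinner_scaleC_left complex_cnj_mult)

lemma inner_scaleC_left:
  fixes x :: "'a :: complex_hilbert"
  shows "inner (c *\<^sub>C x) y = inner x (cnj c *\<^sub>C y)"
  by (simp flip: Re_cinner add: cinner_scaleC_left cinner_scaleC_right)

lemma cinner_eq_Complex:
  fixes x :: "'a :: complex_hilbert"
  shows "cinner x y = Complex (inner x y) (inner x (\<i> *\<^sub>C y))"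
  by (simp flip: Re_cinner add: cinner_scaleC_right complex_eq_iff)

lemma scaleC_minus1: "(-1) *\<^sub>C x = - (x :: 'a :: complex_vector)"
  using scaleC_of_real[of "-1" x] by simp

lemma scaleC_one: "1 *\<^sub>C x = (x :: 'a :: complex_vector)"
  using scaleC_of_real[of 1 x] by simp

lemma scaleC_ii_ii: "\<i> *\<^sub>C \<i> *\<^sub>C x = - (x :: 'a :: complex_vector)"
  by (simp add: scaleC_scaleC scaleC_minus1)

lemma inner_ii_left:
  fixes x :: "'a :: complex_hilbert"
  shows "inner (\<i> *\<^sub>C x) y = - inner x (\<i> *\<^sub>C y)"
proof -
  have "(-\<i>) *\<^sub>C y = - (\<i> *\<^sub>C y)" by (metis scaleC_scaleC scaleC_minus1 mult_minus1)
  then show ?thesis by (simp add: inner_scaleC_left)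
qed

lemma scaleC_scaleR: "c *\<^sub>C r *\<^sub>R x = r *\<^sub>R c *\<^sub>C (x :: 'a :: complex_vector)"
  by (metis mult.commute scaleC_of_real scaleC_scaleC)

lemma scaleC_zero_right: "c *\<^sub>C (0 :: 'a :: complex_vector) = 0"
  using scaleC_add_right[of c 0 0] by simp

lemma scaleC_minus_right: "c *\<^sub>C (- x) = - (c *\<^sub>C (x :: 'a :: complex_vector))"
  by (metis add.right_inverse add_eq_0_iff scaleC_add_right scaleC_zero_right)

lemma scaleC_diff_right: "c *\<^sub>C (x - y) = c *\<^sub>C x - c *\<^sub>C (y :: 'a :: complex_vector)"
  by (metis diff_conv_add_uminus scaleC_add_right scaleC_minus_right)

lemma scaleC_sum_right: "c *\<^sub>C (\<Sum>i\<in>I. f i) = (\<Sum>i\<in>I. c *\<^sub>C (f i :: 'a :: complex_vector))"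
  by (induction I rule: infinite_finite_induct) (auto simp: scaleC_zero_right scaleC_add_right)

section \<open>Riesz representation and adjoints\<close>

lemma norm_ge_inner_imp:
  fixes y :: "'a :: real_inner"
  assumes "\<And>z. inner y z \<le> c * norm z" "c \<ge> 0"
  shows "norm y \<le> c"
proof (cases "y = 0")
  case False
  have "norm y * norm y \<le> c * norm y"
    using assms(1)[of y] unfolding dot_square_norm power2_eq_square .
  then show ?thesis by (rule mult_right_le_imp_le) (use False in simp)
qed (use assms(2) in simp)

lemma inner_eqI:
  fixes y z :: "'a :: real_inner"
  assumes "\<And>x. inner x y = inner x z"
  shows "y = z"
  by (rule iffD1[OF vector_eq_rdot]) (metis assms inner_commute)

text \<open>Minimising the quadratic functional \<open>F\<close> replaces projection onto the
  kernel: the parallelogram identity makes a minimising sequence Cauchy, and stationarity at the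
  minimiser is the representation.\<close>

lemma riesz:
  fixes \<phi> :: "'a :: {real_inner, complete_space} \<Rightarrow> real"
  assumes "bounded_linear \<phi>"
  shows "\<exists>z. \<forall>x. \<phi> x = inner x z"
proof -
  interpret bounded_linear \<phi> by fact
  define F where "F x = (norm x)\<^sup>2 - 2 * \<phi> x" for x
  obtain K where K: "\<And>x. norm (\<phi> x) \<le> norm x * K" using bounded by blast
  have lower: "F x \<ge> - K\<^sup>2" for x
  proof -
    have "\<phi> x \<le> norm x * K" using K[of x] by simp
    moreover have "0 \<le> (norm x - K)\<^sup>2" by simp
    ultimately show ?thesis unfolding F_def by (simp add: power2_eq_square algebra_simps)
  qed
  define m where "m = (INF x. F x)"
  have bdd: "bdd_below (range F)" using lower by (auto intro!: bdd_belowI2)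
  have m_le: "m \<le> F x" for x unfolding m_def using bdd by (intro cINF_lower) auto
  have "\<exists>x. F x < m + inverse (real (Suc n))" for n
    using cINF_less_iff[of UNIV F "m + inverse (real (Suc n))"] bdd unfolding m_def by auto
  then obtain f where f: "\<And>n. F (f n) < m + inverse (real (Suc n))" by metis
  have half: "F ((1/2) *\<^sub>R x) = (norm x)\<^sup>2 / 4 - \<phi> x" for x
    unfolding F_def by (simp add: scaleR power_divide)
  have par: "(norm (x - y))\<^sup>2 = 2 * F x + 2 * F y - 4 * F ((1/2) *\<^sub>R (x + y))" for x y
    unfolding half unfolding F_def
    by (simp add: add power2_norm_eq_inner inner_add_left inner_add_right inner_diff_left inner_diff_right inner_commute[of y x] add_divide_distrib)
  have near: "(norm (x - y))\<^sup>2 \<le> 2 * (F x - m) + 2 * (F y - m)" for x y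
    using par[of x y] m_le[of "(1/2) *\<^sub>R (x + y)"] by simp
  have "Cauchy f"
  proof (rule metric_CauchyI)
    fix e :: real assume "e > 0"
    then obtain N where N: "inverse (real (Suc N)) < e\<^sup>2 / 4"
      using reals_Archimedean[of "e\<^sup>2/4"] by auto
    have "dist (f i) (f j) < e" if "i \<ge> N" "j \<ge> N" for i j
    proof -
      have small: "F (f i) - m < e\<^sup>2/4" if "i \<ge> N" for i
      proof -
        have "inverse (real (Suc i)) \<le> inverse (real (Suc N))"
          using that by (intro le_imp_inverse_le) auto
        then show ?thesis using f[of i] N by linarith
      qed
      have "(norm (f i - f j))\<^sup>2 < e\<^sup>2" using near[of "f i" "f j"] small[OF that(1)] small[OF that(2)] by simp
      then show ?thesis using \<open>e > 0\<close> by (simp add: dist_norm power2_less_imp_less)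
    qed
    then show "\<exists>M. \<forall>m\<ge>M. \<forall>n\<ge>M. dist (f m) (f n) < e" by blast
  qed
  then obtain z where z: "f \<longlonglongrightarrow> z" by (auto simp: Cauchy_convergent_iff convergent_def)
  have lim: "(\<lambda>n. F (f n)) \<longlonglongrightarrow> F z"
    unfolding F_def by (intro tendsto_intros tendsto z)
  have "(\<lambda>n. m + inverse (real (Suc n))) \<longlonglongrightarrow> m + 0"
    by (intro tendsto_intros LIMSEQ_inverse_real_of_nat)
  then have "F z \<le> m + 0" by (rule LIMSEQ_le[OF lim]) (use f less_imp_le in blast)
  then have Fz: "F z \<le> m" by simp
  have "\<phi> x = inner x z" for x
  proof (rule ccontr)
    define d where "d = \<phi> x - inner x z"
    assume "\<phi> x \<noteq> inner x z"
    then have d: "d \<noteq> 0" by (simp add: d_def)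
    have q: "2 * t * d \<le> t\<^sup>2 * (norm x)\<^sup>2" for t
      using m_le[of "z + t *\<^sub>R x"] Fz unfolding F_def d_def
      by (simp add: add scaleR power2_norm_eq_inner inner_add_left inner_add_right inner_commute[of z x])
        (simp add: power2_eq_square algebra_simps)
    have x: "x \<noteq> 0" using d by (auto simp: d_def zero)
    have "0 < d * d" using d by (simp flip: power2_eq_square)
    \<comment> \<open>This t minimises t^2 |x|^2 - 2 t d; the minimum is negative, against the
      minimality of z.\<close>
    then show False using q[of "d / (norm x)\<^sup>2"] x by (simp add: power2_eq_square divide_simps)
  qed
  then show ?thesis by blast
qed

lemma adjoint_exists:
  fixes T :: "'h :: complex_hilbert \<Rightarrow>\<^sub>L 'g :: complex_hilbert"
  shows "\<exists>S :: 'g \<Rightarrow>\<^sub>L 'h. \<forall>x y. inner (T x) y = inner x (S y)"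
proof -
  have "\<exists>z. \<forall>x. inner (T x) y = inner x z" for y
    by (intro riesz bounded_linear_compose[OF bounded_linear_inner_left] blinfun.bounded_linear_right)
  then obtain S where S: "\<And>x y. inner (T x) y = inner x (S y)" by metis
  have "bounded_linear S"
  proof (rule bounded_linear_intro)
    fix x y :: 'g and r
    have "inner w (S (x + y)) = inner w (S x + S y)" "inner w (S (r *\<^sub>R x)) = inner w (r *\<^sub>R S x)" for w
      by (simp_all flip: S add: inner_simps)
    note eqs = this
    show "S (x + y) = S x + S y" by (rule inner_eqI) (rule eqs(1))
    show "S (r *\<^sub>R x) = r *\<^sub>R S x" by (rule inner_eqI) (rule eqs(2))
    show "norm (S x) \<le> norm x * norm T"
    proof (rule norm_ge_inner_imp)
      fix z
      have "inner (S x) z = inner (T z) x" by (metis S inner_commute)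
      also have "\<dots> \<le> norm (T z) * norm x" by (rule norm_cauchy_schwarz)
      also have "\<dots> \<le> norm T * norm z * norm x" by (intro mult_right_mono norm_blinfun) auto
      finally show "inner (S x) z \<le> norm x * norm T * norm z" by (simp add: mult_ac)
    qed simp
  qed
  then show ?thesis using S by (intro exI[of _ "Blinfun S"]) (simp add: bounded_linear_Blinfun_apply)
qed

lemma clinD: "complex_linear_op T \<Longrightarrow> T (c *\<^sub>C x) = c *\<^sub>C T x"
  by (simp add: complex_linear_op_def)

text \<open>The imaginary part of \<open>cinner\<close> is the real inner product against i y, and
  complex linearity of T forces its real adjoint to commute with i. Hence all later arguments about
  adjoints use the real inner product alone.\<close>

lemma cinner_adjoint_iff:
  fixes T S :: "'h :: complex_hilbert \<Rightarrow>\<^sub>L 'h"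
  assumes "complex_linear_op T"
  shows "(\<forall>x y. cinner (T x) y = cinner x (S y)) \<longleftrightarrow> (\<forall>x y. inner (T x) y = inner x (S y))"
proof safe
  fix x y assume *: "\<forall>x y. inner (T x) y = inner x (S y)"
  have "inner x (S (\<i> *\<^sub>C y)) = inner x (\<i> *\<^sub>C S y)" for x
  proof -
    have "inner x (\<i> *\<^sub>C S y) = inner (cnj \<i> *\<^sub>C x) (S y)" by (metis complex_cnj_cnj inner_scaleC_left)
    also have "\<dots> = inner (cnj \<i> *\<^sub>C T x) y" by (metis * assms clinD)
    also have "\<dots> = inner (T x) (\<i> *\<^sub>C y)" by (metis complex_cnj_cnj inner_scaleC_left)
    finally show ?thesis using * by simp
  qed
  with * show "cinner (T x) y = cinner x (S y)" unfolding cinner_eq_Complex by simp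
qed (simp flip: Re_cinner)

lemma op_adjoint_eqI:
  fixes T S :: "'h :: complex_hilbert \<Rightarrow>\<^sub>L 'h"
  assumes "complex_linear_op T" "\<And>x y. inner (T x) y = inner x (S y)"
  shows "op_adjoint T = S"
  unfolding op_adjoint_def cinner_adjoint_iff[OF assms(1)]
proof (rule the_equality)
  fix S' :: "'h \<Rightarrow>\<^sub>L 'h" assume "\<forall>x y. inner (T x) y = inner x (S' y)"
  then have "inner x (S' y) = inner x (S y)" for x y by (simp flip: assms(2))
  then show "S' = S" by (metis blinfun_eqI inner_eqI)
qed (use assms in blast)

lemma inner_adjoint:
  fixes T :: "'h :: complex_hilbert \<Rightarrow>\<^sub>L 'h"
  assumes "complex_linear_op T"
  shows "inner (T x) y = inner x (op_adjoint T y)"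
  using adjoint_exists[of T] op_adjoint_eqI[OF assms] by metis

lemma inner_adjoint':
  fixes T :: "'h :: complex_hilbert \<Rightarrow>\<^sub>L 'h"
  assumes "complex_linear_op T"
  shows "inner (op_adjoint T x) y = inner x (T y)"
  by (metis assms inner_adjoint inner_commute)

lemma clin_adjoint:
  fixes T :: "'h :: complex_hilbert \<Rightarrow>\<^sub>L 'h"
  assumes "complex_linear_op T"
  shows "complex_linear_op (op_adjoint T)"
  unfolding complex_linear_op_def
proof (intro allI)
  fix c and y :: 'h
  have "inner x (op_adjoint T (c *\<^sub>C y)) = inner x (c *\<^sub>C op_adjoint T y)" for x
    by (metis assms clinD complex_cnj_cnj inner_adjoint inner_scaleC_left)
  then show "op_adjoint T (c *\<^sub>C y) = c *\<^sub>C op_adjoint T y" by (rule inner_eqI)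
qed

lemma clin_zero [simp]: "complex_linear_op 0"
  by (simp add: complex_linear_op_def scaleC_zero_right)

lemma clin_id [simp]: "complex_linear_op id_blinfun"
  by (simp add: complex_linear_op_def)

lemma clin_add: "complex_linear_op S \<Longrightarrow> complex_linear_op T \<Longrightarrow> complex_linear_op (S + T)"
  by (simp add: complex_linear_op_def blinfun.add_left scaleC_add_right)

lemma clin_diff: "complex_linear_op S \<Longrightarrow> complex_linear_op T \<Longrightarrow> complex_linear_op (S - T)"
  by (simp add: complex_linear_op_def blinfun.diff_left scaleC_diff_right)

lemma clin_scaleR: "complex_linear_op S \<Longrightarrow> complex_linear_op (r *\<^sub>R S)"
  by (simp add: complex_linear_op_def blinfun.scaleR_left scaleC_scaleR)

lemma scaleC_blinfun_apply: "blinfun_apply (c *\<^sub>C T) x = c *\<^sub>C blinfun_apply T x"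
  by transfer simp

lemma clin_scaleC: "complex_linear_op S \<Longrightarrow> complex_linear_op (c *\<^sub>C S)"
  by (simp add: complex_linear_op_def scaleC_blinfun_apply scaleC_scaleC mult.commute)

lemma clin_comp: "complex_linear_op S \<Longrightarrow> complex_linear_op T \<Longrightarrow> complex_linear_op (S o\<^sub>L T)"
  by (simp add: complex_linear_op_def)

lemma clin_sum: "(\<And>i. i \<in> I \<Longrightarrow> complex_linear_op (f i)) \<Longrightarrow> complex_linear_op (\<Sum>i\<in>I. f i)"
  by (induction I rule: infinite_finite_induct) (auto intro: clin_add)

lemma adjoint_adjoint: "complex_linear_op T \<Longrightarrow> op_adjoint (op_adjoint T) = T"
  by (intro op_adjoint_eqI clin_adjoint) (auto simp: inner_adjoint')

lemma adjoint_add: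
  "complex_linear_op S \<Longrightarrow> complex_linear_op T \<Longrightarrow> op_adjoint (S + T) = op_adjoint S + op_adjoint T"
  by (intro op_adjoint_eqI clin_add) (auto simp: blinfun.add_left inner_simps inner_adjoint)

lemma adjoint_comp:
  "complex_linear_op S \<Longrightarrow> complex_linear_op T \<Longrightarrow> op_adjoint (S o\<^sub>L T) = op_adjoint T o\<^sub>L op_adjoint S"
  by (intro op_adjoint_eqI clin_comp) (auto simp: inner_adjoint)

lemma adjoint_scaleC:
  "complex_linear_op S \<Longrightarrow> op_adjoint (c *\<^sub>C S) = cnj c *\<^sub>C op_adjoint S"
  by (intro op_adjoint_eqI clin_scaleC) (auto simp: scaleC_blinfun_apply inner_scaleC_left inner_adjoint clinD clin_adjoint)

lemma adjoint_zero [simp]: "op_adjoint 0 = 0"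
  by (intro op_adjoint_eqI) auto

lemma adjoint_id [simp]: "op_adjoint id_blinfun = id_blinfun"
  by (intro op_adjoint_eqI) auto

lemma norm_adjoint_le:
  assumes "complex_linear_op T"
  shows "norm (op_adjoint T) \<le> norm T"
proof (rule norm_blinfun_bound)
  fix x
  show "norm (op_adjoint T x) \<le> norm T * norm x"
  proof (rule norm_ge_inner_imp)
    fix z
    have "inner (op_adjoint T x) z = inner x (T z)" using assms by (rule inner_adjoint')
    also have "\<dots> \<le> norm x * norm (T z)" by (rule norm_cauchy_schwarz)
    also have "\<dots> \<le> norm x * (norm T * norm z)" by (intro mult_left_mono norm_blinfun) auto
    finally show "inner (op_adjoint T x) z \<le> norm T * norm x * norm z" by (simp add: mult_ac)
  qed simp
qed simp

lemma norm_scaleC_blinfun: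
  fixes T :: "'h :: complex_hilbert \<Rightarrow>\<^sub>L 'g :: complex_hilbert"
  shows "norm (c *\<^sub>C T) = cmod c * norm T"
proof -
  have le: "norm (c *\<^sub>C T) \<le> cmod c * norm T" for c and T :: "'h \<Rightarrow>\<^sub>L 'g"
  proof (rule norm_blinfun_bound)
    fix x
    show "norm ((c *\<^sub>C T) x) \<le> cmod c * norm T * norm x"
      unfolding scaleC_blinfun_apply norm_scaleC mult.assoc by (intro mult_left_mono norm_blinfun) simp
  qed simp
  show ?thesis
  proof (cases "c = 0")
    case True then show ?thesis using le[of 0 T] by simp
  next
    case False
    have "norm T = norm (inverse c *\<^sub>C c *\<^sub>C T)" using False by (simp add: scaleC_scaleC scaleC_one)
    also have "\<dots> \<le> inverse (cmod c) * norm (c *\<^sub>C T)" using le[of "inverse c" "c *\<^sub>C T"] by (simp add: norm_inverse)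
    finally have "cmod c * norm T \<le> norm (c *\<^sub>C T)" using False by (simp add: field_simps)
    then show ?thesis using le[of c T] by simp
  qed
qed

section \<open>Square roots of positive operators\<close>

instance complex_hilbert \<subseteq> banach ..

lemmas comp_add_left = bounded_bilinear.add_left[OF bounded_bilinear_blinfun_compose]
lemmas comp_add_right = bounded_bilinear.add_right[OF bounded_bilinear_blinfun_compose]
lemmas comp_diff_left = bounded_bilinear.diff_left[OF bounded_bilinear_blinfun_compose]
lemmas comp_diff_right = bounded_bilinear.diff_right[OF bounded_bilinear_blinfun_compose]
lemmas comp_scaleR_left = bounded_bilinear.scaleR_left[OF bounded_bilinear_blinfun_compose]
lemmas comp_scaleR_right = bounded_bilinear.scaleR_right[OF bounded_bilinear_blinfun_compose]
lemmas tendsto_comp = bounded_bilinear.tendsto[OF bounded_bilinear_blinfun_compose]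

lemma comp_assoc: "(R o\<^sub>L S) o\<^sub>L T = R o\<^sub>L (S o\<^sub>L T)"
  by (auto intro: blinfun_eqI)

(* For norm X <= 1 the limit Y satisfies Y = (X + Y^2)/2, i.e. (1 - Y)^2 = 1 - X. *)
fun sq_iter :: "('h :: complex_hilbert \<Rightarrow>\<^sub>L 'h) \<Rightarrow> nat \<Rightarrow> 'h \<Rightarrow>\<^sub>L 'h" where
  "sq_iter X 0 = 0"
| "sq_iter X (Suc n) = (1/2) *\<^sub>R (X + (sq_iter X n o\<^sub>L sq_iter X n))"

text \<open>The same iteration for the scalar X = 1. It is increasing and bounded, and it dominates
  \<open>sq_iter\<close>; at norm X = 1 no geometric rate is available.\<close>

fun sq_real :: "nat \<Rightarrow> real" where
  "sq_real 0 = 0"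
| "sq_real (Suc n) = (1 + sq_real n * sq_real n) / 2"

lemma sq_real_bounds: "0 \<le> sq_real n \<and> sq_real n \<le> 1"
proof (induction n)
  case (Suc n)
  then have "sq_real n * sq_real n \<le> 1 * 1" by (intro mult_mono) auto
  with Suc show ?case by simp
qed simp

lemma sq_real_Cauchy: "Cauchy sq_real"
proof -
  have "incseq sq_real"
  proof (rule incseq_SucI)
    fix n
    have "0 \<le> (1 - sq_real n) * (1 - sq_real n)" by simp
    then show "sq_real n \<le> sq_real (Suc n)" by (simp add: algebra_simps)
  qed
  then show ?thesis
    by (metis incseq_convergent sq_real_bounds LIMSEQ_imp_Cauchy)
qed

lemma norm_sq_iter:
  assumes "norm X \<le> 1"
  shows "norm (sq_iter X n) \<le> sq_real n"
proof (induction n)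
  case (Suc n)
  have "norm (sq_iter X (Suc n)) = norm (X + (sq_iter X n o\<^sub>L sq_iter X n)) / 2" by simp
  also have "norm (X + (sq_iter X n o\<^sub>L sq_iter X n)) \<le> norm X + norm (sq_iter X n) * norm (sq_iter X n)"
    by (rule norm_triangle_le) (simp add: norm_blinfun_compose)
  also have "\<dots> \<le> 1 + sq_real n * sq_real n"
    using Suc assms by (intro add_mono mult_mono) (auto simp: sq_real_bounds)
  finally show ?case by simp
qed simp

text \<open>The iterates are polynomials in X with nonnegative coefficients that grow with n, so
  increments are largest for the scalar 1. The induction uses Y^2 - Z^2 = Y (Y - Z) + (Y - Z)
  Z.\<close>

lemma norm_sq_iter_diff:
  assumes "norm X \<le> 1" "n \<le> m"
  shows "norm (sq_iter X m - sq_iter X n) \<le> sq_real m - sq_real n"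
  using assms(2)
proof (induction n arbitrary: m)
  case 0
  then show ?case using norm_sq_iter[OF assms(1)] by simp
next
  case (Suc n)
  then obtain m' where m: "m = Suc m'" "n \<le> m'" by (metis Suc_le_D Suc_le_mono)
  let ?Y = "sq_iter X m'" and ?Z = "sq_iter X n"
  note IH = Suc.IH[OF m(2)]
  have "sq_iter X m - sq_iter X (Suc n) = (1/2) *\<^sub>R ((?Y o\<^sub>L (?Y - ?Z)) + ((?Y - ?Z) o\<^sub>L ?Z))"
    by (simp add: m comp_diff_left comp_diff_right scaleR_diff_right scaleR_add_right)
  then have "norm (sq_iter X m - sq_iter X (Suc n)) = norm ((?Y o\<^sub>L (?Y - ?Z)) + ((?Y - ?Z) o\<^sub>L ?Z)) / 2"
    by simp
  also have "norm ((?Y o\<^sub>L (?Y - ?Z)) + ((?Y - ?Z) o\<^sub>L ?Z)) \<le> norm ?Y * norm (?Y - ?Z) + norm (?Y - ?Z) * norm ?Z"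
    by (intro norm_triangle_le add_mono norm_blinfun_compose)
  also have "\<dots> \<le> sq_real m' * (sq_real m' - sq_real n) + (sq_real m' - sq_real n) * sq_real n"
    using IH norm_sq_iter[OF assms(1)] order_trans[OF norm_ge_zero IH]
    by (intro add_mono mult_mono) (auto simp: sq_real_bounds)
  finally have "norm (sq_iter X m - sq_iter X (Suc n)) \<le>
    (sq_real m' * (sq_real m' - sq_real n) + (sq_real m' - sq_real n) * sq_real n) / 2" by simp
  also have "\<dots> = sq_real m - sq_real (Suc n)" by (simp add: m algebra_simps diff_divide_distrib)
  finally show ?case .
qed

definition sq_lim :: "('h :: complex_hilbert \<Rightarrow>\<^sub>L 'h) \<Rightarrow> 'h \<Rightarrow>\<^sub>L 'h"
  where "sq_lim X = lim (sq_iter X)"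

lemma sq_lim:
  assumes "norm X \<le> 1"
  shows "sq_iter X \<longlonglongrightarrow> sq_lim X"
proof -
  have "Cauchy (sq_iter X)"
  proof (rule metric_CauchyI)
    fix e :: real assume "e > 0"
    then obtain N where N: "\<And>m n. m \<ge> N \<Longrightarrow> n \<ge> N \<Longrightarrow> dist (sq_real m) (sq_real n) < e"
      using metric_CauchyD[OF sq_real_Cauchy] by blast
    have "dist (sq_iter X m) (sq_iter X n) < e" if "m \<ge> N" "n \<ge> N" for m n
      using N[OF that] norm_sq_iter_diff[OF assms, of n m] norm_sq_iter_diff[OF assms, of m n]
      by (cases "n \<le> m") (auto simp: dist_norm norm_minus_commute abs_if split: if_splits)
    then show "\<exists>M. \<forall>m\<ge>M. \<forall>n\<ge>M. dist (sq_iter X m) (sq_iter X n) < e" by blast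
  qed
  then show ?thesis unfolding sq_lim_def
    by (simp add: Cauchy_convergent_iff convergent_LIMSEQ_iff)
qed

lemma norm_sq_lim:
  assumes "norm X \<le> 1"
  shows "norm (sq_lim X) \<le> 1"
proof (rule LIMSEQ_le_const2[OF tendsto_norm[OF sq_lim[OF assms]]])
  show "\<exists>N. \<forall>n\<ge>N. norm (sq_iter X n) \<le> 1"
    using norm_sq_iter[OF assms] sq_real_bounds order_trans by blast
qed

lemma sq_lim_eq:
  assumes "norm X \<le> 1"
  shows "sq_lim X = (1/2) *\<^sub>R (X + (sq_lim X o\<^sub>L sq_lim X))"
proof (rule LIMSEQ_unique)
  show "(\<lambda>n. sq_iter X (Suc n)) \<longlonglongrightarrow> sq_lim X" using sq_lim[OF assms] by (rule LIMSEQ_Suc)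
  show "(\<lambda>n. sq_iter X (Suc n)) \<longlonglongrightarrow> (1/2) *\<^sub>R (X + (sq_lim X o\<^sub>L sq_lim X))"
    unfolding sq_iter.simps by (intro tendsto_intros tendsto_comp sq_lim assms)
qed

lemma sq_lim_apply:
  fixes X :: "'h :: complex_hilbert \<Rightarrow>\<^sub>L 'h"
  assumes "norm X \<le> 1"
  shows "(\<lambda>n. sq_iter X n x) \<longlonglongrightarrow> sq_lim X x"
  by (intro blinfun.tendsto sq_lim assms tendsto_const)

lemma clin_sq_lim:
  fixes X :: "'h :: complex_hilbert \<Rightarrow>\<^sub>L 'h"
  assumes "norm X \<le> 1" "complex_linear_op X"
  shows "complex_linear_op (sq_lim X)"
  unfolding complex_linear_op_def
proof (intro allI, rule LIMSEQ_unique)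
  fix c and x :: 'h
  have "complex_linear_op (sq_iter X n)" for n
    by (induction n) (simp_all only: sq_iter.simps clin_zero clin_scaleR clin_add clin_comp assms)
  then have "sq_iter X n (c *\<^sub>C x) = c *\<^sub>C sq_iter X n x" for n by (simp add: clinD)
  then show "(\<lambda>n. sq_iter X n (c *\<^sub>C x)) \<longlonglongrightarrow> c *\<^sub>C sq_lim X x"
    using bounded_linear.tendsto[OF bounded_linear_scaleC sq_lim_apply[OF assms(1)]] by simp
qed (rule sq_lim_apply[OF assms(1)])

lemma selfadj_sq_lim:
  fixes X :: "'h :: complex_hilbert \<Rightarrow>\<^sub>L 'h"
  assumes "norm X \<le> 1" "\<And>x y. inner (X x) y = inner x (X y)"
  shows "inner (sq_lim X x) y = inner x (sq_lim X y)"
proof (rule LIMSEQ_unique)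
  have "inner (sq_iter X n x) y = inner x (sq_iter X n y)" for n x y
    by (induction n arbitrary: x y) (auto simp: blinfun.add_left blinfun.scaleR_left inner_simps assms(2))
  then show "(\<lambda>n. inner (sq_iter X n x) y) \<longlonglongrightarrow> inner x (sq_lim X y)"
    by (simp add: tendsto_inner sq_lim_apply assms(1))
qed (intro tendsto_inner tendsto_const sq_lim_apply assms(1))

text \<open>Needed twice: with X' = X it makes the square root commute with everything that commutes
  with X, and with X = V^* V, X' = V V^* it relates the two defect operators of V.\<close>

lemma intertwine_sq_lim:
  assumes "norm X \<le> 1" "norm X' \<le> 1" "V o\<^sub>L X = X' o\<^sub>L V"
  shows "V o\<^sub>L sq_lim X = sq_lim X' o\<^sub>L V"
proof (rule LIMSEQ_unique)
  have "V o\<^sub>L sq_iter X n = sq_iter X' n o\<^sub>L V" for n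
  proof (induction n)
    case (Suc n)
    have "V o\<^sub>L (sq_iter X n o\<^sub>L sq_iter X n) = (sq_iter X' n o\<^sub>L sq_iter X' n) o\<^sub>L V"
      by (metis Suc comp_assoc)
    then show ?case by (simp add: comp_scaleR_left comp_scaleR_right comp_add_left comp_add_right assms(3))
  qed (simp add: blinfun_eqI blinfun.zero_right)
  then show "(\<lambda>n. V o\<^sub>L sq_iter X n) \<longlonglongrightarrow> (sq_lim X' o\<^sub>L V)"
    using tendsto_comp[OF sq_lim[OF assms(2)] tendsto_const] by simp
qed (intro tendsto_comp tendsto_const sq_lim assms(1))

lemma sqrt_one_minus:
  fixes X :: "'h :: complex_hilbert \<Rightarrow>\<^sub>L 'h"
  assumes "norm X \<le> 1"
  shows "(id_blinfun - sq_lim X) o\<^sub>L (id_blinfun - sq_lim X) = id_blinfun - X"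
proof -
  let ?Y = "sq_lim X"
  have "2 *\<^sub>R ?Y = X + (?Y o\<^sub>L ?Y)" by (subst sq_lim_eq[OF assms]) simp
  then have eq: "?Y o\<^sub>L ?Y = ?Y + ?Y - X" by (simp add: scaleR_2)
  have "id_blinfun o\<^sub>L T = T" "T o\<^sub>L id_blinfun = T" for T :: "'h \<Rightarrow>\<^sub>L 'h"
    by (auto intro: blinfun_eqI)
  then show ?thesis by (simp add: comp_diff_left comp_diff_right eq)
qed

lemma one_minus_sq_lim_nonneg:
  fixes X :: "'h :: complex_hilbert \<Rightarrow>\<^sub>L 'h"
  assumes "norm X \<le> 1"
  shows "0 \<le> inner ((id_blinfun - sq_lim X) x) x"
proof -
  have "inner (sq_lim X x) x \<le> norm (sq_lim X x) * norm x" by (rule norm_cauchy_schwarz)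
  also have "\<dots> \<le> 1 * norm x * norm x"
    by (intro mult_right_mono order_trans[OF norm_blinfun] norm_sq_lim assms) auto
  finally show ?thesis by (simp add: blinfun.diff_left inner_diff_left dot_square_norm power2_eq_square)
qed

text \<open>A form that is real on the diagonal is Hermitian by polarisation; in terms of the real
  inner product this means polarising the vanishing imaginary part and then replacing y by -i
  y.\<close>

lemma positive_op_iff:
  fixes T :: "'h :: complex_hilbert \<Rightarrow>\<^sub>L 'h"
  shows "positive_op T \<longleftrightarrow> complex_linear_op T \<and> (\<forall>x y. inner (T x) y = inner x (T y)) \<and> (\<forall>x. 0 \<le> inner (T x) x)"
  (is "_ \<longleftrightarrow> ?R")
proof
  assume pos: "positive_op T"
  then have clin: "complex_linear_op T" and 1: "\<And>x. cinner (T x) x \<in> \<real>\<^sub>\<ge>\<^sub>0" by (auto simp: positive_op_def)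
  have ge: "0 \<le> inner (T x) x" for x using 1[of x] by (auto simp: complex_nonneg_Reals_iff Re_cinner)
  have im: "inner (T x) (\<i> *\<^sub>C x) = 0" for x
    using 1[of x] by (auto simp: complex_nonneg_Reals_iff cinner_eq_Complex)
  have im2: "inner (T x) (\<i> *\<^sub>C y) = - inner (T y) (\<i> *\<^sub>C x)" for x y
    using im[of "x + y"] by (simp add: blinfun.add_right scaleC_add_right inner_add_left inner_add_right im)
  have "inner (T x) y = inner x (T y)" for x y
  proof -
    have y: "\<i> *\<^sub>C (- (\<i> *\<^sub>C y)) = y" by (simp add: scaleC_minus_right scaleC_ii_ii)
    have "inner (T x) y = - inner (T (- (\<i> *\<^sub>C y))) (\<i> *\<^sub>C x)" using im2[of x "- (\<i> *\<^sub>C y)"] y by simp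
    also have "\<dots> = inner (\<i> *\<^sub>C T y) (\<i> *\<^sub>C x)" by (simp add: blinfun.minus_right clinD[OF clin])
    also have "\<dots> = inner x (T y)" by (simp add: inner_scaleC_left scaleC_scaleC scaleC_one inner_commute)
    finally show ?thesis .
  qed
  with clin ge show ?R by blast
next
  assume R: ?R
  then have clin: "complex_linear_op T" by blast
  have "inner (T x) (\<i> *\<^sub>C x) = 0" for x
  proof -
    have "inner (T x) (\<i> *\<^sub>C x) = inner (\<i> *\<^sub>C T x) x" by (metis clinD clin R inner_commute)
    also have "\<dots> = - inner (T x) (\<i> *\<^sub>C x)"
      by (rule inner_ii_left)
    finally show ?thesis by simp
  qed
  with R show "positive_op T"
    by (auto simp: positive_op_def complex_nonneg_Reals_iff cinner_eq_Complex)
qed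

text \<open>This is positivity of T at the vector M x - T x. It turns
  \<open>inner (T x) x = 0\<close> into \<open>T x = 0\<close>, and it shows that 1 - T/M is a
  contraction.\<close>

lemma positive_op_norm_apply:
  fixes T :: "'h :: complex_hilbert \<Rightarrow>\<^sub>L 'h"
  assumes "positive_op T" "norm T \<le> M" "M > 0"
  shows "(norm (T x))\<^sup>2 \<le> M * inner (T x) x"
proof -
  have sa: "\<And>x y. inner (T x) y = inner x (T y)" and pos: "\<And>x. 0 \<le> inner (T x) x"
    using assms(1) by (auto simp: positive_op_iff)
  have "inner (T (T x)) (T x) \<le> norm (T (T x)) * norm (T x)" by (rule norm_cauchy_schwarz)
  also have "\<dots> \<le> M * norm (T x) * norm (T x)"
    using assms(2) by (intro mult_right_mono order_trans[OF norm_blinfun]) auto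
  finally have T2: "inner (T (T x)) (T x) \<le> M * (norm (T x))\<^sup>2" by (simp add: power2_eq_square mult.assoc)
  have "0 \<le> inner (T (M *\<^sub>R x - T x)) (M *\<^sub>R x - T x)" by (rule pos)
  also have "\<dots> = M * M * inner (T x) x - 2 * M * (norm (T x))\<^sup>2 + inner (T (T x)) (T x)"
    by (simp add: blinfun.diff_right blinfun.scaleR_right inner_diff_left inner_diff_right sa[of "T x" x]
        power2_norm_eq_inner algebra_simps)
  finally have "M * (norm (T x))\<^sup>2 \<le> M * (M * inner (T x) x)" using T2 by simp
  then show ?thesis using assms(3) by simp
qed

text \<open>The root is sqrt M times the root of 1 - X for X = 1 - T/M. The commutation clause
  serves uniqueness: another positive root R commutes with T = R R, hence with this S.\<close>

lemma positive_sqrt_exists: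
  fixes T :: "'h :: complex_hilbert \<Rightarrow>\<^sub>L 'h"
  assumes "positive_op T"
  shows "\<exists>S. positive_op S \<and> S o\<^sub>L S = T \<and> (\<forall>R. R o\<^sub>L T = T o\<^sub>L R \<longrightarrow> R o\<^sub>L S = S o\<^sub>L R)"
proof -
  \<comment> \<open>The 1 keeps M positive when T = 0.\<close>
  define M where "M = norm T + 1"
  have M: "M > 0" "norm T \<le> M" by (auto simp: M_def add_nonneg_pos)
  have sa: "\<And>x y. inner (T x) y = inner x (T y)" and clin: "complex_linear_op T" and pos: "\<And>x. 0 \<le> inner (T x) x"
    using assms(1) by (auto simp: positive_op_iff)
  define X where "X = id_blinfun - (1/M) *\<^sub>R T"
  have X: "norm X \<le> 1"
  proof (rule norm_blinfun_bound)
    fix x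
    have "(norm (X x))\<^sup>2 = (norm x)\<^sup>2 - 2 / M * inner (T x) x + (norm (T x))\<^sup>2 / M\<^sup>2"
      unfolding X_def power2_norm_eq_inner
      by (simp add: blinfun.diff_left blinfun.scaleR_left inner_diff_left inner_diff_right sa[of x x] power2_eq_square diff_divide_distrib)
    also have "(norm (T x))\<^sup>2 / M\<^sup>2 \<le> inner (T x) x / M"
      using positive_op_norm_apply[OF assms M(2,1), of x] M(1) by (simp add: field_simps power2_eq_square)
    also have "(norm x)\<^sup>2 - 2 / M * inner (T x) x + inner (T x) x / M = (norm x)\<^sup>2 - inner (T x) x / M" by simp
    also have "\<dots> \<le> (norm x)\<^sup>2" using pos[of x] M(1) by simp
    finally show "norm (X x) \<le> 1 * norm x" by (simp add: power2_le_iff_abs_le)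
  qed simp
  have Xsa: "inner (X x) y = inner x (X y)" for x y
    by (simp add: X_def blinfun.diff_left blinfun.scaleR_left inner_diff_left inner_diff_right sa)
  have Xclin: "complex_linear_op X" unfolding X_def by (intro clin_diff clin_scaleR clin clin_id)
  define D where "D = id_blinfun - sq_lim X"
  define S where "S = sqrt M *\<^sub>R D"
  have "positive_op S" unfolding positive_op_iff
  proof (intro conjI allI)
    show "complex_linear_op S" unfolding S_def D_def by (intro clin_diff clin_scaleR clin_sq_lim X Xclin clin_id)
    fix x y
    show "inner (S x) y = inner x (S y)"
      by (simp add: S_def D_def blinfun.diff_left blinfun.scaleR_left inner_diff_left inner_diff_right selfadj_sq_lim[OF X Xsa])
    show "0 \<le> inner (S x) x"
      using one_minus_sq_lim_nonneg[OF X, of x] M(1) by (simp add: S_def D_def blinfun.scaleR_left)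
  qed
  moreover have "S o\<^sub>L S = T"
  proof -
    have "S o\<^sub>L S = M *\<^sub>R (D o\<^sub>L D)" using M by (simp add: S_def comp_scaleR_left comp_scaleR_right)
    also have "D o\<^sub>L D = (1/M) *\<^sub>R T" unfolding D_def sqrt_one_minus[OF X] by (simp add: X_def)
    finally show ?thesis using M by simp
  qed
  moreover have "R o\<^sub>L S = S o\<^sub>L R" if "R o\<^sub>L T = T o\<^sub>L R" for R
  proof -
    have id: "R o\<^sub>L id_blinfun = id_blinfun o\<^sub>L R" by (auto intro: blinfun_eqI)
    have "R o\<^sub>L X = X o\<^sub>L R"
      by (simp add: X_def comp_diff_left comp_diff_right comp_scaleR_left comp_scaleR_right that id)
    then have "R o\<^sub>L sq_lim X = sq_lim X o\<^sub>L R" by (rule intertwine_sq_lim[OF X X])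
    then show ?thesis
      by (simp add: S_def D_def comp_diff_left comp_diff_right comp_scaleR_left comp_scaleR_right id)
  qed
  ultimately show ?thesis by blast
qed

text \<open>For y = R x - S x commutation gives (R + S) y = 0. Both forms are nonnegative at y, so
  both vanish, whence R y = S y = 0 and then |y|^2 = 0.\<close>

lemma positive_sqrt_unique:
  fixes R S T :: "'h :: complex_hilbert \<Rightarrow>\<^sub>L 'h"
  assumes "positive_op S" "S o\<^sub>L S = T" "positive_op R" "R o\<^sub>L R = T" "R o\<^sub>L S = S o\<^sub>L R"
  shows "R = S"
proof (rule blinfun_eqI)
  fix x
  have R: "\<And>x y. inner (R x) y = inner x (R y)" "\<And>x. 0 \<le> inner (R x) x"
   and S: "\<And>x y. inner (S x) y = inner x (S y)" "\<And>x. 0 \<le> inner (S x) x"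
    using assms by (auto simp: positive_op_iff)
  have RR: "R (R x) = S (S x)" and RS: "R (S x) = S (R x)" for x
    using assms(2,4,5) by (metis blinfun_apply_blinfun_compose)+
  define y where "y = R x - S x"
  have "R y + S y = 0" by (simp add: y_def blinfun.diff_right RR RS)
  then have "inner (R y) y + inner (S y) y = 0" by (metis inner_add_left inner_zero_left)
  then have "inner (R y) y = 0" "inner (S y) y = 0" using R(2)[of y] S(2)[of y] by auto
  then have "R y = 0" "S y = 0"
    using positive_op_norm_apply[OF assms(3), of "norm R + 1" y] positive_op_norm_apply[OF assms(1), of "norm S + 1" y]
    by (auto simp: add_nonneg_pos)
  moreover have "inner y y = inner x (R y - S y)" by (simp add: y_def R(1) S(1) inner_diff_left inner_diff_right blinfun.diff_right)
  ultimately have "y = 0" by simp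
  then show "R x = S x" by (simp add: y_def)
qed

text \<open>The only property of \<open>op_sqrt\<close> used later: it reduces the norms for the
  empty and the full \<alpha> to quadratic forms.\<close>

lemma norm_op_sqrt_apply:
  fixes T :: "'h :: complex_hilbert \<Rightarrow>\<^sub>L 'h"
  assumes "positive_op T"
  shows "(norm (op_sqrt T x))\<^sup>2 = inner (T x) x"
proof -
  obtain S where S: "positive_op S" "S o\<^sub>L S = T" "\<And>R. R o\<^sub>L T = T o\<^sub>L R \<Longrightarrow> R o\<^sub>L S = S o\<^sub>L R"
    using positive_sqrt_exists[OF assms] by blast
  have "op_sqrt T = S" unfolding op_sqrt_def
  proof (rule the_equality)
    fix R assume R: "positive_op R \<and> R o\<^sub>L R = T"
    then have "R o\<^sub>L T = T o\<^sub>L R" by (metis comp_assoc)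
    then have "R o\<^sub>L S = S o\<^sub>L R" by (rule S(3))
    then show "R = S" using R by (intro positive_sqrt_unique[OF S(1,2)]) auto
  qed (use S(1,2) in blast)
  moreover have sa: "inner (S x) y = inner x (S y)" for x y
    using S(1) by (simp add: positive_op_iff)
  then have "inner (T x) x = inner (S x) (S x)"
    by (simp only: S(2)[symmetric] blinfun_apply_blinfun_compose)
  ultimately show ?thesis by (simp add: power2_norm_eq_inner)
qed

section \<open>Haagerup's little Grothendieck inequality\<close>

definition star_algebra :: "('h :: complex_hilbert \<Rightarrow>\<^sub>L 'h) set \<Rightarrow> bool"
  where "star_algebra A \<longleftrightarrow>
    (\<forall>S\<in>A. complex_linear_op S) \<and>
    0 \<in> A \<and>
    (\<forall>S\<in>A. \<forall>T\<in>A. S + T \<in> A) \<and>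
    (\<forall>c. \<forall>S\<in>A. c *\<^sub>C S \<in> A) \<and>
    (\<forall>S\<in>A. \<forall>T\<in>A. S o\<^sub>L T \<in> A) \<and>
    (\<forall>S\<in>A. op_adjoint S \<in> A)"

lemma star_algebraD:
  assumes "star_algebra A"
  shows "S \<in> A \<Longrightarrow> complex_linear_op S" "0 \<in> A" "S \<in> A \<Longrightarrow> T \<in> A \<Longrightarrow> S + T \<in> A"
    "S \<in> A \<Longrightarrow> c *\<^sub>C S \<in> A" "S \<in> A \<Longrightarrow> T \<in> A \<Longrightarrow> S o\<^sub>L T \<in> A" "S \<in> A \<Longrightarrow> op_adjoint S \<in> A"
    "S \<in> A \<Longrightarrow> r *\<^sub>R S \<in> A"
  using assms by (auto simp: star_algebra_def simp flip: scaleC_of_real)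

lemma star_algebra_sum:
  assumes "star_algebra A" "\<And>i. i \<in> I \<Longrightarrow> f i \<in> A"
  shows "(\<Sum>i\<in>I. f i) \<in> A"
  using assms(2) by (induction I rule: infinite_finite_induct) (auto simp: star_algebraD[OF assms(1)])

lemma inner_sum_le:
  fixes f g :: "'i \<Rightarrow> 'a :: real_inner"
  assumes "(\<Sum>i\<in>I. (norm (f i))\<^sup>2) \<le> x\<^sup>2" "(\<Sum>i\<in>I. (norm (g i))\<^sup>2) \<le> y\<^sup>2" "x \<ge> 0" "y \<ge> 0"
  shows "(\<Sum>i\<in>I. inner (f i) (g i)) \<le> x * y"
proof -
  have "(\<Sum>i\<in>I. inner (f i) (g i)) \<le> (\<Sum>i\<in>I. \<bar>norm (f i)\<bar> * \<bar>norm (g i)\<bar>)"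
    by (intro sum_mono) (auto intro: norm_cauchy_schwarz)
  also have "\<dots> \<le> L2_set (\<lambda>i. norm (f i)) I * L2_set (\<lambda>i. norm (g i)) I"
    by (rule L2_set_mult_ineq)
  also have "\<dots> \<le> x * y"
    using assms by (intro mult_mono) (auto simp: L2_set_def real_le_lsqrt sum_nonneg)
  finally show ?thesis .
qed

lemma norm_sum_adjoint_comp_le:
  assumes "\<And>i. i \<in> I \<Longrightarrow> complex_linear_op (a i)" "P \<ge> 0"
    and "\<And>h. (\<Sum>i\<in>I. (norm (a i h))\<^sup>2) \<le> P * (norm h)\<^sup>2"
  shows "norm (\<Sum>i\<in>I. op_adjoint (a i) o\<^sub>L a i) \<le> P"
proof (rule norm_blinfun_bound)
  fix h
  have bound: "(\<Sum>i\<in>I. (norm (a i g))\<^sup>2) \<le> (sqrt P * norm g)\<^sup>2" for g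
    using assms(2,3) by (simp add: power_mult_distrib)
  show "norm ((\<Sum>i\<in>I. op_adjoint (a i) o\<^sub>L a i) h) \<le> P * norm h"
  proof (rule norm_ge_inner_imp)
    fix g
    have "inner ((\<Sum>i\<in>I. op_adjoint (a i) o\<^sub>L a i) h) g = (\<Sum>i\<in>I. inner (a i h) (a i g))"
      by (simp add: blinfun.sum_left inner_sum_left inner_adjoint' assms(1))
    also have "\<dots> \<le> (sqrt P * norm h) * (sqrt P * norm g)"
      using assms(2) by (intro inner_sum_le bound) auto
    also have "\<dots> = P * norm h * norm g" using real_sqrt_pow2[OF assms(2)] by (simp add: power2_eq_square mult_ac)
    finally show "inner ((\<Sum>i\<in>I. op_adjoint (a i) o\<^sub>L a i) h) g \<le> P * norm h * norm g" .
  qed (use assms(2) in simp)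
qed (use assms(2) in simp)

text \<open>J is multiplication by i, kept abstract because the lemma is applied on H x H, for which
  only a real inner product is at hand. The identity is (1 - t^2 b^2 / 2)^2 + t^2 b^2 = 1 + t^4 b^4
  / 4: nothing of order t^2 survives.\<close>

lemma norm_hermitian_second_order:
  fixes b J :: "'a :: real_inner \<Rightarrow> 'a"
  assumes b: "\<And>x y. inner (b x) y = inner x (b y)"
    and J: "\<And>x y. inner (J x) y = - inner x (J y)" "\<And>x. norm (J x) = norm x" "\<And>x. b (J x) = J (b x)"
  shows "(norm (x - (t\<^sup>2/2) *\<^sub>R b (b x) + t *\<^sub>R J (b x)))\<^sup>2 = (norm x)\<^sup>2 + t^4 / 4 * (norm (b (b x)))\<^sup>2"
proof -
  have skew: "inner x (J (b x)) = 0" for x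
  proof -
    have "inner x (J (b x)) = inner (J (b x)) x" by (rule inner_commute)
    also have "\<dots> = inner (b (J x)) x" by (simp only: J(3))
    also have "\<dots> = inner (J x) (b x)" by (rule b)
    also have "\<dots> = - inner x (J (b x))" by (rule J(1))
    finally show ?thesis by simp
  qed
  have 1: "inner (b (b x)) (J (b x)) = 0" using b[of "b x" "J (b x)"] skew[of "b x"] by (simp add: J(3))
  have 2: "inner (J (b x)) (J (b x)) = inner (b x) (b x)" using J(2)[of "b x"] by (simp add: norm_eq_sqrt_inner)
  have 3: "inner x (b (b x)) = inner (b x) (b x)" by (simp add: b)
  have expand: "(norm (x - r *\<^sub>R v + t *\<^sub>R w))\<^sup>2 = inner x x + r\<^sup>2 * inner v v + t\<^sup>2 * inner w w
      - 2 * r * inner x v + 2 * t * inner x w - 2 * r * t * inner v w" for r v w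
    unfolding power2_norm_eq_inner
    by (simp add: inner_add_left inner_add_right inner_diff_left inner_diff_right inner_commute[of v x]
        inner_commute[of w x] inner_commute[of w v] algebra_simps power2_eq_square)
  show ?thesis
    unfolding expand 1 2 3 skew unfolding power2_norm_eq_inner by (simp add: power_divide flip: power_mult)
qed

(* V is the upper left corner of the unitary W = (V, D'; -D, V^* ) on H x H with D = (1 - V^* V)^(1/2),
   D' = (1 - V V^* )^(1/2).  With b the real part of W^* (a + 0), the operator below is the corner of
   W (1 - t^2 b^2 / 2 + i t b), an approximation of the unitary W exp (i t b) up to order t^4. *)
lemma near_unitary_bound:
  fixes V a :: "'h :: complex_hilbert \<Rightarrow>\<^sub>L 'h"
  assumes V: "complex_linear_op V" "norm V \<le> 1" and a: "complex_linear_op a"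
  defines "z \<equiv> (1/2) *\<^sub>R (a + (V o\<^sub>L (op_adjoint a o\<^sub>L V)))"
  defines "p \<equiv> (1/2) *\<^sub>R ((op_adjoint V o\<^sub>L a) + (op_adjoint a o\<^sub>L V))"
  defines "q \<equiv> (1/2) *\<^sub>R ((a o\<^sub>L p) + (V o\<^sub>L (op_adjoint a o\<^sub>L z)))"
  shows "(norm (V - (t\<^sup>2/2) *\<^sub>R q + t *\<^sub>R (\<i> *\<^sub>C z)))\<^sup>2 \<le> 1 + t^4 / 4 * norm a ^ 4"
proof -
  let ?V' = "op_adjoint V" and ?a' = "op_adjoint a"
  note V' = clin_adjoint[OF V(1)]
  define X where "X = ?V' o\<^sub>L V"
  define Y where "Y = V o\<^sub>L ?V'"
  have nV': "norm ?V' \<le> 1" using norm_adjoint_le[OF V(1)] V(2) by simp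
  have nX: "norm X \<le> 1" unfolding X_def
    by (rule order_trans[OF norm_blinfun_compose]) (use nV' V(2) mult_le_one in fastforce)
  have nY: "norm Y \<le> 1" unfolding Y_def
    by (rule order_trans[OF norm_blinfun_compose]) (use nV' V(2) mult_le_one in fastforce)
  define D where "D = id_blinfun - sq_lim X"
  define D' where "D' = id_blinfun - sq_lim Y"
  have saX: "inner (X x) y = inner x (X y)" for x y by (simp add: X_def inner_adjoint inner_adjoint' V(1))
  have saY: "inner (Y x) y = inner x (Y y)" for x y by (simp add: Y_def inner_adjoint inner_adjoint' V(1))
  have saD: "inner (D x) y = inner x (D y)" for x y
    by (simp add: D_def blinfun.diff_left inner_diff_left inner_diff_right selfadj_sq_lim[OF nX saX])
  have saD': "inner (D' x) y = inner x (D' y)" for x y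
    by (simp add: D'_def blinfun.diff_left inner_diff_left inner_diff_right selfadj_sq_lim[OF nY saY])
  have cD': "complex_linear_op D'"
    unfolding D'_def by (intro clin_diff clin_id clin_sq_lim nY) (auto simp: Y_def intro: clin_comp V V')
  have DD: "D (D x) = x - ?V' (V x)" for x
    using arg_cong[OF sqrt_one_minus[OF nX], of "\<lambda>T. T x"] by (simp add: D_def X_def blinfun.diff_left)
  have DD': "D' (D' x) = x - V (?V' x)" for x
    using arg_cong[OF sqrt_one_minus[OF nY], of "\<lambda>T. T x"] by (simp add: D'_def Y_def blinfun.diff_left)
  have "V o\<^sub>L sq_lim X = sq_lim Y o\<^sub>L V"
    by (rule intertwine_sq_lim[OF nX nY]) (simp add: X_def Y_def comp_assoc)
  \<comment> \<open>This relation makes the mixed terms cancel when W is shown to be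
    isometric.\<close>
  then have VD: "V (D x) = D' (V x)" for x
    unfolding D_def D'_def blinfun.diff_left blinfun.diff_right by (metis blinfun_apply_blinfun_compose id_blinfun.rep_eq)
  \<comment> \<open>\<open>w\<close> is the first row of W, \<open>b\<close> the self-adjoint part
    described above and \<open>J\<close> multiplication by i; W itself is never formed.\<close>
  define w where "w = (\<lambda>(h, k). V h + D' k)"
  define b where "b = (\<lambda>(h, k). ((1/2) *\<^sub>R (?V' (a h) + ?a' (V h + D' k)), (1/2) *\<^sub>R D' (a h)))"
  define J where "J = (\<lambda>(h, k). (\<i> *\<^sub>C h, \<i> *\<^sub>C (k :: 'h)) :: 'h \<times> 'h)"
  have w: "norm (w \<xi>) \<le> norm \<xi>" for \<xi>
  proof -
    obtain h k where \<xi>: "\<xi> = (h, k)" by force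
    have "(norm (V h + D' k))\<^sup>2 + (norm (?V' k - D h))\<^sup>2 = (norm h)\<^sup>2 + (norm k)\<^sup>2"
    proof -
      have 1: "inner (V h) (V h) + inner (D h) (D h) = inner h h"
        by (simp add: inner_adjoint[OF V(1)] saD DD inner_diff_right)
      have 2: "inner (D' k) (D' k) + inner (?V' k) (?V' k) = inner k k"
        by (simp add: inner_adjoint'[OF V(1)] saD' DD' inner_diff_right)
      have "inner (V h) (D' k) = inner (D' (V h)) k" by (simp only: saD')
      also have "\<dots> = inner (D h) (?V' k)" by (simp only: VD[symmetric] inner_adjoint[OF V(1)])
      finally have 3: "inner (V h) (D' k) = inner (D h) (?V' k)" .
      show ?thesis using 1 2 3
        by (simp add: power2_norm_eq_inner inner_add_left inner_add_right inner_diff_left inner_diff_right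
            inner_commute[of "D' k" "V h"] inner_commute[of "?V' k" "D h"])
    qed
    then have "(norm (V h + D' k))\<^sup>2 \<le> (norm \<xi>)\<^sup>2"
      by (simp add: \<xi> norm_Pair) (metis add_increasing2 le_add_same_cancel1 zero_le_power2)
    then show ?thesis by (simp add: \<xi> w_def)
  qed
  have b_sa: "inner (b x) y = inner x (b y)" for x y
  proof -
    have form: "inner (b (h, k)) (h', k') = (inner (a h) (V h') + inner (V h) (a h') + inner (D' k) (a h') + inner (a h) (D' k')) / 2"
      for h k h' k'
      by (simp add: b_def inner_add_left inner_adjoint'[OF a] inner_adjoint'[OF V(1)] saD')
    obtain h k h' k' where "x = (h, k)" "y = (h', k')" by (metis surj_pair)
    then show ?thesis unfolding inner_commute[of x "b y"]
      by (simp only: form) (simp add: inner_commute)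
  qed
  have b_norm: "norm (b \<xi>) \<le> norm a * norm \<xi>" for \<xi>
  proof -
    obtain h k where \<xi>: "\<xi> = (h, k)" by force
    have "b \<xi> = (1/2) *\<^sub>R ((?V' (a h), D' (a h)) + (?a' (w \<xi>), 0))"
      by (simp add: b_def \<xi> w_def)
    moreover have "norm ((1/2) *\<^sub>R (x + y)) \<le> (norm x + norm y) / 2" for x y :: "'h \<times> 'h"
      using norm_triangle_ineq[of x y] by simp
    ultimately have "norm (b \<xi>) \<le> (norm (?V' (a h), D' (a h)) + norm (?a' (w \<xi>), 0::'h)) / 2"
      by metis
    \<comment> \<open>The pair is W^* applied to (a h, 0), so its norm is that of a h.\<close>
    moreover have "norm (?V' (a h), D' (a h)) \<le> norm a * norm \<xi>"
    proof -
      have "(norm (?V' (a h)))\<^sup>2 + (norm (D' (a h)))\<^sup>2 = (norm (a h))\<^sup>2"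
        by (simp add: power2_norm_eq_inner inner_adjoint'[OF V(1)] saD' DD' inner_diff_right)
      then have "norm (?V' (a h), D' (a h)) = norm (a h)" by (simp add: norm_Pair)
      also have "\<dots> \<le> norm a * norm h" by (rule norm_blinfun)
      also have "\<dots> \<le> norm a * norm \<xi>" by (intro mult_left_mono) (auto simp: \<xi> norm_Pair real_le_rsqrt)
      finally show ?thesis .
    qed
    moreover have "norm (?a' (w \<xi>), 0::'h) \<le> norm a * norm \<xi>"
    proof -
      have "norm (?a' (w \<xi>), 0::'h) = norm (?a' (w \<xi>))" by (simp add: norm_Pair)
      also have "\<dots> \<le> norm ?a' * norm (w \<xi>)" by (rule norm_blinfun)
      also have "\<dots> \<le> norm a * norm \<xi>" by (intro mult_mono norm_adjoint_le a w) auto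
      finally show ?thesis .
    qed
    ultimately show ?thesis by simp
  qed
  have J: "inner (J x) y = - inner x (J y)" "norm (J x) = norm x" "b (J x) = J (b x)" for x y
    by (cases x; cases y; simp add: J_def b_def inner_ii_left norm_Pair norm_scaleC clinD[OF V(1)] clinD[OF V']
        clinD[OF a] clinD[OF clin_adjoint[OF a]] clinD[OF cD'] scaleC_add_right scaleC_scaleR flip: scaleC_add_right)+
  show ?thesis
  proof -
    let ?T = "V - (t\<^sup>2/2) *\<^sub>R q + t *\<^sub>R (\<i> *\<^sub>C z)"
    have C: "0 \<le> 1 + t^4 / 4 * norm a ^ 4" by (intro add_nonneg_nonneg mult_nonneg_nonneg) auto
    have "norm (?T h) \<le> sqrt (1 + t^4 / 4 * norm a ^ 4) * norm h" for h
    proof -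
      define \<xi> :: "'h \<times> 'h" where "\<xi> = (h, 0)"
      define \<eta> where "\<eta> = \<xi> - (t\<^sup>2/2) *\<^sub>R b (b \<xi>) + t *\<^sub>R J (b \<xi>)"
      have w_lin: "w (x - r *\<^sub>R y + s *\<^sub>R v) = w x - r *\<^sub>R w y + s *\<^sub>R w v" for x y v r s
        by (cases x; cases y; cases v)
          (simp add: w_def blinfun.add_right blinfun.diff_right blinfun.scaleR_right scaleR_add_right)
      have b1: "b \<xi> = (p h, (1/2) *\<^sub>R D' (a h))"
        by (simp add: \<xi>_def b_def p_def blinfun.scaleR_left blinfun.add_left)
      \<comment> \<open>D' occurs only squared, and D'^2 = 1 - V V^* cancels the remaining term with
        V V^*. So z, and in the same way q, involves only V, a and adjoints and stays in any
        *-algebra containing V and a.\<close>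
      have wb1: "w (b \<xi>) = z h"
        unfolding b1 by (simp add: w_def p_def z_def blinfun.scaleR_left blinfun.add_left blinfun.scaleR_right
            blinfun.add_right DD' flip: scaleR_add_right)
      have b2: "b (b \<xi>) = ((1/2) *\<^sub>R (?V' (a (p h)) + ?a' (z h)), (1/2) *\<^sub>R D' (a (p h)))"
        using wb1 unfolding b1 by (simp add: b_def w_def)
      have wb2: "w (b (b \<xi>)) = q h"
        unfolding b2 by (simp add: w_def q_def blinfun.scaleR_left blinfun.add_left blinfun.scaleR_right
            blinfun.add_right DD' flip: scaleR_add_right)
      have wJ: "w (J x) = \<i> *\<^sub>C w x" for x
        by (cases x) (simp add: w_def J_def clinD[OF V(1)] clinD[OF cD'] scaleC_add_right)
      have "?T h = w \<eta>"
        unfolding \<eta>_def w_lin wJ wb1 wb2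
        by (simp add: \<xi>_def w_def blinfun.add_left blinfun.diff_left blinfun.scaleR_left scaleC_blinfun_apply)
      then have "(norm (?T h))\<^sup>2 \<le> (norm \<eta>)\<^sup>2" using w[of \<eta>] by simp
      also have "(norm \<eta>)\<^sup>2 = (norm \<xi>)\<^sup>2 + t^4 / 4 * (norm (b (b \<xi>)))\<^sup>2"
        unfolding \<eta>_def by (rule norm_hermitian_second_order[OF b_sa J])
      also have "norm (b (b \<xi>)) \<le> norm a * (norm a * norm \<xi>)"
        by (rule order_trans[OF b_norm]) (intro mult_left_mono b_norm, simp)
      then have "(norm \<xi>)\<^sup>2 + t^4 / 4 * (norm (b (b \<xi>)))\<^sup>2 \<le> (norm \<xi>)\<^sup>2 + t^4 / 4 * (norm a * (norm a * norm \<xi>))\<^sup>2"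
        by (intro add_left_mono mult_left_mono power_mono) auto
      also have "\<dots> = (1 + t^4 / 4 * norm a ^ 4) * (norm h)\<^sup>2"
        by (simp add: \<xi>_def norm_Pair power_mult_distrib algebra_simps flip: power_add)
      also have "\<dots> = (sqrt (1 + t^4 / 4 * norm a ^ 4) * norm h)\<^sup>2"
        using C by (simp add: power_mult_distrib)
      finally show ?thesis by (rule power2_le_imp_le) (use C in simp)
    qed
    then have "norm ?T \<le> sqrt (1 + t^4 / 4 * norm a ^ 4)" using C by (intro norm_blinfun_bound) auto
    then have "(norm ?T)\<^sup>2 \<le> (sqrt (1 + t^4 / 4 * norm a ^ 4))\<^sup>2" by (intro power_mono) auto
    then show ?thesis using C by simp
  qed
qed

lemma halves_cancel:
  fixes x y z :: "'a :: real_vector"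
  shows "(1/2) *\<^sub>R x + ((1/2) *\<^sub>R y + (1/2) *\<^sub>R z) + ((1/2) *\<^sub>R x + ((1/2) *\<^sub>R y - (1/2) *\<^sub>R z)) = x + y"
proof -
  have half: "v = (1/2) *\<^sub>R v + (1/2) *\<^sub>R v" for v :: 'a by (simp flip: scaleR_add_left)
  have "x' + (y' + z') + (x' + (y' - z')) = (x' + x') + (y' + y')" for x' y' z' :: 'a by simp
  from this[of "(1/2) *\<^sub>R x" "(1/2) *\<^sub>R y" "(1/2) *\<^sub>R z"] show ?thesis unfolding half[symmetric] .
qed

text \<open>Second-order optimality at an almost maximal V: moving V by t and by -t along the
  approximate unitary path and adding, the parallelogram law isolates t^2 |u z|^2. Maximality bounds
  it by the second-order term with q, and the sum of these terms over the family is controlled by P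
  + Q.\<close>

lemma little_grothendieck:
  fixes A :: "('h :: complex_hilbert \<Rightarrow>\<^sub>L 'h) set" and u :: "('h \<Rightarrow>\<^sub>L 'h) \<Rightarrow> 'k :: complex_hilbert"
  assumes A: "star_algebra A"
    and add: "\<And>S T. S \<in> A \<Longrightarrow> T \<in> A \<Longrightarrow> u (S + T) = u S + u T"
    and scaleC: "\<And>c S. S \<in> A \<Longrightarrow> u (c *\<^sub>C S) = c *\<^sub>C u S"
    and bound: "\<And>S. S \<in> A \<Longrightarrow> norm (u S) \<le> M * norm S" "M \<ge> 0"
    and a: "finite I" "\<And>j. j \<in> I \<Longrightarrow> a j \<in> A"
    and P: "\<And>h. (\<Sum>j\<in>I. (norm (a j h))\<^sup>2) \<le> P * (norm h)\<^sup>2" "P \<ge> 0"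
    and Q: "\<And>h. (\<Sum>j\<in>I. (norm (op_adjoint (a j) h))\<^sup>2) \<le> Q * (norm h)\<^sup>2" "Q \<ge> 0"
  shows "(\<Sum>j\<in>I. (norm (u (a j)))\<^sup>2) \<le> M\<^sup>2 * (P + Q)"
proof -
  note D = star_algebraD[OF A]
  have scaleR: "u (r *\<^sub>R S) = r *\<^sub>R u S" if "S \<in> A" for r S
    using scaleC[OF that, of "complex_of_real r"] by (simp add: scaleC_of_real)
  have diff_scaleR: "u (S - r *\<^sub>R T) = u S - r *\<^sub>R u T" if "S \<in> A" "T \<in> A" for r S T
    using add[OF that(1) D(7)[OF that(2)], of "- r"] scaleR[OF that(2), of "- r"] by simp
  have diff_in: "S - r *\<^sub>R T \<in> A" if "S \<in> A" "T \<in> A" for r S T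
    using D(3)[OF that(1) D(7)[OF that(2)], of "- r"] by simp
  have u0: "u 0 = 0" using scaleR[OF D(2), of 0] by simp
  have u_sum: "u (\<Sum>j\<in>J. f j) = (\<Sum>j\<in>J. u (f j))" if "\<And>j. j \<in> J \<Longrightarrow> f j \<in> A" for J and f :: "'i \<Rightarrow> _"
    using that by (induction J rule: infinite_finite_induct) (auto simp: u0 add star_algebra_sum[OF A])
  define ball where "ball = {V \<in> A. norm V \<le> 1}"
  have M_ball: "norm (u V) \<le> M" if "V \<in> ball" for V
  proof -
    have "norm (u V) \<le> M * norm V" using that by (intro bound(1)) (simp add: ball_def)
    also have "\<dots> \<le> M * 1" using that bound(2) by (intro mult_left_mono) (auto simp: ball_def)
    finally show ?thesis by simp
  qed
  \<comment> \<open>V is compared with the actual supremum over the ball, which may be smaller than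
    M and need not be attained.\<close>
  define m where "m = (SUP V\<in>ball. norm (u V))"
  have bdd: "bdd_above ((\<lambda>V. norm (u V)) ` ball)" using M_ball by (intro bdd_aboveI2)
  have ball0: "0 \<in> ball" by (simp add: ball_def D)
  have m_ge: "norm (u V) \<le> m" if "V \<in> ball" for V unfolding m_def by (rule cSUP_upper[OF that bdd])
  have m0: "m \<ge> 0" using m_ge[OF ball0] by (simp add: u0)
  have mM: "m \<le> M" unfolding m_def using M_ball ball0 by (intro cSUP_least) auto
  have m_bound: "norm (u S) \<le> m * norm S" if S: "S \<in> A" for S
  proof (cases "S = 0")
    case False
    have "norm (u ((1 / norm S) *\<^sub>R S)) \<le> m" using False S by (intro m_ge) (simp add: ball_def D)
    then show ?thesis using False by (simp add: scaleR[OF S] field_simps)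
  qed (simp add: u0)

  \<comment> \<open>The terms on the right are the defect of V from extremality, an error of order
    t^4 and the main term of order t^2. Later V approaches the supremum for fixed t, and only then t
    tends to 0.\<close>
  have key: "t\<^sup>2 * (\<Sum>j\<in>I. (norm (u (a j)))\<^sup>2) \<le>
      4 * card I * (m\<^sup>2 - (norm (u V))\<^sup>2) + t^4 * (m\<^sup>2 * (\<Sum>j\<in>I. norm (a j) ^ 4)) + t\<^sup>2 * (m\<^sup>2 * (P + Q))"
    if V: "V \<in> ball" for V t
  proof -
    have VA: "V \<in> A" "norm V \<le> 1" using V by (auto simp: ball_def)
    define z where "z a = (1/2) *\<^sub>R (a + (V o\<^sub>L (op_adjoint a o\<^sub>L V)))" for a
    define p where "p a = (1/2) *\<^sub>R ((op_adjoint V o\<^sub>L a) + (op_adjoint a o\<^sub>L V))" for a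
    define q where "q a = (1/2) *\<^sub>R ((a o\<^sub>L p a) + (V o\<^sub>L (op_adjoint a o\<^sub>L z a)))" for a
    define r where "r a = (a o\<^sub>L (op_adjoint a o\<^sub>L V)) + (V o\<^sub>L (op_adjoint a o\<^sub>L a))" for a
    have in_A: "z a \<in> A" "q a \<in> A" "r a \<in> A" if "a \<in> A" for a
      using that VA unfolding q_def p_def z_def r_def by (auto intro!: D(3,5,6,7))
    have est: "t\<^sup>2 * (norm (u (z a)))\<^sup>2 \<le> (m\<^sup>2 - (norm (u V))\<^sup>2) + t^4 * (m\<^sup>2 * norm a ^ 4) / 4 + t\<^sup>2 * inner (u (q a)) (u V)"
      if aA: "a \<in> A" for a
    proof -
      define x where "x = u V - (t\<^sup>2/2) *\<^sub>R u (q a)"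
      define y where "y = t *\<^sub>R (\<i> *\<^sub>C u (z a))"
      have *: "(norm (x + s *\<^sub>R (\<i> *\<^sub>C u (z a))))\<^sup>2 \<le> m\<^sup>2 * (1 + t^4 / 4 * norm a ^ 4)" if s: "s\<^sup>2 = t\<^sup>2" for s
      proof -
        let ?T = "V - (s\<^sup>2/2) *\<^sub>R q a + s *\<^sub>R (\<i> *\<^sub>C z a)"
        have s4: "s^4 = t^4" using s by (metis power2_eq_square power4_eq_xxxx mult.assoc)
        have "u ?T = x + s *\<^sub>R (\<i> *\<^sub>C u (z a))"
          using in_A[OF aA] VA by (simp add: add diff_in D diff_scaleR scaleR scaleC x_def s)
        moreover have "?T \<in> A" using in_A[OF aA] VA by (intro D diff_in)
        ultimately have "norm (x + s *\<^sub>R (\<i> *\<^sub>C u (z a))) \<le> m * norm ?T" using m_bound by metis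
        then have "(norm (x + s *\<^sub>R (\<i> *\<^sub>C u (z a))))\<^sup>2 \<le> m\<^sup>2 * (norm ?T)\<^sup>2"
          by (metis norm_ge_zero power_mono power_mult_distrib)
        also have "(norm ?T)\<^sup>2 \<le> 1 + s^4 / 4 * norm a ^ 4"
          unfolding q_def p_def z_def using aA VA by (intro near_unitary_bound D(1))
        finally show ?thesis using m0 by (simp add: s4 mult_left_mono)
      qed
      \<comment> \<open>Both signs of t are allowed, since the norm bound depends only on
        t^2.\<close>
      have "(norm (x + y))\<^sup>2 + (norm (x - y))\<^sup>2 \<le> 2 * (m\<^sup>2 * (1 + t^4 / 4 * norm a ^ 4))"
        using *[of t] *[of "- t"] by (simp add: y_def)
      moreover have "(norm (x + y))\<^sup>2 + (norm (x - y))\<^sup>2 = 2 * (norm x)\<^sup>2 + 2 * (norm y)\<^sup>2"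
        by (simp add: power2_norm_eq_inner inner_add_left inner_add_right inner_diff_left inner_diff_right)
      moreover have "(norm y)\<^sup>2 = t\<^sup>2 * (norm (u (z a)))\<^sup>2" by (simp add: y_def norm_scaleC power_mult_distrib)
      moreover have "(norm (u V))\<^sup>2 - t\<^sup>2 * inner (u (q a)) (u V) \<le> (norm x)\<^sup>2"
      proof -
        have "(norm x)\<^sup>2 = (norm (u V))\<^sup>2 - t\<^sup>2 * inner (u (q a)) (u V) + (t\<^sup>2/2)\<^sup>2 * (norm (u (q a)))\<^sup>2"
        proof -
          have "(norm (v - r *\<^sub>R w))\<^sup>2 = (norm v)\<^sup>2 - 2 * r * inner w v + r\<^sup>2 * (norm w)\<^sup>2" for r and v w :: 'k
            unfolding power2_norm_eq_inner
            by (simp add: inner_diff_left inner_diff_right inner_commute[of v w] power2_eq_square algebra_simps)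
          then show ?thesis unfolding x_def by simp
        qed
        then show ?thesis by simp
      qed
      ultimately have "t\<^sup>2 * (norm (u (z a)))\<^sup>2 + ((norm (u V))\<^sup>2 - t\<^sup>2 * inner (u (q a)) (u V)) \<le> m\<^sup>2 * (1 + t^4 / 4 * norm a ^ 4)"
        by linarith
      then show ?thesis by (simp add: algebra_simps)
    qed
    have est2: "t\<^sup>2 * (norm (u a))\<^sup>2 \<le> 4 * (m\<^sup>2 - (norm (u V))\<^sup>2) + t^4 * (m\<^sup>2 * norm a ^ 4) + t\<^sup>2 * inner (u (r a)) (u V)"
      if aA: "a \<in> A" for a
    proof -
      \<comment> \<open>Multiplying a by -i flips the sign of V a^* V relative to a. So a = z a + i
        z a', and the skew part is treated as the self-adjoint part belonging to a'.\<close>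
      define a' where "a' = (-\<i>) *\<^sub>C a"
      have a': "a' \<in> A" "norm a' = norm a" using aA by (auto simp: a'_def D norm_scaleC_blinfun)
      have ca: "complex_linear_op a" "complex_linear_op V" "complex_linear_op (op_adjoint V)" "complex_linear_op (op_adjoint a)"
        using aA VA by (auto intro: D)
      have adj: "op_adjoint a' = \<i> *\<^sub>C op_adjoint a" unfolding a'_def by (simp add: adjoint_scaleC ca)
      have "a = z a + \<i> *\<^sub>C z a'"
        unfolding z_def adj
        by (rule blinfun_eqI) (simp add: a'_def blinfun.add_left blinfun.scaleR_left scaleC_blinfun_apply scaleC_scaleR
            scaleC_add_right scaleC_scaleC clinD[OF ca(2)] scaleC_one scaleC_minus1 flip: scaleR_add_right scaleR_2)
      then have ua: "u a = u (z a) + \<i> *\<^sub>C u (z a')" using in_A[OF aA] in_A[OF a'(1)] by (metis D(4) add scaleC)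
      have "(norm (u a))\<^sup>2 \<le> 2 * (norm (u (z a)))\<^sup>2 + 2 * (norm (u (z a')))\<^sup>2"
      proof -
        have "norm (u a) \<le> norm (u (z a)) + norm (u (z a'))"
          unfolding ua by (rule norm_triangle_le) (simp add: norm_scaleC)
        then have "(norm (u a))\<^sup>2 \<le> (norm (u (z a)) + norm (u (z a')))\<^sup>2" by (intro power_mono) auto
        also have "\<dots> \<le> 2 * (norm (u (z a)))\<^sup>2 + 2 * (norm (u (z a')))\<^sup>2"
          using sum_squares_bound[of "norm (u (z a))" "norm (u (z a'))"] by (simp add: power2_sum)
        finally show ?thesis .
      qed
      then have "t\<^sup>2 * (norm (u a))\<^sup>2 \<le> t\<^sup>2 * (2 * (norm (u (z a)))\<^sup>2 + 2 * (norm (u (z a')))\<^sup>2)"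
        by (rule mult_left_mono) simp
      then have "t\<^sup>2 * (norm (u a))\<^sup>2 \<le> 2 * (t\<^sup>2 * (norm (u (z a)))\<^sup>2) + 2 * (t\<^sup>2 * (norm (u (z a')))\<^sup>2)"
        by (simp add: distrib_left mult.left_commute)
      moreover have "2 * (inner (u (q a)) (u V) + inner (u (q a')) (u V)) = inner (u (r a)) (u V)"
      proof -
        \<comment> \<open>The terms with two factors a, or with two factors a^*, change sign from a
          to -i a and cancel; a a^* V and V a^* a remain.\<close>
        have "2 *\<^sub>R (q a + q a') = r a"
          unfolding q_def p_def z_def r_def adj
          by (rule blinfun_eqI) (simp add: a'_def blinfun.add_left blinfun.scaleR_left scaleC_blinfun_apply scaleC_scaleR
            scaleC_add_right scaleC_scaleC clinD[OF ca(1)] clinD[OF ca(2)] clinD[OF ca(3)] clinD[OF ca(4)]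
            blinfun.add_right blinfun.scaleR_right blinfun.minus_right
            scaleC_one scaleC_minus1 scaleR_add_right blinfun.diff_right halves_cancel flip: scaleR_2)
        then have "u (r a) = 2 *\<^sub>R (u (q a) + u (q a'))"
          using in_A[OF aA] in_A[OF a'(1)] by (metis D(3) add scaleR)
        then show ?thesis by (simp add: inner_add_left)
      qed
      moreover have "t\<^sup>2 * inner (u (q a)) (u V) + t\<^sup>2 * inner (u (q a')) (u V) = t\<^sup>2 * inner (u (r a)) (u V) / 2"
        unfolding calculation(2)[symmetric] by (simp add: algebra_simps)
      ultimately show ?thesis using est[OF aA] est[OF a'(1)] a'(2) by simp
    qed
    have ra: "r (a j) \<in> A" if "j \<in> I" for j using in_A[OF a(2)[OF that]] by simp
    have clin_a: "complex_linear_op (a j)" if "j \<in> I" for j using D(1)[OF a(2)[OF that]] .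
    have "(\<Sum>j\<in>I. inner (u (r (a j))) (u V)) = inner (u (\<Sum>j\<in>I. r (a j))) (u V)"
      by (simp add: u_sum[OF ra] inner_sum_left)
    also have "\<dots> \<le> norm (u (\<Sum>j\<in>I. r (a j))) * norm (u V)" by (rule norm_cauchy_schwarz)
    also have "\<dots> \<le> (m * (P + Q)) * m"
    proof (intro mult_mono)
      let ?S1 = "\<Sum>j\<in>I. op_adjoint (op_adjoint (a j)) o\<^sub>L op_adjoint (a j)"
      let ?S2 = "\<Sum>j\<in>I. op_adjoint (a j) o\<^sub>L a j"
      have "(\<Sum>j\<in>I. r (a j)) = (?S1 o\<^sub>L V) + (V o\<^sub>L ?S2)"
        by (rule blinfun_eqI)
          (simp add: r_def blinfun.sum_left blinfun.add_left blinfun.sum_right sum.distrib adjoint_adjoint clin_a)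
      also have "norm \<dots> \<le> norm ?S1 * norm V + norm V * norm ?S2"
        by (intro norm_triangle_le add_mono norm_blinfun_compose)
      also have "\<dots> \<le> Q * 1 + 1 * P"
        by (intro add_mono mult_mono norm_sum_adjoint_comp_le clin_adjoint clin_a P Q VA) auto
      finally have "norm (\<Sum>j\<in>I. r (a j)) \<le> P + Q" by simp
      then show "norm (u (\<Sum>j\<in>I. r (a j))) \<le> m * (P + Q)"
        by (intro order_trans[OF m_bound] star_algebra_sum[OF A] ra mult_left_mono m0)
    qed (use m_ge[OF V] m0 P Q in auto)
    finally have "(\<Sum>j\<in>I. inner (u (r (a j))) (u V)) \<le> m\<^sup>2 * (P + Q)" by (simp add: power2_eq_square mult_ac)
    then have fin: "t\<^sup>2 * (\<Sum>j\<in>I. inner (u (r (a j))) (u V)) \<le> t\<^sup>2 * (m\<^sup>2 * (P + Q))" by (rule mult_left_mono) simp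
    have "t\<^sup>2 * (\<Sum>j\<in>I. (norm (u (a j)))\<^sup>2) \<le>
        (\<Sum>j\<in>I. 4 * (m\<^sup>2 - (norm (u V))\<^sup>2) + t^4 * (m\<^sup>2 * norm (a j) ^ 4) + t\<^sup>2 * inner (u (r (a j))) (u V))"
      unfolding sum_distrib_left by (intro sum_mono est2 a)
    also have "\<dots> = 4 * card I * (m\<^sup>2 - (norm (u V))\<^sup>2) + t^4 * (m\<^sup>2 * (\<Sum>j\<in>I. norm (a j) ^ 4)) +
        t\<^sup>2 * (\<Sum>j\<in>I. inner (u (r (a j))) (u V))"
      by (simp add: sum.distrib sum_distrib_left)
    finally show ?thesis using fin by linarith
  qed

  define S where "S = (\<Sum>j\<in>I. (norm (u (a j)))\<^sup>2)"
  define C where "C = m\<^sup>2 * (\<Sum>j\<in>I. norm (a j) ^ 4)"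
  have C0: "C \<ge> 0" unfolding C_def by (intro mult_nonneg_nonneg sum_nonneg) auto
  have step: "t\<^sup>2 * S \<le> t^4 * C + t\<^sup>2 * (m\<^sup>2 * (P + Q))" for t
  proof (rule field_le_epsilon)
    fix e :: real assume e: "e > 0"
    \<comment> \<open>Chosen so that 4 * card I * d * (2 * m) stays below e; the added 1 covers m =
      0 and empty I.\<close>
    define d where "d = e / (4 * card I * (2 * m) + 1)"
    have den: "4 * card I * (2 * m) + 1 > 0" using m0 by (intro add_nonneg_pos) auto
    have d: "d > 0" using e den by (simp add: d_def)
    obtain V where V: "V \<in> ball" "norm (u V) > m - d"
      using less_cSUP_iff[OF _ bdd, of "m - d"] ball0 d unfolding m_def by auto
    have "m\<^sup>2 - (norm (u V))\<^sup>2 = (m - norm (u V)) * (m + norm (u V))" by (simp add: power2_eq_square algebra_simps)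
    also have "\<dots> \<le> d * (2 * m)" using V m_ge[OF V(1)] m0 d by (intro mult_mono) auto
    finally have "4 * card I * (m\<^sup>2 - (norm (u V))\<^sup>2) \<le> 4 * card I * (d * (2 * m))" by (intro mult_left_mono) auto
    also have "\<dots> = d * (4 * card I * (2 * m) + 1) - d" by (simp add: algebra_simps)
    also have "d * (4 * card I * (2 * m) + 1) = e" using den by (simp add: d_def)
    finally show "t\<^sup>2 * S \<le> t^4 * C + t\<^sup>2 * (m\<^sup>2 * (P + Q)) + e"
      using key[OF V(1), of t] d by (simp add: S_def C_def)
  qed
  have "S \<le> m\<^sup>2 * (P + Q)"
  proof (rule field_le_epsilon)
    fix e :: real assume e: "e > 0"
    \<comment> \<open>For this t the error t^2 * C is at most e.\<close>
    define t where "t = sqrt (e / (C + 1))"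
    have t2: "t\<^sup>2 = e / (C + 1)" "t\<^sup>2 > 0" using e C0 by (auto simp: t_def)
    have "t\<^sup>2 * S \<le> t\<^sup>2 * (t\<^sup>2 * C + m\<^sup>2 * (P + Q))"
      using step[of t] by (simp add: algebra_simps power4_eq_xxxx power2_eq_square)
    then have "S \<le> t\<^sup>2 * C + m\<^sup>2 * (P + Q)" using t2(2) by (rule mult_left_le_imp_le)
    moreover have "t\<^sup>2 * C \<le> e" using e C0 by (simp add: t2(1) field_simps)
    ultimately show "S \<le> m\<^sup>2 * (P + Q) + e" by linarith
  qed
  also have "\<dots> \<le> M\<^sup>2 * (P + Q)" using mM m0 P Q by (intro mult_right_mono power_mono) auto
  finally show ?thesis by (simp add: S_def)
qed

section \<open>The algebra generated by free semicircular operators\<close>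

lemma infsum_has_sum_le:
  fixes f :: "'i \<Rightarrow> real"
  assumes "(f has_sum s) UNIV" "\<And>F. finite F \<Longrightarrow> sum f F \<le> b"
  shows "s \<le> b"
  using assms by (intro has_sum_le_finite_sums[OF assms(1)]) auto

lemma has_sum_single:
  fixes f :: "'i \<Rightarrow> real"
  assumes "\<And>j. j \<noteq> i \<Longrightarrow> f j = 0"
  shows "(f has_sum f i) UNIV"
  by (rule has_sum_cong_neutral[THEN iffD1, OF _ _ _ has_sum_finite[of "{i}" f, simplified]]) (auto simp: assms)

lemma adjoint_eq_0_iff: "complex_linear_op S \<Longrightarrow> op_adjoint S = 0 \<longleftrightarrow> S = 0"
  by (metis adjoint_adjoint adjoint_zero)

(* Identifies H with the Hilbert space sum of copies of H indexed by words; C w is the projection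
   onto the component with index w.  So H plays the role of its tensor product with the full Fock space. *)
locale block_system =
  fixes C :: "nat list \<Rightarrow> 'h :: complex_hilbert \<Rightarrow>\<^sub>L 'h"
  assumes clin_C: "complex_linear_op (C w)"
    and parseval: "((\<lambda>w. (norm (C w f))\<^sup>2) has_sum (norm f)\<^sup>2) UNIV"
    and synthesis: "(\<lambda>w. (norm (g w))\<^sup>2) summable_on UNIV \<Longrightarrow> \<exists>f. \<forall>w. C w f = g w"
begin

lemma parseval_inner: "((\<lambda>w. inner (C w f) (C w g)) has_sum inner f g) UNIV"
proof -
  have pol: "inner x y = ((norm (x + y))\<^sup>2 - (norm x)\<^sup>2 - (norm y)\<^sup>2) / 2" for x y :: 'h
    by (simp add: power2_norm_eq_inner inner_add_left inner_add_right inner_commute[of y x])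
  have "((\<lambda>w. (1/2) * ((norm (C w (f + g)))\<^sup>2 + (-1) * (norm (C w f))\<^sup>2 + (-1) * (norm (C w g))\<^sup>2)) has_sum
      (1/2) * ((norm (f + g))\<^sup>2 + (-1) * (norm f)\<^sup>2 + (-1) * (norm g)\<^sup>2)) UNIV"
    by (intro has_sum_cmult_right has_sum_add parseval)
  then show ?thesis by (simp add: pol blinfun.add_right)
qed

lemma ext:
  assumes "\<And>w. C w f = C w g"
  shows "f = g"
proof -
  have "((\<lambda>w :: nat list. 0 :: real) has_sum (norm (f - g))\<^sup>2) UNIV"
    using parseval[of "f - g"] by (simp add: blinfun.diff_right assms)
  then have "(norm (f - g))\<^sup>2 = 0" by (metis has_sum_0 has_sum_unique)
  then show ?thesis by simp
qed

lemma finite_parseval_le: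
  assumes "finite F"
  shows "(\<Sum>w\<in>F. (norm (C w f))\<^sup>2) \<le> (norm f)\<^sup>2"
  by (rule has_sum_mono2[OF has_sum_finite[OF assms] parseval]) auto

text \<open>The isometric inclusion of the component with index w; taken as an adjoint it is bounded
  and linear from the start.\<close>

definition E :: "nat list \<Rightarrow> 'h \<Rightarrow>\<^sub>L 'h" where "E w = op_adjoint (C w)"

lemma clin_E: "complex_linear_op (E w)"
  by (simp add: E_def clin_C clin_adjoint)

lemma C_E: "C v (E w h) = (if v = w then h else 0)"
proof -
  let ?g = "\<lambda>v. if v = w then h else 0"
  have "((\<lambda>v. (norm (?g v))\<^sup>2) has_sum (norm (?g w))\<^sup>2) UNIV" by (rule has_sum_single) auto
  then obtain f where f: "\<And>v. C v f = ?g v" using synthesis[of ?g] summable_on_def by blast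
  have "inner x (E w h) = inner x f" for x
  proof -
    have "((\<lambda>v. inner (C v x) (?g v)) has_sum inner x f) UNIV" using parseval_inner[of x f] by (simp add: f)
    moreover have "((\<lambda>v. inner (C v x) (?g v)) has_sum inner (C w x) (?g w)) UNIV" by (rule has_sum_single) auto
    ultimately have "inner x f = inner (C w x) (?g w)" by (rule has_sum_unique)
    then show ?thesis by (simp add: E_def inner_adjoint[OF clin_C])
  qed
  then have "E w h = f" by (rule inner_eqI)
  then show ?thesis by (simp add: f)
qed

lemma inner_E: "inner (E w h) f = inner h (C w f)"
  by (simp add: E_def inner_adjoint'[OF clin_C])

lemma norm_E: "norm (E w h) = norm h"
  by (simp add: norm_eq_sqrt_inner inner_E C_E)

lemma finite_expansion:
  assumes "finite F" "\<And>w. w \<notin> F \<Longrightarrow> C w f = 0"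
  shows "f = (\<Sum>w\<in>F. E w (C w f))"
proof (rule ext)
  fix v
  have "C v (\<Sum>w\<in>F. E w (C w f)) = (\<Sum>w\<in>F. if w = v then C v f else 0)"
    unfolding blinfun.sum_right C_E by (rule sum.cong) auto
  also have "\<dots> = C v f" using assms by (simp add: sum.delta')
  finally show "C v f = C v (\<Sum>w\<in>F. E w (C w f))" by simp
qed

lemma shift_exists:
  assumes "inj \<sigma>" and a: "complex_linear_op a"
  shows "\<exists>T. complex_linear_op T \<and> (\<forall>f. (\<forall>w. C (\<sigma> w) (T f) = a (C w f)) \<and> (\<forall>v. v \<notin> range \<sigma> \<longrightarrow> C v (T f) = 0))"
proof -
  define g where "g f v = (if v \<in> range \<sigma> then a (C (inv \<sigma> v) f) else 0)" for f v
  have g: "g f (\<sigma> w) = a (C w f)" for f w using assms(1) by (simp add: g_def)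
  have bound: "(\<lambda>v. (norm (g f v))\<^sup>2) summable_on UNIV \<and> (\<Sum>\<^sub>\<infinity>v. (norm (g f v))\<^sup>2) \<le> (norm a * norm f)\<^sup>2" for f
  proof -
    have fin: "sum (\<lambda>v. (norm (g f v))\<^sup>2) F \<le> (norm a * norm f)\<^sup>2" if "finite F" for F
    proof -
      have "sum (\<lambda>v. (norm (g f v))\<^sup>2) F = sum (\<lambda>v. (norm (g f v))\<^sup>2) (F \<inter> range \<sigma>)"
        using that by (intro sum.mono_neutral_right) (auto simp: g_def)
      also have "F \<inter> range \<sigma> = \<sigma> ` (\<sigma> -` F)" by auto
      also have "sum (\<lambda>v. (norm (g f v))\<^sup>2) (\<sigma> ` (\<sigma> -` F)) = (\<Sum>w\<in>\<sigma> -` F. (norm (a (C w f)))\<^sup>2)"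
        using assms(1) by (subst sum.reindex) (auto simp: g inj_on_def)
      also have "\<dots> \<le> (\<Sum>w\<in>\<sigma> -` F. (norm a)\<^sup>2 * (norm (C w f))\<^sup>2)"
        unfolding power_mult_distrib[symmetric] by (intro sum_mono power_mono norm_blinfun) auto
      also have "\<dots> \<le> (norm a)\<^sup>2 * (norm f)\<^sup>2"
        unfolding sum_distrib_left[symmetric] using that assms(1)
        by (intro mult_left_mono finite_parseval_le finite_vimageI) auto
      finally show ?thesis by (simp add: power_mult_distrib)
    qed
    have "(\<lambda>v. (norm (g f v))\<^sup>2) summable_on UNIV"
      by (rule nonneg_bdd_above_summable_on) (use fin in \<open>auto intro!: bdd_aboveI2\<close>)
    then show ?thesis using fin by (auto intro!: infsum_le_finite_sums)
  qed
  have "\<exists>x. \<forall>v. C v x = g f v" for f using synthesis bound by blast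
  then obtain T where T: "\<And>f v. C v (T f) = g f v" by metis
  have "bounded_linear T"
  proof (rule bounded_linear_intro)
    fix x y r
    show "T (x + y) = T x + T y" by (rule ext) (simp add: T g_def blinfun.add_right)
    show "T (r *\<^sub>R x) = r *\<^sub>R T x" by (rule ext) (simp add: T g_def blinfun.scaleR_right)
    have "(norm (T x))\<^sup>2 = (\<Sum>\<^sub>\<infinity>v. (norm (g x v))\<^sup>2)"
      using infsumI[OF parseval[of "T x"]] by (simp add: T)
    also have "\<dots> \<le> (norm a * norm x)\<^sup>2" using bound by blast
    finally have "norm (T x) \<le> norm a * norm x" by (rule power2_le_imp_le) simp
    then show "norm (T x) \<le> norm x * norm a" by (simp add: mult.commute)
  qed
  then have B: "blinfun_apply (Blinfun T) = T" by (rule bounded_linear_Blinfun_apply)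
  have "complex_linear_op (Blinfun T)" unfolding complex_linear_op_def B
    by (intro allI, rule ext) (simp add: T g_def clinD[OF clin_C] clinD[OF a] scaleC_zero_right)
  then show ?thesis using g by (intro exI[of _ "Blinfun T"]) (auto simp: B T g_def)
qed

text \<open>In tensor notation, a tensored with the isometry sending e_w to e_(\<sigma> w). A vector
  is determined by its components, so \<open>SOME\<close> has only one candidate.\<close>

definition shift :: "(nat list \<Rightarrow> nat list) \<Rightarrow> ('h \<Rightarrow>\<^sub>L 'h) \<Rightarrow> 'h \<Rightarrow>\<^sub>L 'h" where
  "shift \<sigma> a = (SOME T. complex_linear_op T \<and> (\<forall>f. (\<forall>w. C (\<sigma> w) (T f) = a (C w f)) \<and> (\<forall>v. v \<notin> range \<sigma> \<longrightarrow> C v (T f) = 0)))"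

lemma shift:
  assumes "inj \<sigma>" "complex_linear_op a"
  shows "complex_linear_op (shift \<sigma> a)" "C (\<sigma> w) (shift \<sigma> a f) = a (C w f)"
    "v \<notin> range \<sigma> \<Longrightarrow> C v (shift \<sigma> a f) = 0"
  using someI_ex[OF shift_exists[OF assms]] unfolding shift_def by blast+

lemma C_adjoint_shift:
  assumes "inj \<sigma>" "complex_linear_op a"
  shows "C w (op_adjoint (shift \<sigma> a) f) = op_adjoint a (C (\<sigma> w) f)"
proof (rule inner_eqI)
  fix x
  note S = shift[OF assms]
  have CE: "C (\<sigma> u) (shift \<sigma> a (E w x)) = (if u = w then a x else 0)" for u
    by (simp add: S(2) C_E blinfun.zero_right)
  then have 0: "C v (shift \<sigma> a (E w x)) = (if v = \<sigma> w then a x else 0)" for v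
    using S(3)[of v "E w x"] CE assms(1) by (cases "v \<in> range \<sigma>") (auto simp: inj_eq simp del: blinfun.zero_right)
  have "((\<lambda>v. inner (C v (shift \<sigma> a (E w x))) (C v f)) has_sum inner (C (\<sigma> w) (shift \<sigma> a (E w x))) (C (\<sigma> w) f)) UNIV"
    by (rule has_sum_single) (simp add: 0)
  then have "inner (shift \<sigma> a (E w x)) f = inner (a x) (C (\<sigma> w) f)"
    using has_sum_unique[OF parseval_inner[of "shift \<sigma> a (E w x)" f]] by (simp add: CE)
  then show "inner x (C w (op_adjoint (shift \<sigma> a) f)) = inner x (op_adjoint a (C (\<sigma> w) f))"
    by (simp flip: inner_E inner_adjoint[OF S(1)] inner_adjoint[OF assms(2)])
qed

text \<open>Creation plus annihilation of the last letter, with identity coefficient. These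
  operators serve to describe the algebra of the left semicirculars through their commutant.\<close>

definition right_semicircular :: "nat \<Rightarrow> 'h \<Rightarrow>\<^sub>L 'h" where
  "right_semicircular j = shift (\<lambda>w. w @ [j]) id_blinfun + op_adjoint (shift (\<lambda>w. w @ [j]) id_blinfun)"

text \<open>The operator a tensored with s_i. The inner adjoint is undone by the outer one, so that
  the annihilation part also carries a and not its adjoint.\<close>

definition left_semicircular :: "nat \<Rightarrow> ('h \<Rightarrow>\<^sub>L 'h) \<Rightarrow> 'h \<Rightarrow>\<^sub>L 'h" where
  "left_semicircular i a = shift (Cons i) a + op_adjoint (shift (Cons i) (op_adjoint a))"

lemma inj_Cons: "inj (Cons i)" by (simp add: inj_def)

lemma inj_snoc: "inj (\<lambda>w. w @ [j])" by (simp add: inj_def)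

lemma clin_right: "complex_linear_op (right_semicircular j)"
  unfolding right_semicircular_def by (intro clin_add clin_adjoint shift(1) inj_snoc clin_id)

lemma adjoint_right: "op_adjoint (right_semicircular j) = right_semicircular j"
  unfolding right_semicircular_def
  by (simp add: adjoint_add clin_adjoint adjoint_adjoint shift(1)[OF inj_snoc] add.commute)

lemma C_right: "C v (right_semicircular j f) =
    (if v \<noteq> [] \<and> last v = j then C (butlast v) f else 0) + C (v @ [j]) f"
proof -
  have "C v (shift (\<lambda>w. w @ [j]) id_blinfun f) = (if v \<noteq> [] \<and> last v = j then C (butlast v) f else 0)"
  proof (cases "v \<noteq> [] \<and> last v = j")
    case True
    then have "v = butlast v @ [j]" by (metis append_butlast_last_id)
    then show ?thesis using True shift(2)[OF inj_snoc[of j] clin_id, of "butlast v" f] by simp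
  qed (auto intro!: shift(3)[OF inj_snoc])
  then show ?thesis
    unfolding right_semicircular_def by (simp add: blinfun.add_left blinfun.add_right C_adjoint_shift[OF inj_snoc])
qed

context
  fixes a :: "'h \<Rightarrow>\<^sub>L 'h"
  assumes a: "complex_linear_op a"
begin

lemma clin_left: "complex_linear_op (left_semicircular i a)"
  unfolding left_semicircular_def by (intro clin_add clin_adjoint shift(1) inj_Cons a)

lemma C_left_Nil: "C [] (left_semicircular i a f) = a (C [i] f)"
  unfolding left_semicircular_def
  by (simp add: blinfun.add_left blinfun.add_right C_adjoint_shift[OF inj_Cons] clin_adjoint a adjoint_adjoint)
    (rule shift(3)[OF inj_Cons a], auto)

lemma C_left_Cons: "C (k # w) (left_semicircular i a f) = (if k = i then a (C w f) else 0) + a (C (i # k # w) f)"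
  unfolding left_semicircular_def
  by (auto simp add: blinfun.add_left blinfun.add_right C_adjoint_shift[OF inj_Cons] clin_adjoint a adjoint_adjoint
      shift(2)[OF inj_Cons a] intro!: shift(3)[OF inj_Cons a])

text \<open>Creating on one side and annihilating on the other commute except at the vacuum. There
  the commutator of l_i with r_i^* and that of l_i^* with r_i are opposite, so they cancel in the
  sum.\<close>

lemma left_right_commute:
  "right_semicircular j o\<^sub>L left_semicircular i a = left_semicircular i a o\<^sub>L right_semicircular j"
proof (rule blinfun_eqI, rule ext)
  fix f v
  show "C v ((right_semicircular j o\<^sub>L left_semicircular i a) f) = C v ((left_semicircular i a o\<^sub>L right_semicircular j) f)"
  proof (cases v)
    case Nil
    then show ?thesis by (simp add: C_right C_left_Nil C_left_Cons blinfun.add_right)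
  next
    case (Cons k w)
    then show ?thesis
      by (cases "butlast v"; cases w)
        (auto simp: C_right C_left_Nil C_left_Cons blinfun.add_right blinfun.zero_right split: if_splits)
  qed
qed

text \<open>The creation and the annihilation part are kept apart because they are estimated by
  different norms of the family.\<close>

lemma inner_left:
  "((\<lambda>w. inner (a (C w f)) (C (i # w) g) + inner (a (C (i # w) f)) (C w g)) has_sum inner (left_semicircular i a f) g) UNIV"
proof -
  note a' = clin_adjoint[OF a]
  have "((\<lambda>w. inner (a (C w f)) (C (i # w) g)) has_sum inner (shift (Cons i) a f) g) UNIV"
    using parseval_inner[of f "op_adjoint (shift (Cons i) a) g"]
    by (simp add: C_adjoint_shift[OF inj_Cons a] inner_adjoint[OF shift(1)[OF inj_Cons a]] inner_adjoint[OF a])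
  moreover have "((\<lambda>w. inner (a (C (i # w) f)) (C w g)) has_sum inner (op_adjoint (shift (Cons i) (op_adjoint a)) f) g) UNIV"
    using parseval_inner[of "op_adjoint (shift (Cons i) (op_adjoint a)) f" g]
    by (simp add: C_adjoint_shift[OF inj_Cons a'] adjoint_adjoint a)
  ultimately show ?thesis
    unfolding left_semicircular_def blinfun.add_left inner_add_left by (rule has_sum_add)
qed

end

section \<open>Operators as block matrices indexed by words\<close>

definition entry :: "('h \<Rightarrow>\<^sub>L 'h) \<Rightarrow> nat list \<Rightarrow> nat list \<Rightarrow> 'h \<Rightarrow>\<^sub>L 'h" where
  "entry X v w = C v o\<^sub>L (X o\<^sub>L E w)"

(* Finiteness of rows and columns makes the entries of a product finite sums, so that they lie in A
   without any closedness of A. *)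
definition fock_algebra :: "('h \<Rightarrow>\<^sub>L 'h) set \<Rightarrow> ('h \<Rightarrow>\<^sub>L 'h) set" where
  "fock_algebra A = {X. complex_linear_op X \<and>
     (\<forall>j. right_semicircular j o\<^sub>L X = X o\<^sub>L right_semicircular j) \<and>
     (\<forall>v w. entry X v w \<in> A) \<and>
     (\<forall>w. finite {v. entry X v w \<noteq> 0}) \<and> (\<forall>v. finite {w. entry X v w \<noteq> 0})}"

lemma entry_adjoint: "complex_linear_op X \<Longrightarrow> entry (op_adjoint X) v w = op_adjoint (entry X w v)"
  unfolding entry_def E_def
  by (simp add: adjoint_comp clin_comp clin_adjoint clin_C adjoint_adjoint comp_assoc)

lemma entry_comp:
  assumes "finite {z. entry Y z w \<noteq> 0}"
  shows "entry (X o\<^sub>L Y) v w = (\<Sum>z | entry Y z w \<noteq> 0. entry X v z o\<^sub>L entry Y z w)"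
proof (rule blinfun_eqI)
  fix h
  have "Y (E w h) = (\<Sum>z | entry Y z w \<noteq> 0. E z (C z (Y (E w h))))"
  proof (rule finite_expansion[OF assms])
    fix z assume "z \<notin> {z. entry Y z w \<noteq> 0}"
    then have "entry Y z w h = 0" by simp
    then show "C z (Y (E w h)) = 0" by (simp add: entry_def)
  qed
  then have "C v (X (Y (E w h))) = (\<Sum>z | entry Y z w \<noteq> 0. C v (X (E z (C z (Y (E w h))))))"
    by (metis (no_types, lifting) blinfun.sum_right sum.cong)
  then show "entry (X o\<^sub>L Y) v w h = (\<Sum>z | entry Y z w \<noteq> 0. entry X v z o\<^sub>L entry Y z w) h"
    by (simp add: entry_def blinfun.sum_left)
qed

lemma entry_add: "entry (X + Y) v w = entry X v w + entry Y v w"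
  by (simp add: entry_def comp_add_left comp_add_right)

lemma entry_scaleC: "entry (c *\<^sub>C X) v w = c *\<^sub>C entry X v w"
  by (rule blinfun_eqI) (simp add: entry_def scaleC_blinfun_apply clinD[OF clin_C])

text \<open>Adjoints exchange rows and columns, which is why both must be finite. The right
  semicirculars are self-adjoint, so their commutant is closed under adjoints.\<close>

lemma star_algebra_fock:
  assumes A: "star_algebra A"
  shows "star_algebra (fock_algebra A)"
  unfolding star_algebra_def
proof (intro conjI ballI allI)
  note D = star_algebraD[OF A]
  show "complex_linear_op S" if "S \<in> fock_algebra A" for S using that by (simp add: fock_algebra_def)
  have e0: "entry 0 v w = 0" for v w by (rule blinfun_eqI) (simp add: entry_def blinfun.zero_right)
  show "0 \<in> fock_algebra A"
    by (auto simp: fock_algebra_def e0 D intro!: blinfun_eqI simp: blinfun.zero_right)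
  fix S assume S: "S \<in> fock_algebra A"
  show "c *\<^sub>C S \<in> fock_algebra A" for c
  proof -
    have "{v. entry (c *\<^sub>C S) v w \<noteq> 0} \<subseteq> {v. entry S v w \<noteq> 0}" "{w. entry (c *\<^sub>C S) v w \<noteq> 0} \<subseteq> {w. entry S v w \<noteq> 0}" for v w
      by (auto simp: entry_scaleC scaleC_zero_right)
    moreover have "finite {v. entry S v w \<noteq> 0}" "finite {w. entry S v w \<noteq> 0}" for v w
      using S by (auto simp: fock_algebra_def)
    ultimately have "finite {v. entry (c *\<^sub>C S) v w \<noteq> 0}" "finite {w. entry (c *\<^sub>C S) v w \<noteq> 0}" for v w
      by (meson finite_subset)+
    moreover have "right_semicircular j o\<^sub>L c *\<^sub>C S = c *\<^sub>C S o\<^sub>L right_semicircular j" for j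
    proof -
      have "right_semicircular j (S x) = S (right_semicircular j x)" for x
        using S unfolding fock_algebra_def by (metis (mono_tags, lifting) blinfun_apply_blinfun_compose mem_Collect_eq)
      then show ?thesis by (intro blinfun_eqI) (simp add: scaleC_blinfun_apply clinD[OF clin_right])
    qed
    ultimately show ?thesis using S unfolding fock_algebra_def
      by (auto simp: clin_scaleC entry_scaleC D)
  qed
  show "op_adjoint S \<in> fock_algebra A"
  proof -
    have cS: "complex_linear_op S" using S by (simp add: fock_algebra_def)
    have ce: "complex_linear_op (entry S v w)" for v w using S D(1) by (simp add: fock_algebra_def)
    have "right_semicircular j o\<^sub>L op_adjoint S = op_adjoint S o\<^sub>L right_semicircular j" for j
    proof -
      have "op_adjoint (S o\<^sub>L right_semicircular j) = op_adjoint (right_semicircular j o\<^sub>L S)"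
        using S by (simp add: fock_algebra_def)
      then show ?thesis by (simp add: adjoint_comp cS clin_right adjoint_right)
    qed
    then show ?thesis using S
      by (auto simp: fock_algebra_def clin_adjoint entry_adjoint D adjoint_eq_0_iff[OF ce])
  qed
  fix T assume T: "T \<in> fock_algebra A"
  show "S + T \<in> fock_algebra A"
  proof -
    have "{v. entry (S + T) v w \<noteq> 0} \<subseteq> {v. entry S v w \<noteq> 0} \<union> {v. entry T v w \<noteq> 0}"
      "{w. entry (S + T) v w \<noteq> 0} \<subseteq> {w. entry S v w \<noteq> 0} \<union> {w. entry T v w \<noteq> 0}" for v w
      by (auto simp: entry_add)
    moreover have "finite ({v. entry S v w \<noteq> 0} \<union> {v. entry T v w \<noteq> 0})"
      "finite ({w. entry S v w \<noteq> 0} \<union> {w. entry T v w \<noteq> 0})" for v w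
      using S T by (auto simp: fock_algebra_def)
    ultimately have "finite {v. entry (S + T) v w \<noteq> 0}" "finite {w. entry (S + T) v w \<noteq> 0}" for v w
      by (meson finite_subset)+
    then show ?thesis using S T unfolding fock_algebra_def
      by (auto simp: clin_add entry_add D comp_add_left comp_add_right)
  qed
  show "S o\<^sub>L T \<in> fock_algebra A"
  proof -
    have fin: "finite {v. entry S v w \<noteq> 0}" "finite {w. entry S v w \<noteq> 0}"
      "finite {v. entry T v w \<noteq> 0}" "finite {w. entry T v w \<noteq> 0}" for v w
      using S T by (auto simp: fock_algebra_def)
    have ent: "entry (S o\<^sub>L T) v w = (\<Sum>z | entry T z w \<noteq> 0. entry S v z o\<^sub>L entry T z w)" for v w
      by (rule entry_comp[OF fin(3)])
    have nz: "\<exists>z. entry S v z \<noteq> 0 \<and> entry T z w \<noteq> 0" if "entry (S o\<^sub>L T) v w \<noteq> 0" for v w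
    proof (rule ccontr)
      assume "\<nexists>z. entry S v z \<noteq> 0 \<and> entry T z w \<noteq> 0"
      then have "entry S v z = 0 \<or> entry T z w = 0" for z by blast
      moreover have "0 o\<^sub>L T = (0 :: 'h \<Rightarrow>\<^sub>L 'h)" for T :: "'h \<Rightarrow>\<^sub>L 'h" by (rule blinfun_eqI) simp
      ultimately have "entry (S o\<^sub>L T) v w = 0" unfolding ent
        by (intro sum.neutral ballI) (metis (mono_tags, lifting) mem_Collect_eq)
      with that show False by simp
    qed
    have "{v. entry (S o\<^sub>L T) v w \<noteq> 0} \<subseteq> (\<Union>z\<in>{z. entry T z w \<noteq> 0}. {v. entry S v z \<noteq> 0})"
      "{w. entry (S o\<^sub>L T) v w \<noteq> 0} \<subseteq> (\<Union>z\<in>{z. entry S v z \<noteq> 0}. {w. entry T z w \<noteq> 0})" for v w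
      using nz by blast+
    moreover have "finite (\<Union>z\<in>{z. entry T z w \<noteq> 0}. {v. entry S v z \<noteq> 0})"
      "finite (\<Union>z\<in>{z. entry S v z \<noteq> 0}. {w. entry T z w \<noteq> 0})" for v w
      by (intro finite_UN_I fin)+
    ultimately have "finite {v. entry (S o\<^sub>L T) v w \<noteq> 0}" "finite {w. entry (S o\<^sub>L T) v w \<noteq> 0}" for v w
      by (meson finite_subset)+
    moreover have "entry (S o\<^sub>L T) v w \<in> A" for v w
      unfolding ent using S T by (intro star_algebra_sum[OF A] D(5)) (auto simp: fock_algebra_def)
    moreover have "right_semicircular j o\<^sub>L (S o\<^sub>L T) = (S o\<^sub>L T) o\<^sub>L right_semicircular j" for j
      using S T unfolding fock_algebra_def by (metis (mono_tags, lifting) comp_assoc mem_Collect_eq)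
    ultimately show ?thesis using S T unfolding fock_algebra_def by (auto intro: clin_comp)
  qed
qed

(* This is the trace property of the vacuum state on the algebra of the left semicirculars. *)
lemma entry_vacuum_swap:
  assumes "X \<in> fock_algebra A"
  shows "entry X [] [j] = entry X [j] []"
proof (rule blinfun_eqI)
  fix h
  \<comment> \<open>The right semicircular creates the letter j from the vacuum. As X commutes with
    it, the letter moves from the argument of X to the component that is read off.\<close>
  have RE: "right_semicircular j (E [] h) = E [j] h"
  proof (rule ext)
    fix v show "C v (right_semicircular j (E [] h)) = C v (E [j] h)"
      by (cases v rule: rev_cases) (auto simp: C_right C_E)
  qed
  have comm: "right_semicircular j (X x) = X (right_semicircular j x)" for x
    using assms unfolding fock_algebra_def by (metis (mono_tags, lifting) blinfun_apply_blinfun_compose mem_Collect_eq)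
  have "C [] (X (E [j] h)) = C [] (right_semicircular j (X (E [] h)))" by (simp add: comm RE)
  also have "\<dots> = C [j] (X (E [] h))" by (simp add: C_right)
  finally show "entry X [] [j] h = entry X [j] [] h" by (simp add: entry_def)
qed

lemma left_in_fock:
  assumes A: "star_algebra A" and a: "a \<in> A"
  shows "left_semicircular i a \<in> fock_algebra A"
proof -
  note D = star_algebraD[OF A]
  have ca: "complex_linear_op a" using a by (rule D)
  have ent: "entry (left_semicircular i a) v w = (if v = i # w \<or> w = i # v then a else 0)" for v w
    by (rule blinfun_eqI, cases v)
      (auto simp: entry_def C_left_Nil[OF ca] C_left_Cons[OF ca] C_E blinfun.zero_right)
  have "{v. entry (left_semicircular i a) v w \<noteq> 0} \<subseteq> {i # w, tl w}"
    "{w. entry (left_semicircular i a) v w \<noteq> 0} \<subseteq> {i # v, tl v}" for v w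
    by (auto simp: ent split: if_splits)
  then have "finite {v. entry (left_semicircular i a) v w \<noteq> 0}" "finite {w. entry (left_semicircular i a) v w \<noteq> 0}" for v w
    by (meson finite.emptyI finite.insertI finite_subset)+
  then show ?thesis unfolding fock_algebra_def
    by (simp add: clin_left[OF ca] left_right_commute[OF ca]) (simp add: ent a D(2))
qed

end

section \<open>Families indexed by multi-indices\<close>

lemma finite_multi_index: "finite D \<Longrightarrow> finite (multi_index n D)"
  unfolding multi_index_def by (intro finite_PiE) auto

lemma sum_multi_index_insert:
  assumes "d \<notin> D"
  shows "(\<Sum>J\<in>multi_index n (insert d D). f J) = (\<Sum>J\<in>multi_index n D. \<Sum>i=1..n. f (J(d := i)))"
proof -
  have "inj_on (\<lambda>(i, J). J(d := i)) ({1..n} \<times> multi_index n D)"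
    unfolding multi_index_def by (rule inj_combinator) (rule assms)
  then have "(\<Sum>J\<in>multi_index n (insert d D). f J) = (\<Sum>(i, J)\<in>{1..n} \<times> multi_index n D. f (J(d := i)))"
    unfolding multi_index_def PiE_insert_eq by (subst sum.reindex) (auto simp: case_prod_beta)
  also have "\<dots> = (\<Sum>i=1..n. \<Sum>J\<in>multi_index n D. f (J(d := i)))" by (simp add: sum.cartesian_product)
  finally show ?thesis by (simp add: sum.swap[of _ "multi_index n D"])
qed

lemma multi_index_upd: "J \<in> multi_index n D \<Longrightarrow> i \<in> {1..n} \<Longrightarrow> J(d := i) \<in> multi_index n (insert d D)"
  unfolding multi_index_def by (rule PiE_fun_upd) auto

lemma restrict_upd_notin: "d \<notin> B \<Longrightarrow> restrict (J(d := i)) B = restrict J B"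
  by (auto simp: restrict_def)

lemma restrict_upd_insert: "restrict (J(d := i)) (insert d B) = (restrict J B)(d := i)"
  by (auto simp: restrict_def)

lemma multi_index_restrict: "J \<in> multi_index n D \<Longrightarrow> restrict J D = J"
  unfolding multi_index_def by (rule PiE_restrict)

lemma multi_index_empty: "multi_index n {} = {\<lambda>_. undefined}"
  by (simp add: multi_index_def)

definition pairing_bounded ::
    "nat \<Rightarrow> nat set \<Rightarrow> nat set \<Rightarrow> ((nat \<Rightarrow> nat) \<Rightarrow> 'h :: real_inner \<Rightarrow>\<^sub>L 'h) \<Rightarrow> real \<Rightarrow> bool"
  where "pairing_bounded n D \<alpha> a c \<longleftrightarrow>
    (\<forall>x y. (\<Sum>J\<in>multi_index n D. inner (a J (x (restrict J \<alpha>))) (y (restrict J (D - \<alpha>)))) \<le>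
      c * L2_set (\<lambda>l. norm (x l)) (multi_index n \<alpha>) * L2_set (\<lambda>m. norm (y m)) (multi_index n (D - \<alpha>)))"

lemma pairing_bounded_cong:
  assumes "\<And>J. J \<in> multi_index n D \<Longrightarrow> a J = b J"
  shows "pairing_bounded n D \<alpha> a c = pairing_bounded n D \<alpha> b c"
  unfolding pairing_bounded_def by (simp add: assms cong: sum.cong)

lemma L2_set_sq: "(L2_set f I)\<^sup>2 = (\<Sum>i\<in>I. (f i)\<^sup>2)"
  by (simp add: L2_set_def sum_nonneg)

text \<open>There is exactly one empty tuple, the constant \<open>undefined\<close>, so x reduces to
  a single vector h. Testing with y J = a J h extracts the square sum; Cauchy-Schwarz gives the
  converse.\<close>

lemma pairing_bounded_empty_iff:
  fixes a :: "(nat \<Rightarrow> nat) \<Rightarrow> 'h :: real_inner \<Rightarrow>\<^sub>L 'h"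
  assumes "c \<ge> 0"
  shows "pairing_bounded n D {} a c \<longleftrightarrow> (\<forall>h. (\<Sum>J\<in>multi_index n D. (norm (a J h))\<^sup>2) \<le> c\<^sup>2 * (norm h)\<^sup>2)"
proof -
  let ?I = "multi_index n D"
  have "pairing_bounded n D {} a c \<longleftrightarrow> (\<forall>h y. (\<Sum>J\<in>?I. inner (a J h) (y J)) \<le> c * norm h * L2_set (\<lambda>m. norm (y m)) ?I)"
    (is "_ = ?B")
  proof -
    have "(\<Sum>J\<in>?I. inner (a J (x (restrict J {}))) (y (restrict J D))) = (\<Sum>J\<in>?I. inner (a J (x (\<lambda>_. undefined))) (y J))"
      for x y :: "(nat \<Rightarrow> nat) \<Rightarrow> 'h"
      by (intro sum.cong) (auto simp: restrict_def multi_index_restrict[unfolded restrict_def])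
    then have "pairing_bounded n D {} a c \<longleftrightarrow>
      (\<forall>(x :: (nat \<Rightarrow> nat) \<Rightarrow> 'h) y. (\<Sum>J\<in>?I. inner (a J (x (\<lambda>_. undefined))) (y J)) \<le> c * norm (x (\<lambda>_. undefined)) * L2_set (\<lambda>m. norm (y m)) ?I)"
      unfolding pairing_bounded_def by (simp add: multi_index_empty)
    also have "\<dots> \<longleftrightarrow> ?B"
    proof (intro iffI allI)
      fix h y
      assume "\<forall>(x :: (nat \<Rightarrow> nat) \<Rightarrow> 'h) y. (\<Sum>J\<in>?I. inner (a J (x (\<lambda>_. undefined))) (y J)) \<le> c * norm (x (\<lambda>_. undefined)) * L2_set (\<lambda>m. norm (y m)) ?I"
      from this[rule_format, of "\<lambda>_. h" y]
      show "(\<Sum>J\<in>?I. inner (a J h) (y J)) \<le> c * norm h * L2_set (\<lambda>m. norm (y m)) ?I" .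
    qed blast
    finally show ?thesis .
  qed
  also have "\<dots> \<longleftrightarrow> (\<forall>h. (\<Sum>J\<in>?I. (norm (a J h))\<^sup>2) \<le> c\<^sup>2 * (norm h)\<^sup>2)"
  proof safe
    fix h
    assume *: ?B
    define L where "L = L2_set (\<lambda>J. norm (a J h)) ?I"
    have "L * L \<le> c * norm h * L"
      using *[rule_format, of h "\<lambda>J. a J h"] by (simp add: L_def L2_set_sq dot_square_norm flip: power2_eq_square)
    then have "L \<le> c * norm h"
      using assms by (cases "L = 0") (auto simp: L_def L2_set_nonneg order_less_le intro: mult_right_le_imp_le)
    then have "L\<^sup>2 \<le> (c * norm h)\<^sup>2" by (intro power_mono) (auto simp: L_def L2_set_nonneg)
    then show "(\<Sum>J\<in>?I. (norm (a J h))\<^sup>2) \<le> c\<^sup>2 * (norm h)\<^sup>2" by (simp add: L_def L2_set_sq power_mult_distrib)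
  next
    fix h y
    assume "\<forall>h. (\<Sum>J\<in>?I. (norm (a J h))\<^sup>2) \<le> c\<^sup>2 * (norm h)\<^sup>2"
    then show "(\<Sum>J\<in>?I. inner (a J h) (y J)) \<le> c * norm h * L2_set (\<lambda>m. norm (y m)) ?I"
      using assms by (intro inner_sum_le) (auto simp: L2_set_nonneg L2_set_sq power_mult_distrib)
  qed
  finally show ?thesis .
qed

lemma pairing_bounded_full_iff:
  fixes a :: "(nat \<Rightarrow> nat) \<Rightarrow> 'h :: complex_hilbert \<Rightarrow>\<^sub>L 'h"
  assumes "c \<ge> 0" and clin: "\<And>J. J \<in> multi_index n D \<Longrightarrow> complex_linear_op (a J)"
  shows "pairing_bounded n D D a c \<longleftrightarrow> (\<forall>h. (\<Sum>J\<in>multi_index n D. (norm (op_adjoint (a J) h))\<^sup>2) \<le> c\<^sup>2 * (norm h)\<^sup>2)"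
proof -
  have "(\<Sum>J\<in>multi_index n D. inner (a J (x J)) y) = (\<Sum>J\<in>multi_index n D. inner (op_adjoint (a J) y) (x J))" for x y
    by (intro sum.cong refl) (metis clin inner_adjoint inner_commute)
  then have "pairing_bounded n D D a c \<longleftrightarrow> pairing_bounded n D {} (\<lambda>J. op_adjoint (a J)) c"
    unfolding pairing_bounded_def by (simp add: multi_index_restrict multi_index_empty restrict_def[of _ "{}"] mult_ac cong: sum.cong) blast
  then show ?thesis using pairing_bounded_empty_iff[OF assms(1)] by simp
qed

section \<open>Little Grothendieck inequality for operator-valued maps\<close>

definition bounded_map_on :: "('h :: complex_hilbert \<Rightarrow>\<^sub>L 'h) set \<Rightarrow>
      (('h \<Rightarrow>\<^sub>L 'h) \<Rightarrow> 'g :: complex_hilbert \<Rightarrow>\<^sub>L 'g) \<Rightarrow> real \<Rightarrow> bool"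
  where "bounded_map_on A u M \<longleftrightarrow> M \<ge> 0 \<and>
    (\<forall>S\<in>A. complex_linear_op (u S)) \<and>
    (\<forall>S\<in>A. \<forall>T\<in>A. u (S + T) = u S + u T) \<and>
    (\<forall>c. \<forall>S\<in>A. u (c *\<^sub>C S) = c *\<^sub>C u S) \<and>
    (\<forall>S\<in>A. norm (u S) \<le> M * norm S)"

lemma bounded_map_onD:
  assumes "bounded_map_on A u M"
  shows "M \<ge> 0" "S \<in> A \<Longrightarrow> complex_linear_op (u S)" "S \<in> A \<Longrightarrow> T \<in> A \<Longrightarrow> u (S + T) = u S + u T"
    "S \<in> A \<Longrightarrow> u (c *\<^sub>C S) = c *\<^sub>C u S" "S \<in> A \<Longrightarrow> norm (u S) \<le> M * norm S"
  using assms by (auto simp: bounded_map_on_def)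

text \<open>Evaluation at h gives a Hilbert space valued map for the columns. For the rows the map
  is \<open>\<lambda>S. op_adjoint (u (op_adjoint S)) h\<close>: two adjoints make it complex linear
  again, and P and Q change places.\<close>

lemma little_grothendieck_op:
  fixes u :: "('h :: complex_hilbert \<Rightarrow>\<^sub>L 'h) \<Rightarrow> 'g :: complex_hilbert \<Rightarrow>\<^sub>L 'g"
  assumes A: "star_algebra A" and u: "bounded_map_on A u M"
    and a: "finite I" "\<And>j. j \<in> I \<Longrightarrow> a j \<in> A"
    and P: "\<And>h. (\<Sum>j\<in>I. (norm (a j h))\<^sup>2) \<le> P * (norm h)\<^sup>2" "P \<ge> 0"
    and Q: "\<And>h. (\<Sum>j\<in>I. (norm (op_adjoint (a j) h))\<^sup>2) \<le> Q * (norm h)\<^sup>2" "Q \<ge> 0"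
  shows "(\<Sum>j\<in>I. (norm (u (a j) h))\<^sup>2) \<le> M\<^sup>2 * (P + Q) * (norm h)\<^sup>2"
    and "(\<Sum>j\<in>I. (norm (op_adjoint (u (a j)) h))\<^sup>2) \<le> M\<^sup>2 * (P + Q) * (norm h)\<^sup>2"
proof -
  note D = star_algebraD[OF A] and U = bounded_map_onD[OF u]
  have "(\<Sum>j\<in>I. (norm (u (a j) h))\<^sup>2) \<le> (M * norm h)\<^sup>2 * (P + Q)"
  proof (rule little_grothendieck[OF A, where u = "\<lambda>S. u S h" and a = a])
    fix S assume S: "S \<in> A"
    have "norm (u S h) \<le> norm (u S) * norm h" by (rule norm_blinfun)
    also have "\<dots> \<le> M * norm S * norm h" by (intro mult_right_mono U S) simp
    finally show "norm (u S h) \<le> M * norm h * norm S" by (simp add: mult_ac)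
  qed (use a P Q U in \<open>auto simp: blinfun.add_left scaleC_blinfun_apply\<close>)
  then show "(\<Sum>j\<in>I. (norm (u (a j) h))\<^sup>2) \<le> M\<^sup>2 * (P + Q) * (norm h)\<^sup>2"
    by (simp add: power_mult_distrib mult_ac)
  have adj: "op_adjoint (op_adjoint (a j)) = a j" if "j \<in> I" for j using a(2)[OF that] D by (simp add: adjoint_adjoint)
  have "(\<Sum>j\<in>I. (norm (op_adjoint (u (op_adjoint (op_adjoint (a j)))) h))\<^sup>2) \<le> (M * norm h)\<^sup>2 * (Q + P)"
  proof (rule little_grothendieck[OF A, where u = "\<lambda>S. op_adjoint (u (op_adjoint S)) h" and a = "\<lambda>j. op_adjoint (a j)"])
    fix S assume S: "S \<in> A"
    have "norm (op_adjoint (u (op_adjoint S)) h) \<le> norm (op_adjoint (u (op_adjoint S))) * norm h" by (rule norm_blinfun)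
    also have "norm (op_adjoint (u (op_adjoint S))) \<le> norm (u (op_adjoint S))" by (intro norm_adjoint_le U D S)
    also have "\<dots> \<le> M * norm (op_adjoint S)" by (intro U D S)
    also have "\<dots> \<le> M * norm S" by (intro mult_left_mono norm_adjoint_le U D S)
    finally show "norm (op_adjoint (u (op_adjoint S)) h) \<le> M * norm h * norm S" by (simp add: mult_ac mult_right_mono)
    show "op_adjoint (u (op_adjoint (c *\<^sub>C S))) h = c *\<^sub>C op_adjoint (u (op_adjoint S)) h" for c
      using S by (simp add: adjoint_scaleC D U scaleC_blinfun_apply)
    show "op_adjoint (u (op_adjoint (S + T))) h = op_adjoint (u (op_adjoint S)) h + op_adjoint (u (op_adjoint T)) h" if "T \<in> A" for T
      using S that by (simp add: adjoint_add D U blinfun.add_left)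
  next
    show "(\<Sum>j\<in>I. (norm (op_adjoint (op_adjoint (a j)) h))\<^sup>2) \<le> P * (norm h)\<^sup>2" for h
      using P(1)[of h] by (simp add: adj cong: sum.cong)
  qed (use a P Q U D in auto)
  then show "(\<Sum>j\<in>I. (norm (op_adjoint (u (a j)) h))\<^sup>2) \<le> M\<^sup>2 * (P + Q) * (norm h)\<^sup>2"
    by (simp add: adj power_mult_distrib mult_ac add.commute cong: sum.cong)
qed

lemma has_sum_sum:
  fixes f :: "'i \<Rightarrow> 'j \<Rightarrow> real"
  assumes "\<And>i. i \<in> I \<Longrightarrow> (f i has_sum s i) A"
  shows "((\<lambda>w. \<Sum>i\<in>I. f i w) has_sum (\<Sum>i\<in>I. s i)) A"
  using assms by (induction I rule: infinite_finite_induct) (auto intro: has_sum_add has_sum_0)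

lemma sum_product_le:
  fixes A B :: "'i \<Rightarrow> real"
  assumes "\<And>w. w \<in> F \<Longrightarrow> f w \<le> c * A w * B w" "(\<Sum>w\<in>F. (A w)\<^sup>2) \<le> p\<^sup>2" "(\<Sum>w\<in>F. (B w)\<^sup>2) \<le> q\<^sup>2"
    "c \<ge> 0" "p \<ge> 0" "q \<ge> 0"
  shows "(\<Sum>w\<in>F. f w) \<le> c * p * q"
proof -
  have "(\<Sum>w\<in>F. f w) \<le> (\<Sum>w\<in>F. c * (A w * B w))" using assms(1) by (intro sum_mono) (simp add: mult_ac)
  also have "\<dots> = c * (\<Sum>w\<in>F. inner (A w) (B w))" by (simp add: sum_distrib_left)
  also have "\<dots> \<le> c * (p * q)" using assms by (intro mult_left_mono inner_sum_le) auto
  finally show ?thesis by (simp add: mult_ac)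
qed

context block_system
begin

section \<open>Passing between families and operators on the Fock space\<close>

lemma finite_parseval_reindex_le:
  assumes "finite I" "inj_on \<sigma> I"
  shows "(\<Sum>i\<in>I. (norm (C (\<sigma> i) f))\<^sup>2) \<le> (norm f)\<^sup>2"
  using finite_parseval_le[of "\<sigma> ` I" f] assms by (simp add: sum.reindex)

text \<open>The vacuum column of X has column norm at most \<open>norm X\<close> by Bessel's
  inequality. Since its one-letter entries agree with those of the vacuum row, the adjoints of the
  entries form the vacuum column of the adjoint of X, which gives the row bound. P = Q = |X|^2
  yields the 2.\<close>

lemma fock_entries_bound:
  fixes u :: "('h \<Rightarrow>\<^sub>L 'h) \<Rightarrow> 'g :: complex_hilbert \<Rightarrow>\<^sub>L 'g"
  assumes A: "star_algebra A" and u: "bounded_map_on A u M" and X: "X \<in> fock_algebra A" and I: "finite I"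
  shows "(\<Sum>i\<in>I. (norm (u (entry X [i] []) h))\<^sup>2) \<le> 2 * (M * norm X)\<^sup>2 * (norm h)\<^sup>2"
    and "(\<Sum>i\<in>I. (norm (op_adjoint (u (entry X [i] [])) h))\<^sup>2) \<le> 2 * (M * norm X)\<^sup>2 * (norm h)\<^sup>2"
proof -
  have P: "(\<Sum>i\<in>I. (norm (entry Y [i] [] h))\<^sup>2) \<le> (norm X)\<^sup>2 * (norm h)\<^sup>2" if "norm Y \<le> norm X" for Y h
  proof -
    have "(\<Sum>i\<in>I. (norm (entry Y [i] [] h))\<^sup>2) \<le> (norm (Y (E [] h)))\<^sup>2"
      using finite_parseval_reindex_le[OF I, of "\<lambda>i. [i]" "Y (E [] h)"] by (simp add: entry_def inj_on_def)
    also have "\<dots> \<le> (norm X * norm h)\<^sup>2"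
    proof (intro power_mono)
      have "norm (Y (E [] h)) \<le> norm Y * norm h" using norm_blinfun[of Y "E [] h"] by (simp add: norm_E)
      also have "\<dots> \<le> norm X * norm h" using that by (intro mult_right_mono) auto
      finally show "norm (Y (E [] h)) \<le> norm X * norm h" .
    qed simp
    finally show ?thesis by (simp add: power_mult_distrib)
  qed
  note F = star_algebraD[OF star_algebra_fock[OF A]]
  have "op_adjoint (entry X [i] []) = entry (op_adjoint X) [i] []" for i
    using entry_vacuum_swap[OF F(6)[OF X], of i] entry_adjoint[OF F(1)[OF X], of "[]" "[i]"] by simp
  then have Q: "(\<Sum>i\<in>I. (norm (op_adjoint (entry X [i] []) h))\<^sup>2) \<le> (norm X)\<^sup>2 * (norm h)\<^sup>2" for h
    using P[OF norm_adjoint_le[OF F(1)[OF X]]] by simp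
  have ent: "entry X [i] [] \<in> A" for i using X by (simp add: fock_algebra_def)
  note G = little_grothendieck_op[OF A u I ent P[OF order_refl] _ Q, of h]
  show "(\<Sum>i\<in>I. (norm (u (entry X [i] []) h))\<^sup>2) \<le> 2 * (M * norm X)\<^sup>2 * (norm h)\<^sup>2"
    and "(\<Sum>i\<in>I. (norm (op_adjoint (u (entry X [i] [])) h))\<^sup>2) \<le> 2 * (M * norm X)\<^sup>2 * (norm h)\<^sup>2"
    using G by (simp_all add: power_mult_distrib mult_ac)
qed

lemma sum_L2_C_le:
  assumes "finite F" "finite I"
  shows "(\<Sum>w\<in>F. (L2_set (\<lambda>l. norm (C w (x l))) I)\<^sup>2) \<le> (L2_set (\<lambda>l. norm (x l)) I)\<^sup>2"
  unfolding L2_set_sq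
  by (subst sum.swap) (intro sum_mono finite_parseval_le assms)

text \<open>The words i # w are distinct for distinct pairs (i, w), so the extra sum over the new
  letter still meets every component at most once.\<close>

lemma sum_L2_C_Cons_le:
  assumes "finite F" "finite B" "d \<notin> B"
  shows "(\<Sum>w\<in>F. (L2_set (\<lambda>m. norm (C (m d # w) (x (restrict m B)))) (multi_index n (insert d B)))\<^sup>2)
    \<le> (L2_set (\<lambda>l. norm (x l)) (multi_index n B))\<^sup>2"
proof -
  have "(\<Sum>w\<in>F. (L2_set (\<lambda>m. norm (C (m d # w) (x (restrict m B)))) (multi_index n (insert d B)))\<^sup>2) =
     (\<Sum>w\<in>F. \<Sum>l\<in>multi_index n B. \<Sum>i=1..n. (norm (C (i # w) (x l)))\<^sup>2)"
    unfolding L2_set_sq using assms(3)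
    by (simp add: sum_multi_index_insert restrict_upd_notin multi_index_restrict cong: sum.cong)
  also have "\<dots> = (\<Sum>l\<in>multi_index n B. \<Sum>w\<in>F. \<Sum>i=1..n. (norm (C (i # w) (x l)))\<^sup>2)" by (rule sum.swap)
  also have "\<dots> \<le> (\<Sum>l\<in>multi_index n B. (norm (x l))\<^sup>2)"
  proof (rule sum_mono)
    fix l
    have "(\<Sum>w\<in>F. \<Sum>i=1..n. (norm (C (i # w) (x l)))\<^sup>2) = (\<Sum>p\<in>F \<times> {1..n}. (norm (C (snd p # fst p) (x l)))\<^sup>2)"
      by (simp add: sum.cartesian_product case_prod_beta)
    also have "\<dots> \<le> (norm (x l))\<^sup>2"
      using assms(1) by (intro finite_parseval_reindex_le) (auto simp: inj_on_def)
    finally show "(\<Sum>w\<in>F. \<Sum>i=1..n. (norm (C (i # w) (x l)))\<^sup>2) \<le> (norm (x l))\<^sup>2" .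
  qed
  finally show ?thesis by (simp add: L2_set_sq)
qed

text \<open>The bound 2 for e_i -> s_i with operator coefficients. For each word w the creation part
  \<open>f1\<close> is a pairing with d among the output indices and the annihilation part
  \<open>f2\<close> one with d among the input indices. Summing over w costs nothing by Parseval and
  Cauchy-Schwarz, so each part contributes c.\<close>

lemma pairing_bounded_semicircular:
  fixes a :: "(nat \<Rightarrow> nat) \<Rightarrow> 'h \<Rightarrow>\<^sub>L 'h"
  assumes D: "finite D" "d \<notin> D" "\<beta> \<subseteq> D" and c: "c \<ge> 0"
    and clin: "\<And>J. J \<in> multi_index n (insert d D) \<Longrightarrow> complex_linear_op (a J)"
    and col: "pairing_bounded n (insert d D) \<beta> a c" and row: "pairing_bounded n (insert d D) (insert d \<beta>) a c"
  shows "pairing_bounded n D \<beta> (\<lambda>J. \<Sum>i=1..n. left_semicircular i (a (J(d := i)))) (2 * c)"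
  unfolding pairing_bounded_def
proof (intro allI)
  fix x y :: "(nat \<Rightarrow> nat) \<Rightarrow> 'h"
  let ?N = "\<lambda>x B. L2_set (\<lambda>l. norm (x l)) (multi_index n B)"
  have d: "d \<notin> \<beta>" "d \<notin> D - \<beta>" using D by auto
  have diffs: "insert d D - \<beta> = insert d (D - \<beta>)" "insert d D - insert d \<beta> = D - \<beta>" using D by auto
  have fin: "finite \<beta>" "finite (D - \<beta>)" using D finite_subset by auto
  define f1 where "f1 w = (\<Sum>J\<in>multi_index n D. \<Sum>i=1..n.
      inner (a (J(d := i)) (C w (x (restrict J \<beta>)))) (C (i # w) (y (restrict J (D - \<beta>)))))" for w
  define f2 where "f2 w = (\<Sum>J\<in>multi_index n D. \<Sum>i=1..n.
      inner (a (J(d := i)) (C (i # w) (x (restrict J \<beta>)))) (C w (y (restrict J (D - \<beta>)))))" for w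
  have f1: "f1 w \<le> c * L2_set (\<lambda>l. norm (C w (x l))) (multi_index n \<beta>) *
      L2_set (\<lambda>m. norm (C (m d # w) (y (restrict m (D - \<beta>))))) (multi_index n (insert d (D - \<beta>)))" for w
    using col[unfolded pairing_bounded_def, rule_format, of "\<lambda>l. C w (x l)" "\<lambda>m. C (m d # w) (y (restrict m (D - \<beta>)))"]
    unfolding diffs f1_def sum_multi_index_insert[OF D(2)] restrict_upd_insert restrict_upd_notin[OF d(1)]
    by (simp add: restrict_upd_notin[OF d(2)])
  have f2: "f2 w \<le> c * L2_set (\<lambda>m. norm (C (m d # w) (x (restrict m \<beta>)))) (multi_index n (insert d \<beta>)) *
      L2_set (\<lambda>l. norm (C w (y l))) (multi_index n (D - \<beta>))" for w
    using row[unfolded pairing_bounded_def, rule_format, of "\<lambda>m. C (m d # w) (x (restrict m \<beta>))" "\<lambda>l. C w (y l)"]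
    unfolding diffs f2_def sum_multi_index_insert[OF D(2)] restrict_upd_insert restrict_upd_notin[OF d(2)]
    by (simp add: restrict_upd_notin[OF d(1)])
  have hs: "((\<lambda>w. f1 w + f2 w) has_sum (\<Sum>J\<in>multi_index n D.
      inner ((\<Sum>i=1..n. left_semicircular i (a (J(d := i)))) (x (restrict J \<beta>))) (y (restrict J (D - \<beta>))))) UNIV"
    unfolding f1_def f2_def sum.distrib[symmetric] blinfun.sum_left inner_sum_left
    by (intro has_sum_sum inner_left clin multi_index_upd)
  have "sum (\<lambda>w. f1 w + f2 w) F \<le> 2 * c * ?N x \<beta> * ?N y (D - \<beta>)" if F: "finite F" for F
  proof -
    have "sum f1 F \<le> c * ?N x \<beta> * ?N y (D - \<beta>)"
      by (rule sum_product_le[OF f1 sum_L2_C_le sum_L2_C_Cons_le]) (auto simp: F fin d c D(2) L2_set_nonneg finite_multi_index)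
    moreover have "sum f2 F \<le> c * ?N x \<beta> * ?N y (D - \<beta>)"
      by (rule sum_product_le[OF f2 sum_L2_C_Cons_le sum_L2_C_le]) (auto simp: F fin d c D(2) L2_set_nonneg finite_multi_index)
    ultimately show ?thesis by (simp add: sum.distrib)
  qed
  then show "(\<Sum>J\<in>multi_index n D. inner ((\<Sum>i=1..n. left_semicircular i (a (J(d := i)))) (x (restrict J \<beta>))) (y (restrict J (D - \<beta>))))
      \<le> 2 * c * ?N x \<beta> * ?N y (D - \<beta>)"
    by (rule infsum_has_sum_le[OF hs])
qed

lemma norm_sum_E:
  assumes "finite I"
  shows "(norm (\<Sum>i\<in>I. E [i] (v i)))\<^sup>2 = (\<Sum>i\<in>I. (norm (v i))\<^sup>2)"
  using assms
  by (simp add: power2_norm_eq_inner inner_sum_left inner_E blinfun.sum_right C_E sum.delta cong: sum.cong if_cong)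

lemma C_sum_E:
  assumes "finite I" "j \<in> I"
  shows "C [j] (\<Sum>i\<in>I. E [i] (v i)) = v j"
  using assms by (simp add: blinfun.sum_right C_E sum.delta' cong: if_cong)

lemma L2_sum_E:
  assumes "d \<notin> B"
  shows "L2_set (\<lambda>l. norm (\<Sum>i=1..n. E [i] (x (l(d := i))))) (multi_index n B) =
    L2_set (\<lambda>l. norm (x l)) (multi_index n (insert d B))"
  unfolding L2_set_def by (simp add: norm_sum_E sum_multi_index_insert[OF assms])

text \<open>The vectors x with index d are stored in mutually orthogonal components of a single
  vector, from which \<open>C [i]\<close> reads them back. In this way one operator encodes a
  row.\<close>

lemma pairing_bounded_row:
  assumes D: "d \<notin> D" "\<beta> \<subseteq> D"
    and *: "pairing_bounded n D \<beta> (\<lambda>J. \<Sum>i=1..n. b (J(d := i)) o\<^sub>L C [i]) c"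
  shows "pairing_bounded n (insert d D) (insert d \<beta>) b c"
  unfolding pairing_bounded_def
proof (intro allI)
  fix x y :: "(nat \<Rightarrow> nat) \<Rightarrow> 'h"
  have d: "d \<notin> \<beta>" "d \<notin> D - \<beta>" using D by auto
  have diffs: "insert d D - insert d \<beta> = D - \<beta>" using D by auto
  have eq: "(\<Sum>j=1..n. inner (b (J(d := j)) (C [j] (\<Sum>i=1..n. E [i] (v i)))) z) = (\<Sum>j=1..n. inner (b (J(d := j)) (v j)) z)"
    for J v z by (intro sum.cong refl) (simp only: C_sum_E[OF finite_atLeastAtMost])
  show "(\<Sum>J\<in>multi_index n (insert d D). inner (b J (x (restrict J (insert d \<beta>)))) (y (restrict J (insert d D - insert d \<beta>))))
    \<le> c * L2_set (\<lambda>l. norm (x l)) (multi_index n (insert d \<beta>)) * L2_set (\<lambda>m. norm (y m)) (multi_index n (insert d D - insert d \<beta>))"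
    using *[unfolded pairing_bounded_def, rule_format, of "\<lambda>l. \<Sum>i=1..n. E [i] (x (l(d := i)))" y]
    unfolding diffs sum_multi_index_insert[OF D(1)] restrict_upd_insert restrict_upd_notin[OF d(2)] L2_sum_E[OF d(1)]
    unfolding blinfun.sum_left inner_sum_left blinfun_apply_blinfun_compose eq .
qed

text \<open>Dually, the isometries \<open>E [i]\<close> store the index d in the range, so that it
  becomes an output index.\<close>

lemma pairing_bounded_col:
  assumes D: "d \<notin> D" "\<beta> \<subseteq> D"
    and *: "pairing_bounded n D \<beta> (\<lambda>J. \<Sum>i=1..n. E [i] o\<^sub>L b (J(d := i))) c"
  shows "pairing_bounded n (insert d D) \<beta> b c"
  unfolding pairing_bounded_def
proof (intro allI)
  fix x y :: "(nat \<Rightarrow> nat) \<Rightarrow> 'h"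
  have d: "d \<notin> \<beta>" "d \<notin> D - \<beta>" using D by auto
  have diffs: "insert d D - \<beta> = insert d (D - \<beta>)" using D by auto
  have eq: "(\<Sum>j=1..n. inner (b (J(d := j)) z) (C [j] (\<Sum>i=1..n. E [i] (v i)))) = (\<Sum>j=1..n. inner (b (J(d := j)) z) (v j))"
    for J v z by (intro sum.cong refl) (simp only: C_sum_E[OF finite_atLeastAtMost])
  show "(\<Sum>J\<in>multi_index n (insert d D). inner (b J (x (restrict J \<beta>))) (y (restrict J (insert d D - \<beta>))))
    \<le> c * L2_set (\<lambda>l. norm (x l)) (multi_index n \<beta>) * L2_set (\<lambda>m. norm (y m)) (multi_index n (insert d D - \<beta>))"
    using *[unfolded pairing_bounded_def, rule_format, of x "\<lambda>l. \<Sum>i=1..n. E [i] (y (l(d := i)))"]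
    unfolding diffs sum_multi_index_insert[OF D(1)] restrict_upd_insert restrict_upd_notin[OF d(1)] L2_sum_E[OF d(2)]
    unfolding blinfun.sum_left inner_sum_left blinfun_apply_blinfun_compose inner_E eq .
qed

end

section \<open>The induction on the number of indices\<close>

context block_system
begin

lemma entry_sum: "entry (\<Sum>i\<in>I. X i) v w = (\<Sum>i\<in>I. entry (X i) v w)"
proof (induction I rule: infinite_finite_induct)
  case empty
  show ?case by (rule blinfun_eqI) (simp add: entry_def)
next
  case (infinite I)
  then show ?case by (simp, intro blinfun_eqI) (simp add: entry_def)
qed (simp add: entry_add)

text \<open>Since s_i sends the vacuum to the letter i, the vacuum column returns the
  coefficients.\<close>

lemma entry_semicircular_sum:
  assumes "\<And>i. i \<in> I \<Longrightarrow> complex_linear_op (b i)" "finite I" "j \<in> I"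
  shows "entry (\<Sum>i\<in>I. left_semicircular i (b i)) [j] [] = b j"
proof -
  have "entry (\<Sum>i\<in>I. left_semicircular i (b i)) [j] [] = (\<Sum>i\<in>I. if i = j then b j else 0)"
    unfolding entry_sum using assms(1)
    by (intro sum.cong refl blinfun_eqI) (auto simp: entry_def C_left_Cons C_E)
  then show ?thesis using assms by simp
qed

end

text \<open>This is u tensored with the projection of F onto E: u acts on the vacuum coefficients,
  and the results are stacked in a column. The result is again an operator-valued map on a
  *-algebra, so the induction hypothesis applies to it; sqrt 2 is the root of the 2 in the bound for
  the square sum.\<close>

lemma bounded_map_on_col:
  fixes C :: "nat list \<Rightarrow> 'h :: complex_hilbert \<Rightarrow>\<^sub>L 'h" and C' :: "nat list \<Rightarrow> 'g :: complex_hilbert \<Rightarrow>\<^sub>L 'g"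
  assumes "block_system C" "block_system C'" and A: "star_algebra A" and u: "bounded_map_on A u M"
  shows "bounded_map_on (block_system.fock_algebra C A)
    (\<lambda>X. \<Sum>i=1..n. block_system.E C' [i] o\<^sub>L u (block_system.entry C X [i] [])) (sqrt 2 * M)"
proof -
  interpret S: block_system C by fact
  interpret T: block_system C' by fact
  note U = bounded_map_onD[OF u]
  have ent: "S.entry X v w \<in> A" if "X \<in> S.fock_algebra A" for X v w
    using that by (simp add: S.fock_algebra_def)
  show ?thesis unfolding bounded_map_on_def
  proof (intro conjI ballI allI)
    show "0 \<le> sqrt 2 * M" using U by simp
    fix X assume X: "X \<in> S.fock_algebra A"
    show "complex_linear_op (\<Sum>i=1..n. T.E [i] o\<^sub>L u (S.entry X [i] []))"
      by (intro clin_sum clin_comp T.clin_E U ent X)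
    show "(\<Sum>i=1..n. T.E [i] o\<^sub>L u (S.entry (c *\<^sub>C X) [i] [])) = c *\<^sub>C (\<Sum>i=1..n. T.E [i] o\<^sub>L u (S.entry X [i] []))" for c
      by (rule blinfun_eqI)
        (simp add: S.entry_scaleC U ent[OF X] blinfun.sum_left scaleC_blinfun_apply scaleC_sum_right clinD[OF T.clin_E])
    show "norm (\<Sum>i=1..n. T.E [i] o\<^sub>L u (S.entry X [i] [])) \<le> sqrt 2 * M * norm X"
    proof (rule norm_blinfun_bound)
      fix h
      have "(norm ((\<Sum>i=1..n. T.E [i] o\<^sub>L u (S.entry X [i] [])) h))\<^sup>2 = (\<Sum>i=1..n. (norm (u (S.entry X [i] []) h))\<^sup>2)"
        using T.norm_sum_E[of "{1..n}" "\<lambda>i. u (S.entry X [i] []) h"] by (simp add: blinfun.sum_left)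
      also have "\<dots> \<le> 2 * (M * norm X)\<^sup>2 * (norm h)\<^sup>2" by (rule S.fock_entries_bound[OF A u X]) simp
      also have "\<dots> = (sqrt 2 * M * norm X * norm h)\<^sup>2" by (simp add: power_mult_distrib)
      finally show "norm ((\<Sum>i=1..n. T.E [i] o\<^sub>L u (S.entry X [i] [])) h) \<le> sqrt 2 * M * norm X * norm h"
        by (rule power2_le_imp_le) (use U in simp)
    qed (use U in simp)
    fix Y assume Y: "Y \<in> S.fock_algebra A"
    show "(\<Sum>i=1..n. T.E [i] o\<^sub>L u (S.entry (X + Y) [i] [])) =
        (\<Sum>i=1..n. T.E [i] o\<^sub>L u (S.entry X [i] [])) + (\<Sum>i=1..n. T.E [i] o\<^sub>L u (S.entry Y [i] []))"
      by (simp add: S.entry_add U ent[OF X] ent[OF Y] comp_add_right sum.distrib)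
  qed
qed

text \<open>For a row the norm is computed against a second vector, which brings in the adjoints of
  the entries and hence the second half of the entry bound.\<close>

lemma bounded_map_on_row:
  fixes C :: "nat list \<Rightarrow> 'h :: complex_hilbert \<Rightarrow>\<^sub>L 'h" and C' :: "nat list \<Rightarrow> 'g :: complex_hilbert \<Rightarrow>\<^sub>L 'g"
  assumes "block_system C" "block_system C'" and A: "star_algebra A" and u: "bounded_map_on A u M"
  shows "bounded_map_on (block_system.fock_algebra C A)
    (\<lambda>X. \<Sum>i=1..n. u (block_system.entry C X [i] []) o\<^sub>L C' [i]) (sqrt 2 * M)"
proof -
  interpret S: block_system C by fact
  interpret T: block_system C' by fact
  note U = bounded_map_onD[OF u]
  have ent: "S.entry X v w \<in> A" if "X \<in> S.fock_algebra A" for X v w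
    using that by (simp add: S.fock_algebra_def)
  show ?thesis unfolding bounded_map_on_def
  proof (intro conjI ballI allI)
    show "0 \<le> sqrt 2 * M" using U by simp
    fix X assume X: "X \<in> S.fock_algebra A"
    show "complex_linear_op (\<Sum>i=1..n. u (S.entry X [i] []) o\<^sub>L C' [i])"
      by (intro clin_sum clin_comp T.clin_C U ent X)
    show "(\<Sum>i=1..n. u (S.entry (c *\<^sub>C X) [i] []) o\<^sub>L C' [i]) = c *\<^sub>C (\<Sum>i=1..n. u (S.entry X [i] []) o\<^sub>L C' [i])" for c
      by (rule blinfun_eqI)
        (simp add: S.entry_scaleC U ent[OF X] blinfun.sum_left scaleC_blinfun_apply scaleC_sum_right)
    show "norm (\<Sum>i=1..n. u (S.entry X [i] []) o\<^sub>L C' [i]) \<le> sqrt 2 * M * norm X"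
    proof (rule norm_blinfun_bound)
      fix h
      show "norm ((\<Sum>i=1..n. u (S.entry X [i] []) o\<^sub>L C' [i]) h) \<le> sqrt 2 * M * norm X * norm h"
      proof (rule norm_ge_inner_imp)
        fix y
        have "inner ((\<Sum>i=1..n. u (S.entry X [i] []) o\<^sub>L C' [i]) h) y =
            (\<Sum>i=1..n. inner (C' [i] h) (op_adjoint (u (S.entry X [i] [])) y))"
          by (simp add: blinfun.sum_left inner_sum_left inner_adjoint[OF U(2)[OF ent[OF X]]])
        also have "\<dots> \<le> norm h * (sqrt 2 * M * norm X * norm y)"
        proof (rule inner_sum_le)
          show "(\<Sum>i=1..n. (norm (C' [i] h))\<^sup>2) \<le> (norm h)\<^sup>2"
            by (rule T.finite_parseval_reindex_le) (auto simp: inj_on_def)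
          show "(\<Sum>i=1..n. (norm (op_adjoint (u (S.entry X [i] [])) y))\<^sup>2) \<le> (sqrt 2 * M * norm X * norm y)\<^sup>2"
            using S.fock_entries_bound(2)[OF A u X, of "{1..n}" y] by (simp add: power_mult_distrib)
        qed (use U in simp_all)
        finally show "inner ((\<Sum>i=1..n. u (S.entry X [i] []) o\<^sub>L C' [i]) h) y \<le> sqrt 2 * M * norm X * norm h * norm y"
          by (simp add: mult_ac)
      qed (use U in simp)
    qed (use U in simp)
    fix Y assume Y: "Y \<in> S.fock_algebra A"
    show "(\<Sum>i=1..n. u (S.entry (X + Y) [i] []) o\<^sub>L C' [i]) =
        (\<Sum>i=1..n. u (S.entry X [i] []) o\<^sub>L C' [i]) + (\<Sum>i=1..n. u (S.entry Y [i] []) o\<^sub>L C' [i])"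
      by (simp add: S.entry_add U ent[OF X] ent[OF Y] comp_add_left sum.distrib)
  qed
qed

lemma pairing_bounded_single:
  assumes A: "star_algebra A" and u: "bounded_map_on A u M" and a: "\<And>J. J \<in> multi_index n {d} \<Longrightarrow> a J \<in> A"
    and c: "c \<ge> 0" and pb: "\<And>\<beta>. \<beta> \<subseteq> {d} \<Longrightarrow> pairing_bounded n {d} \<beta> a c" and \<alpha>: "\<alpha> \<subseteq> {d}"
  shows "pairing_bounded n {d} \<alpha> (\<lambda>J. u (a J)) (sqrt 2 * M * c)"
proof -
  note U = bounded_map_onD[OF u]
  have clin: "complex_linear_op (a J)" if "J \<in> multi_index n {d}" for J using a[OF that] star_algebraD[OF A] by blast
  have P: "(\<Sum>J\<in>multi_index n {d}. (norm (a J h))\<^sup>2) \<le> c\<^sup>2 * (norm h)\<^sup>2" for h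
    using pb[of "{}"] pairing_bounded_empty_iff[OF c, of n "{d}" a] by blast
  have Q: "(\<Sum>J\<in>multi_index n {d}. (norm (op_adjoint (a J) h))\<^sup>2) \<le> c\<^sup>2 * (norm h)\<^sup>2" for h
    using pb[of "{d}"] pairing_bounded_full_iff[where a = a and D = "{d}", OF c clin] by blast
  have Mc: "sqrt 2 * M * c \<ge> 0" "M\<^sup>2 * (c\<^sup>2 + c\<^sup>2) = (sqrt 2 * M * c)\<^sup>2"
    using U(1) c by (auto simp: power_mult_distrib)
  have fin: "finite (multi_index n {d})" by (simp add: finite_multi_index)
  note G = little_grothendieck_op[OF A u fin a P _ Q]
  have cu: "complex_linear_op (u (a J))" if "J \<in> multi_index n {d}" for J using U a[OF that] by blast
  consider "\<alpha> = {}" | "\<alpha> = {d}" using \<alpha> by auto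
  then show ?thesis
  proof cases
    case 1
    then show ?thesis using G(1) by (simp add: pairing_bounded_empty_iff[OF Mc(1)] flip: Mc(2))
  next
    case 2
    then show ?thesis using G(2) by (simp add: pairing_bounded_full_iff[OF Mc(1) cu] flip: Mc(2))
  qed
qed

text \<open>The index d is hidden in the algebra: for each J the operators
  \<open>a (J(d := i))\<close> are merged into one operator \<open>X J\<close>, which doubles c, and
  u is replaced by a map that reads d off again, which costs sqrt 2. A, u, M, a and c change at
  every step, while the two Hilbert spaces, hence the types, stay fixed.\<close>

lemma pairing_bounded_map:
  fixes C :: "nat list \<Rightarrow> 'h :: complex_hilbert \<Rightarrow>\<^sub>L 'h" and C' :: "nat list \<Rightarrow> 'g :: complex_hilbert \<Rightarrow>\<^sub>L 'g"
    and u :: "('h \<Rightarrow>\<^sub>L 'h) \<Rightarrow> 'g \<Rightarrow>\<^sub>L 'g"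
  assumes C: "block_system C" "block_system C'" and D: "finite D" "D \<noteq> {}"
    and "star_algebra A" "bounded_map_on A u M" "\<And>J. J \<in> multi_index n D \<Longrightarrow> a J \<in> A"
    and "c \<ge> 0" "\<And>\<beta>. \<beta> \<subseteq> D \<Longrightarrow> pairing_bounded n D \<beta> a c" "\<alpha> \<subseteq> D"
  shows "pairing_bounded n D \<alpha> (\<lambda>J. u (a J)) (sqrt 2 * (2 * sqrt 2) ^ (card D - 1) * M * c)"
  using D assms(5-)
proof (induction D arbitrary: A u M a c \<alpha> rule: finite_ne_induct)
  case (singleton d)
  then show ?case using pairing_bounded_single[of A u M n d a c \<alpha>] by simp
next
  case (insert d D)
  interpret S: block_system C by fact
  interpret T: block_system C' by fact
  note A = insert.prems(1) and u = insert.prems(2) and a = insert.prems(3) and c = insert.prems(4) and pb = insert.prems(5)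
  note U = bounded_map_onD[OF u]
  define X where "X J = (\<Sum>i=1..n. S.left_semicircular i (a (J(d := i))))" for J
  have clin: "complex_linear_op (a J)" if "J \<in> multi_index n (insert d D)" for J
    using a[OF that] star_algebraD[OF A] by blast
  have fock: "star_algebra (S.fock_algebra A)" by (rule S.star_algebra_fock[OF A])
  have X_in: "X J \<in> S.fock_algebra A" if "J \<in> multi_index n D" for J
    unfolding X_def by (intro star_algebra_sum[OF fock] S.left_in_fock[OF A] a multi_index_upd that)
  have X_bound: "pairing_bounded n D \<beta> X (2 * c)" if "\<beta> \<subseteq> D" for \<beta>
    unfolding X_def using insert.hyps that by (intro S.pairing_bounded_semicircular clin c pb) auto
  have X_entry: "S.entry (X J) [i] [] = a (J(d := i))" if "J \<in> multi_index n D" "i \<in> {1..n}" for J i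
    unfolding X_def using that by (intro S.entry_semicircular_sum clin multi_index_upd) auto
  have card: "card D = Suc (card D - 1)" using insert.hyps by (simp add: card_gt_0_iff)
  have "sqrt 2 * (2 * sqrt 2) ^ (card D - 1) * (sqrt 2 * M) * (2 * c) = sqrt 2 * (2 * sqrt 2) ^ Suc (card D - 1) * M * c"
    by simp
  then have const: "sqrt 2 * (2 * sqrt 2) ^ (card D - 1) * (sqrt 2 * M) * (2 * c) = sqrt 2 * (2 * sqrt 2) ^ (card (insert d D) - 1) * M * c"
    using insert.hyps card by simp
  have c2: "0 \<le> 2 * c" using c by simp
  show ?case
  \<comment> \<open>Whether d is an input or an output index in \<alpha> decides between the row and
    the column version of the new map.\<close>
  proof (cases "d \<in> \<alpha>")
    case True
    define \<beta> where "\<beta> = \<alpha> - {d}"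
    have \<beta>: "\<alpha> = insert d \<beta>" "\<beta> \<subseteq> D" using True insert.prems(6) by (auto simp: \<beta>_def)
    have "pairing_bounded n D \<beta> (\<lambda>J. \<Sum>i=1..n. u (S.entry (X J) [i] []) o\<^sub>L C' [i])
       (sqrt 2 * (2 * sqrt 2) ^ (card D - 1) * (sqrt 2 * M) * (2 * c))"
      by (rule insert.IH[OF fock bounded_map_on_row[OF C A u] X_in c2 X_bound \<beta>(2)])
    then have "pairing_bounded n D \<beta> (\<lambda>J. \<Sum>i=1..n. u (a (J(d := i))) o\<^sub>L C' [i])
       (sqrt 2 * (2 * sqrt 2) ^ (card (insert d D) - 1) * M * c)"
      unfolding const by (subst (asm) pairing_bounded_cong) (auto intro!: sum.cong simp: X_entry)
    then show ?thesis unfolding \<beta>(1) by (rule T.pairing_bounded_row[OF insert.hyps(3) \<beta>(2)])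
  next
    case False
    then have \<alpha>: "\<alpha> \<subseteq> D" using insert.prems(6) by auto
    have "pairing_bounded n D \<alpha> (\<lambda>J. \<Sum>i=1..n. T.E [i] o\<^sub>L u (S.entry (X J) [i] []))
       (sqrt 2 * (2 * sqrt 2) ^ (card D - 1) * (sqrt 2 * M) * (2 * c))"
      by (rule insert.IH[OF fock bounded_map_on_col[OF C A u] X_in c2 X_bound \<alpha>])
    then have "pairing_bounded n D \<alpha> (\<lambda>J. \<Sum>i=1..n. T.E [i] o\<^sub>L u (a (J(d := i))))
       (sqrt 2 * (2 * sqrt 2) ^ (card (insert d D) - 1) * M * c)"
      unfolding const by (subst (asm) pairing_bounded_cong) (auto intro!: sum.cong simp: X_entry)
    then show ?thesis by (rule T.pairing_bounded_col[OF insert.hyps(3) \<alpha>])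
  qed
qed

section \<open>Square-summable sequences\<close>

text \<open>An infinite index set, whatever H is, lets the space split into copies of itself indexed
  by words even if H is finite-dimensional.\<close>

typedef (overloaded) 'a ell2 = "{f :: nat \<Rightarrow> 'a :: complex_hilbert. (\<lambda>n. (norm (f n))\<^sup>2) summable_on UNIV}"
  by (rule exI[of _ "\<lambda>_. 0"]) simp

setup_lifting type_definition_ell2

lemma sq_summable_add:
  fixes f g :: "'i \<Rightarrow> 'a :: real_inner"
  assumes "(\<lambda>n. (norm (f n))\<^sup>2) summable_on S" "(\<lambda>n. (norm (g n))\<^sup>2) summable_on S"
  shows "(\<lambda>n. (norm (f n + g n))\<^sup>2) summable_on S"
proof (rule summable_on_comparison_test)
  show "(\<lambda>n. 2 * (norm (f n))\<^sup>2 + 2 * (norm (g n))\<^sup>2) summable_on S"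
    by (intro summable_on_add summable_on_cmult_right assms)
  fix n
  have "0 \<le> (norm (f n - g n))\<^sup>2" by simp
  then show "(norm (f n + g n))\<^sup>2 \<le> 2 * (norm (f n))\<^sup>2 + 2 * (norm (g n))\<^sup>2"
    by (simp add: power2_norm_eq_inner inner_add_left inner_add_right inner_diff_left inner_diff_right inner_commute[of "g n" "f n"])
qed simp

lemma sq_summable_scaleC:
  fixes f :: "'i \<Rightarrow> 'a :: complex_hilbert"
  assumes "(\<lambda>n. (norm (f n))\<^sup>2) summable_on S"
  shows "(\<lambda>n. (norm (c *\<^sub>C f n))\<^sup>2) summable_on S"
  using summable_on_cmult_right[OF assms, of "(cmod c)\<^sup>2"] by (simp add: norm_scaleC power_mult_distrib)

lemma inner_summable:
  fixes f g :: "'i \<Rightarrow> 'a :: real_inner"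
  assumes "(\<lambda>n. (norm (f n))\<^sup>2) summable_on S" "(\<lambda>n. (norm (g n))\<^sup>2) summable_on S"
  shows "(\<lambda>n. inner (f n) (g n)) summable_on S"
proof -
  have pol: "inner x y = (1/2) * ((norm (x + y))\<^sup>2 + ((-1) * (norm x)\<^sup>2 + (-1) * (norm y)\<^sup>2))" for x y :: 'a
    by (simp add: power2_norm_eq_inner inner_add_left inner_add_right inner_commute[of y x])
  show ?thesis
    unfolding pol by (intro summable_on_cmult_right summable_on_add sq_summable_add assms)
qed

instantiation ell2 :: (complex_hilbert) complex_vector
begin

lift_definition zero_ell2 :: "'a ell2" is "\<lambda>_. 0" by simp
lift_definition plus_ell2 :: "'a ell2 \<Rightarrow> 'a ell2 \<Rightarrow> 'a ell2" is "\<lambda>f g n. f n + g n"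
  by (rule sq_summable_add)
lift_definition uminus_ell2 :: "'a ell2 \<Rightarrow> 'a ell2" is "\<lambda>f n. - f n" by simp
lift_definition scaleC_ell2 :: "complex \<Rightarrow> 'a ell2 \<Rightarrow> 'a ell2" is "\<lambda>c f n. c *\<^sub>C f n"
  by (rule sq_summable_scaleC)
lift_definition scaleR_ell2 :: "real \<Rightarrow> 'a ell2 \<Rightarrow> 'a ell2" is "\<lambda>r f n. r *\<^sub>R f n"
  using sq_summable_scaleC[of _ UNIV "complex_of_real _"] by (simp add: scaleC_of_real)
definition minus_ell2 :: "'a ell2 \<Rightarrow> 'a ell2 \<Rightarrow> 'a ell2" where "minus_ell2 f g = f + (- g)"

instance
  by (standard; (rule minus_ell2_def |
    (transfer, simp add: fun_eq_iff algebra_simps scaleC_add_right scaleC_add_left scaleC_scaleC scaleC_of_real)))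

end

instantiation ell2 :: (complex_hilbert) real_inner
begin

lift_definition inner_ell2 :: "'a ell2 \<Rightarrow> 'a ell2 \<Rightarrow> real" is "\<lambda>f g. \<Sum>\<^sub>\<infinity>n. inner (f n) (g n)" .
definition norm_ell2 :: "'a ell2 \<Rightarrow> real" where "norm_ell2 f = sqrt (inner f f)"
definition dist_ell2 :: "'a ell2 \<Rightarrow> 'a ell2 \<Rightarrow> real" where "dist_ell2 f g = norm (f - g)"
definition sgn_ell2 :: "'a ell2 \<Rightarrow> 'a ell2" where "sgn_ell2 f = inverse (norm f) *\<^sub>R f"
definition uniformity_ell2 :: "('a ell2 \<times> 'a ell2) filter"
  where "uniformity_ell2 = (INF e\<in>{0 <..}. principal {(x, y). dist x y < e})"
definition open_ell2 :: "'a ell2 set \<Rightarrow> bool"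
  where "open_ell2 U \<longleftrightarrow> (\<forall>x\<in>U. \<forall>\<^sub>F (x', y) in uniformity. x' = x \<longrightarrow> y \<in> U)"

instance
proof
  fix x y z :: "'a ell2" and r :: real
  show "inner x y = inner y x" by transfer (simp add: inner_commute)
  show "inner (x + y) z = inner x z + inner y z"
    by transfer (simp add: inner_add_left infsum_add inner_summable)
  show "inner (r *\<^sub>R x) y = r * inner x y"
    by transfer (simp add: infsum_cmult_right inner_summable)
  show "0 \<le> inner x x" by transfer (simp add: infsum_nonneg)
  show "inner x x = 0 \<longleftrightarrow> x = 0"
  proof
    assume "inner x x = 0"
    then show "x = 0"
    proof transfer
      fix f :: "nat \<Rightarrow> 'a"
      assume f: "(\<lambda>n. (norm (f n))\<^sup>2) summable_on UNIV" "(\<Sum>\<^sub>\<infinity>n. inner (f n) (f n)) = 0"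
      have "inner (f n) (f n) = 0" for n
        by (rule nonneg_infsum_le_0D[of "\<lambda>n. inner (f n) (f n)" UNIV]) (use f inner_summable[OF f(1) f(1)] in auto)
      then show "f = (\<lambda>_. 0)" by auto
    qed
  qed (transfer, simp)
qed (rule dist_ell2_def sgn_ell2_def uniformity_ell2_def open_ell2_def norm_ell2_def)+

end

lemma ell2_norm_has_sum: "((\<lambda>n. (norm (Rep_ell2 f n))\<^sup>2) has_sum (norm f)\<^sup>2) UNIV"
proof -
  have "(\<lambda>n. (norm (Rep_ell2 f n))\<^sup>2) summable_on UNIV" using Rep_ell2[of f] by simp
  moreover have "(norm f)\<^sup>2 = (\<Sum>\<^sub>\<infinity>n. (norm (Rep_ell2 f n))\<^sup>2)"
    unfolding power2_norm_eq_inner by (simp add: inner_ell2.rep_eq)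
  ultimately show ?thesis by (simp add: has_sum_infsum)
qed

lemma ell2_finite_sum_le: "finite F \<Longrightarrow> (\<Sum>n\<in>F. (norm (Rep_ell2 f n))\<^sup>2) \<le> (norm f)\<^sup>2"
  by (rule has_sum_mono2[OF has_sum_finite ell2_norm_has_sum]) auto

lemma norm_Rep_ell2_le: "norm (Rep_ell2 f n) \<le> norm f"
  by (rule power2_le_imp_le) (use ell2_finite_sum_le[of "{n}" f] in auto)

lemma Rep_ell2_diff: "Rep_ell2 (f - g) n = Rep_ell2 f n - Rep_ell2 g n"
  unfolding minus_ell2_def plus_ell2.rep_eq uminus_ell2.rep_eq by simp

lemma ell2_norm_leI:
  assumes "\<And>F. finite F \<Longrightarrow> (\<Sum>n\<in>F. (norm (Rep_ell2 f n))\<^sup>2) \<le> c\<^sup>2" "c \<ge> 0"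
  shows "norm f \<le> c"
  using infsum_has_sum_le[OF ell2_norm_has_sum assms(1)] assms(2) by (rule power2_le_imp_le)

instance ell2 :: (complex_hilbert) complete_space
proof
  fix X :: "nat \<Rightarrow> 'a ell2"
  assume X: "Cauchy X"
  have "Cauchy (\<lambda>k. Rep_ell2 (X k) n)" for n
  proof (rule metric_CauchyI)
    fix e :: real assume "e > 0"
    then obtain N where N: "\<forall>k\<ge>N. \<forall>l\<ge>N. dist (X k) (X l) < e" using metric_CauchyD[OF X] by blast
    have "dist (Rep_ell2 (X k) n) (Rep_ell2 (X l) n) \<le> dist (X k) (X l)" for k l
      using norm_Rep_ell2_le[of "X k - X l" n] by (simp add: dist_norm Rep_ell2_diff)
    then show "\<exists>N. \<forall>k\<ge>N. \<forall>l\<ge>N. dist (Rep_ell2 (X k) n) (Rep_ell2 (X l) n) < e"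
      using N by (meson le_less_trans)
  qed
  then have "\<exists>L. (\<lambda>k. Rep_ell2 (X k) n) \<longlonglongrightarrow> L" for n
    by (simp add: Cauchy_convergent_iff convergent_def)
  then obtain g where g: "\<And>n. (\<lambda>k. Rep_ell2 (X k) n) \<longlonglongrightarrow> g n" by metis
  \<comment> \<open>The Cauchy estimate survives the coordinatewise limit on finite sets of
    coordinates. This gives both square summability of g and convergence in norm.\<close>
  have fin: "\<exists>N. \<forall>k\<ge>N. \<forall>F. finite F \<longrightarrow> (\<Sum>n\<in>F. (norm (Rep_ell2 (X k) n - g n))\<^sup>2) \<le> e\<^sup>2" if e: "e > 0" for e :: real
  proof -
    obtain N where N: "\<And>k l. k \<ge> N \<Longrightarrow> l \<ge> N \<Longrightarrow> dist (X k) (X l) < e" using metric_CauchyD[OF X e] by blast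
    have "(\<Sum>n\<in>F. (norm (Rep_ell2 (X k) n - g n))\<^sup>2) \<le> e\<^sup>2" if k: "k \<ge> N" and F: "finite F" for k F
    proof (rule LIMSEQ_le_const2)
      show "(\<lambda>l. \<Sum>n\<in>F. (norm (Rep_ell2 (X k) n - Rep_ell2 (X l) n))\<^sup>2) \<longlonglongrightarrow> (\<Sum>n\<in>F. (norm (Rep_ell2 (X k) n - g n))\<^sup>2)"
        by (intro tendsto_intros g)
      have "(\<Sum>n\<in>F. (norm (Rep_ell2 (X k) n - Rep_ell2 (X l) n))\<^sup>2) \<le> e\<^sup>2" if l: "l \<ge> N" for l
      proof -
        have "(\<Sum>n\<in>F. (norm (Rep_ell2 (X k) n - Rep_ell2 (X l) n))\<^sup>2) \<le> (norm (X k - X l))\<^sup>2"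
          using ell2_finite_sum_le[OF F, of "X k - X l"] by (simp add: Rep_ell2_diff)
        also have "\<dots> \<le> e\<^sup>2" using N[OF k l] by (intro power_mono) (auto simp: dist_norm)
        finally show ?thesis .
      qed
      then show "\<exists>N. \<forall>l\<ge>N. (\<Sum>n\<in>F. (norm (Rep_ell2 (X k) n - Rep_ell2 (X l) n))\<^sup>2) \<le> e\<^sup>2" by blast
    qed
    then show ?thesis by blast
  qed
  have "(\<lambda>n. (norm (g n))\<^sup>2) summable_on UNIV"
  proof -
    obtain k where k: "\<And>F. finite F \<Longrightarrow> (\<Sum>n\<in>F. (norm (Rep_ell2 (X k) n - g n))\<^sup>2) \<le> 1\<^sup>2"
      using fin[of 1] by auto
    have "(\<lambda>n. (norm (Rep_ell2 (X k) n - g n))\<^sup>2) summable_on UNIV"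
      by (rule nonneg_bdd_above_summable_on) (use k in \<open>auto intro!: bdd_aboveI2\<close>)
    then have "(\<lambda>n. (norm (- (Rep_ell2 (X k) n - g n)))\<^sup>2) summable_on UNIV" by (simp only: norm_minus_cancel)
    from sq_summable_add[OF _ this, of "Rep_ell2 (X k)"] show ?thesis using Rep_ell2[of "X k"] by simp
  qed
  then have g_rep: "Rep_ell2 (Abs_ell2 g) = g" by (simp add: Abs_ell2_inverse)
  have "X \<longlonglongrightarrow> Abs_ell2 g"
  proof (rule metric_LIMSEQ_I)
    fix e :: real assume e: "e > 0"
    obtain N where N: "\<And>k F. k \<ge> N \<Longrightarrow> finite F \<Longrightarrow> (\<Sum>n\<in>F. (norm (Rep_ell2 (X k) n - g n))\<^sup>2) \<le> (e/2)\<^sup>2"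
      using fin[of "e/2"] e by auto
    have "norm (X k - Abs_ell2 g) \<le> e/2" if "k \<ge> N" for k
      by (rule ell2_norm_leI) (use N[OF that] e in \<open>auto simp: Rep_ell2_diff g_rep\<close>)
    then have "dist (X k) (Abs_ell2 g) < e" if "k \<ge> N" for k using that e by (fastforce simp: dist_norm)
    then show "\<exists>N. \<forall>k\<ge>N. dist (X k) (Abs_ell2 g) < e" by blast
  qed
  then show "convergent X" by (auto simp: convergent_def)
qed

instantiation ell2 :: (complex_hilbert) complex_hilbert
begin

definition cinner_ell2 :: "'a ell2 \<Rightarrow> 'a ell2 \<Rightarrow> complex"
  where "cinner_ell2 f g = Complex (inner f g) (inner f (\<i> *\<^sub>C g))"

instance
proof
  fix x y z :: "'a ell2" and c :: complex
  have ii: "inner x (\<i> *\<^sub>C y) = - inner (\<i> *\<^sub>C x) y" for x y :: "'a ell2"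
    by transfer (simp add: inner_ii_left infsum_uminus)
  have c: "c *\<^sub>C x = Re c *\<^sub>R x + Im c *\<^sub>R (\<i> *\<^sub>C x)"
  proof -
    have "c = complex_of_real (Re c) + complex_of_real (Im c) * \<i>" by (simp add: complex_eq_iff)
    then have "c *\<^sub>C x = complex_of_real (Re c) *\<^sub>C x + complex_of_real (Im c) *\<^sub>C \<i> *\<^sub>C x"
      by (metis scaleC_add_left scaleC_scaleC)
    then show ?thesis by (simp add: scaleC_of_real)
  qed
  have neg: "inner (\<i> *\<^sub>C x) (\<i> *\<^sub>C y) = inner x y"
    using ii[of x "\<i> *\<^sub>C y"] by (simp add: scaleC_ii_ii)
  show "cinner x y = cnj (cinner y x)"
    using ii[of x y] by (simp add: cinner_ell2_def complex_eq_iff inner_commute)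
  show "cinner (x + y) z = cinner x z + cinner y z"
    by (simp add: cinner_ell2_def complex_eq_iff inner_add_left)
  show "cinner (c *\<^sub>C x) y = c * cinner x y"
    using ii[of x y] neg by (simp add: cinner_ell2_def complex_eq_iff c inner_add_left)
  show "Re (cinner x y) = inner x y" by (simp add: cinner_ell2_def)
qed

end

section \<open>Decomposition of l_2(H) into copies of itself indexed by words\<close>

definition word_code :: "nat list \<Rightarrow> nat \<Rightarrow> nat" where
  "word_code w m = prod_encode (list_encode w, m)"

lemma bij_word_code: "bij_betw (\<lambda>(w, m). word_code w m) (UNIV \<times> UNIV) UNIV"
  by (rule bij_betw_byWitness[where f' = "\<lambda>p. (list_decode (fst (prod_decode p)), snd (prod_decode p))"])
    (auto simp: word_code_def)

lemma inj_word_code: "inj (word_code w)"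
  by (simp add: inj_def word_code_def)

lift_definition ell2_slice :: "nat list \<Rightarrow> 'a :: complex_hilbert ell2 \<Rightarrow> 'a ell2" is "\<lambda>w f m. f (word_code w m)"
proof -
  fix w and f :: "nat \<Rightarrow> 'a"
  assume "(\<lambda>n. (norm (f n))\<^sup>2) summable_on UNIV"
  then have "(\<lambda>n. (norm (f n))\<^sup>2) summable_on range (word_code w)" by (rule summable_on_subset) simp
  then show "(\<lambda>m. (norm (f (word_code w m)))\<^sup>2) summable_on UNIV"
    by (simp add: summable_on_reindex[OF inj_word_code] o_def)
qed

lemma norm_ell2_slice_le: "norm (ell2_slice w f) \<le> norm f"
proof (rule ell2_norm_leI)
  fix F :: "nat set" assume F: "finite F"
  have "(\<Sum>m\<in>F. (norm (Rep_ell2 (ell2_slice w f) m))\<^sup>2) = (\<Sum>n\<in>word_code w ` F. (norm (Rep_ell2 f n))\<^sup>2)"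
    by (subst sum.reindex) (auto simp: ell2_slice.rep_eq intro: inj_on_subset[OF inj_word_code])
  also have "\<dots> \<le> (norm f)\<^sup>2" using F by (intro ell2_finite_sum_le) auto
  finally show "(\<Sum>m\<in>F. (norm (Rep_ell2 (ell2_slice w f) m))\<^sup>2) \<le> (norm f)\<^sup>2" .
qed simp

lift_definition ell2_block :: "nat list \<Rightarrow> 'a :: complex_hilbert ell2 \<Rightarrow>\<^sub>L 'a ell2" is ell2_slice
proof (rule bounded_linear_intro)
  fix w and f g :: "'a ell2" and r :: real
  show "ell2_slice w (f + g) = ell2_slice w f + ell2_slice w g" by transfer simp
  show "ell2_slice w (r *\<^sub>R f) = r *\<^sub>R ell2_slice w f" by transfer simp
  show "norm (ell2_slice w f) \<le> norm f * 1" using norm_ell2_slice_le by simp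
qed

lemma block_system_ell2: "block_system (ell2_block :: nat list \<Rightarrow> 'a :: complex_hilbert ell2 \<Rightarrow>\<^sub>L 'a ell2)"
proof
  fix w and f :: "'a ell2"
  have "ell2_slice w (c *\<^sub>C f) = c *\<^sub>C ell2_slice w f" for c w and f :: "'a ell2" by transfer simp
  then show "complex_linear_op (ell2_block w :: 'a ell2 \<Rightarrow>\<^sub>L 'a ell2)"
    by (simp add: complex_linear_op_def ell2_block.rep_eq)
  have "((\<lambda>(w, m). (norm (Rep_ell2 f (word_code w m)))\<^sup>2) has_sum (norm f)\<^sup>2) (UNIV \<times> UNIV)"
    using has_sum_reindex_bij_betw[OF bij_word_code, of "\<lambda>n. (norm (Rep_ell2 f n))\<^sup>2"] ell2_norm_has_sum[of f]
    by (simp add: case_prod_unfold)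
  then show "((\<lambda>w. (norm (ell2_block w f))\<^sup>2) has_sum (norm f)\<^sup>2) UNIV"
  proof (rule has_sum_SigmaD)
    fix w
    show "((\<lambda>m. case (w, m) of (w, m) \<Rightarrow> (norm (Rep_ell2 f (word_code w m)))\<^sup>2) has_sum (norm (ell2_block w f))\<^sup>2) UNIV"
      using ell2_norm_has_sum[of "ell2_block w f"] by (simp add: ell2_block.rep_eq ell2_slice.rep_eq)
  qed
next
  fix g :: "nat list \<Rightarrow> 'a ell2"
  assume g: "(\<lambda>w. (norm (g w))\<^sup>2) summable_on UNIV"
  define F where "F p = Rep_ell2 (g (list_decode (fst (prod_decode p)))) (snd (prod_decode p))" for p
  have F: "F (word_code w m) = Rep_ell2 (g w) m" for w m by (simp add: F_def word_code_def)
  have "(\<lambda>(w, m). (norm (F (word_code w m)))\<^sup>2) summable_on (UNIV \<times> UNIV)"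
    by (rule summable_on_SigmaI[OF _ g]) (use ell2_norm_has_sum in \<open>auto simp: F\<close>)
  then have "(\<lambda>n. (norm (F n))\<^sup>2) summable_on UNIV"
    using summable_on_reindex_bij_betw[OF bij_word_code, of "\<lambda>n. (norm (F n))\<^sup>2"] by (simp add: case_prod_unfold)
  then have "Rep_ell2 (Abs_ell2 F) = F" by (simp add: Abs_ell2_inverse)
  then have "ell2_block w (Abs_ell2 F) = g w" for w
    by (simp add: ell2_block.rep_eq F ell2_slice.rep_eq flip: Rep_ell2_inject)
  then show "\<exists>f. \<forall>w. ell2_block w f = g w" by blast
qed

section \<open>Operators on H as a corner of the operators on l_2(H)\<close>

lift_definition ell2_single :: "'a :: complex_hilbert \<Rightarrow> 'a ell2" is "\<lambda>h n. if n = 0 then h else 0"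
proof -
  fix h :: 'a
  show "(\<lambda>n::nat. (norm (if n = 0 then h else 0))\<^sup>2) summable_on UNIV"
    by (rule has_sum_imp_summable, rule has_sum_single[where i = 0]) auto
qed

lemma inner_ell2_single: "inner (ell2_single h) f = inner h (Rep_ell2 f 0)"
proof -
  have "((\<lambda>n. inner (Rep_ell2 (ell2_single h) n) (Rep_ell2 f n)) has_sum inner (Rep_ell2 (ell2_single h) 0) (Rep_ell2 f 0)) UNIV"
    by (rule has_sum_single[where i = 0]) (simp add: ell2_single.rep_eq)
  from infsumI[OF this] show ?thesis by (simp add: inner_ell2.rep_eq ell2_single.rep_eq)
qed

lemma norm_ell2_single: "norm (ell2_single h) = norm h"
  by (simp add: norm_eq_sqrt_inner inner_ell2_single ell2_single.rep_eq)

lift_definition corner_in :: "'a :: complex_hilbert \<Rightarrow>\<^sub>L 'a ell2" is ell2_single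
proof (rule bounded_linear_intro)
  fix f g :: 'a and r :: real
  show "ell2_single (f + g) = ell2_single f + ell2_single g" by transfer auto
  show "ell2_single (r *\<^sub>R f) = r *\<^sub>R ell2_single f" by transfer auto
  show "norm (ell2_single f) \<le> norm f * 1" by (simp add: norm_ell2_single)
qed

lift_definition corner_out :: "'a :: complex_hilbert ell2 \<Rightarrow>\<^sub>L 'a" is "\<lambda>f. Rep_ell2 f 0"
proof (rule bounded_linear_intro)
  fix f g :: "'a ell2" and r :: real
  show "Rep_ell2 (f + g) 0 = Rep_ell2 f 0 + Rep_ell2 g 0" by (simp add: plus_ell2.rep_eq)
  show "Rep_ell2 (r *\<^sub>R f) 0 = r *\<^sub>R Rep_ell2 f 0" by (simp add: scaleR_ell2.rep_eq)
  show "norm (Rep_ell2 f 0) \<le> norm f * 1" by (simp add: norm_Rep_ell2_le)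
qed

lemma corner_out_in: "corner_out (corner_in h) = h"
  by (simp add: corner_out.rep_eq corner_in.rep_eq ell2_single.rep_eq)

lemma inner_corner: "inner (corner_in h) f = inner h (corner_out f)"
  by (simp add: corner_out.rep_eq corner_in.rep_eq inner_ell2_single)

lemma norm_corner_in: "norm (corner_in h) = norm h"
  by (simp add: corner_in.rep_eq norm_ell2_single)

lemma norm_corner_out_le: "norm (corner_out f) \<le> norm f"
  by (simp add: corner_out.rep_eq norm_Rep_ell2_le)

lemma corner_in_scaleC: "corner_in (c *\<^sub>C h) = c *\<^sub>C corner_in h"
  unfolding corner_in.rep_eq by transfer (auto simp: scaleC_zero_right)

lemma corner_out_scaleC: "corner_out (c *\<^sub>C f) = c *\<^sub>C corner_out f"
  by (simp add: corner_out.rep_eq scaleC_ell2.rep_eq)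

text \<open>An isometric, non-unital *-homomorphism. \<open>compression\<close> is its left inverse
  and serves to define the transported u on all operators.\<close>

definition corner :: "('a :: complex_hilbert \<Rightarrow>\<^sub>L 'a) \<Rightarrow> 'a ell2 \<Rightarrow>\<^sub>L 'a ell2" where
  "corner a = corner_in o\<^sub>L (a o\<^sub>L corner_out)"

definition compression :: "('a :: complex_hilbert ell2 \<Rightarrow>\<^sub>L 'a ell2) \<Rightarrow> 'a \<Rightarrow>\<^sub>L 'a" where
  "compression S = corner_out o\<^sub>L (S o\<^sub>L corner_in)"

lemma corner_apply: "corner a f = corner_in (a (corner_out f))"
  by (simp add: corner_def)

lemma compression_corner: "compression (corner a) = a"
  by (rule blinfun_eqI) (simp add: compression_def corner_apply corner_out_in)

lemma clin_corner: "complex_linear_op a \<Longrightarrow> complex_linear_op (corner a)"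
  by (simp add: complex_linear_op_def corner_apply corner_out_scaleC corner_in_scaleC)

lemma corner_add: "corner (a + b) = corner a + corner b"
  by (simp add: corner_def comp_add_left comp_add_right)

lemma corner_scaleC: "corner (c *\<^sub>C a) = c *\<^sub>C corner a"
  by (rule blinfun_eqI) (simp add: corner_apply scaleC_blinfun_apply corner_in_scaleC)

lemma corner_comp: "corner (a o\<^sub>L b) = corner a o\<^sub>L corner b"
  by (rule blinfun_eqI) (simp add: corner_apply corner_out_in)

lemma corner_adjoint: "complex_linear_op a \<Longrightarrow> op_adjoint (corner a) = corner (op_adjoint a)"
  by (intro op_adjoint_eqI clin_corner)
    (auto simp: corner_apply inner_corner inner_adjoint inner_commute[of _ "corner_in _"], simp add: inner_commute)

lemma corner_zero: "corner 0 = 0"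
  by (rule blinfun_eqI) (simp add: corner_apply)

lemma norm_corner: "norm (corner a) = norm a"
proof (rule antisym)
  show "norm (corner a) \<le> norm a"
  proof (rule norm_blinfun_bound)
    fix f
    have "norm (corner a f) = norm (a (corner_out f))" by (simp add: corner_apply norm_corner_in)
    also have "\<dots> \<le> norm a * norm (corner_out f)" by (rule norm_blinfun)
    also have "\<dots> \<le> norm a * norm f" by (intro mult_left_mono norm_corner_out_le) simp
    finally show "norm (corner a f) \<le> norm a * norm f" .
  qed simp
  show "norm a \<le> norm (corner a)"
  proof (rule norm_blinfun_bound)
    fix h
    have "norm (a h) = norm (corner a (corner_in h))" by (simp add: corner_apply norm_corner_in corner_out_in)
    also have "\<dots> \<le> norm (corner a) * norm (corner_in h)" by (rule norm_blinfun)
    finally show "norm (a h) \<le> norm (corner a) * norm h" by (simp add: norm_corner_in)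
  qed simp
qed

lemma star_algebra_corner:
  assumes "star_algebra A"
  shows "star_algebra (corner ` A)"
proof -
  note D = star_algebraD[OF assms]
  have "0 \<in> corner ` A" using D(2) corner_zero by (metis imageI)
  then show ?thesis
    unfolding star_algebra_def
    by (auto simp: clin_corner D corner_adjoint simp flip: corner_add corner_scaleC corner_comp intro!: imageI)
qed

lemma pairing_bounded_corner:
  assumes "pairing_bounded n D \<alpha> a c" "c \<ge> 0"
  shows "pairing_bounded n D \<alpha> (\<lambda>J. corner (a J)) c"
  unfolding pairing_bounded_def
proof (intro allI)
  fix x y :: "(nat \<Rightarrow> nat) \<Rightarrow> 'a ell2"
  have "(\<Sum>J\<in>multi_index n D. inner (corner (a J) (x (restrict J \<alpha>))) (y (restrict J (D - \<alpha>)))) =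
      (\<Sum>J\<in>multi_index n D. inner (a J (corner_out (x (restrict J \<alpha>)))) (corner_out (y (restrict J (D - \<alpha>)))))"
    by (simp add: corner_apply inner_corner)
  also have "\<dots> \<le> c * L2_set (\<lambda>l. norm (corner_out (x l))) (multi_index n \<alpha>) *
      L2_set (\<lambda>m. norm (corner_out (y m))) (multi_index n (D - \<alpha>))"
    using assms(1)[unfolded pairing_bounded_def, rule_format, of "\<lambda>l. corner_out (x l)" "\<lambda>m. corner_out (y m)"] .
  also have "\<dots> \<le> c * L2_set (\<lambda>l. norm (x l)) (multi_index n \<alpha>) * L2_set (\<lambda>m. norm (y m)) (multi_index n (D - \<alpha>))"
    using assms(2) by (intro mult_mono L2_set_mono norm_corner_out_le) (auto simp: L2_set_nonneg)
  finally show "(\<Sum>J\<in>multi_index n D. inner (corner (a J) (x (restrict J \<alpha>))) (y (restrict J (D - \<alpha>)))) \<le>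
    c * L2_set (\<lambda>l. norm (x l)) (multi_index n \<alpha>) * L2_set (\<lambda>m. norm (y m)) (multi_index n (D - \<alpha>))" .
qed

lemma pairing_bounded_cornerD:
  assumes "pairing_bounded n D \<alpha> (\<lambda>J. corner (a J)) c"
  shows "pairing_bounded n D \<alpha> a c"
  unfolding pairing_bounded_def
proof (intro allI)
  fix x y :: "(nat \<Rightarrow> nat) \<Rightarrow> 'a"
  show "(\<Sum>J\<in>multi_index n D. inner (a J (x (restrict J \<alpha>))) (y (restrict J (D - \<alpha>)))) \<le>
    c * L2_set (\<lambda>l. norm (x l)) (multi_index n \<alpha>) * L2_set (\<lambda>m. norm (y m)) (multi_index n (D - \<alpha>))"
    using assms[unfolded pairing_bounded_def, rule_format, of "\<lambda>l. corner_in (x l)" "\<lambda>m. corner_in (y m)"]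
    by (simp add: corner_apply inner_corner corner_out_in norm_corner_in)
qed

text \<open>Passing to corners on both sides changes neither the bound of u nor the pairings, and it
  supplies the block systems that the original spaces may lack.\<close>

lemma pairing_bounded_map_general:
  fixes u :: "('h :: complex_hilbert \<Rightarrow>\<^sub>L 'h) \<Rightarrow> 'g :: complex_hilbert \<Rightarrow>\<^sub>L 'g"
  assumes D: "finite D" "D \<noteq> {}" and A: "star_algebra A" and u: "bounded_map_on A u M"
    and a: "\<And>J. J \<in> multi_index n D \<Longrightarrow> a J \<in> A"
    and c: "c \<ge> 0" and pb: "\<And>\<beta>. \<beta> \<subseteq> D \<Longrightarrow> pairing_bounded n D \<beta> a c" and \<alpha>: "\<alpha> \<subseteq> D"
  shows "pairing_bounded n D \<alpha> (\<lambda>J. u (a J)) (sqrt 2 * (2 * sqrt 2) ^ (card D - 1) * M * c)"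
proof -
  define u' where "u' S = corner (u (compression S))" for S
  note U = bounded_map_onD[OF u] and D' = star_algebraD[OF A]
  have u': "bounded_map_on (corner ` A) u' M"
    unfolding bounded_map_on_def
    by (auto simp: u'_def compression_corner U D' clin_corner norm_corner simp flip: corner_add corner_scaleC)
  have "pairing_bounded n D \<alpha> (\<lambda>J. u' (corner (a J))) (sqrt 2 * (2 * sqrt 2) ^ (card D - 1) * M * c)"
    by (rule pairing_bounded_map[OF block_system_ell2 block_system_ell2 D star_algebra_corner[OF A] u'])
      (rule imageI a c pairing_bounded_corner pb \<alpha> | assumption)+
  then have "pairing_bounded n D \<alpha> (\<lambda>J. corner (u (a J))) (sqrt 2 * (2 * sqrt 2) ^ (card D - 1) * M * c)"
    by (simp add: u'_def compression_corner)
  then show ?thesis by (rule pairing_bounded_cornerD)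
qed

section \<open>The norms of families of operators\<close>

text \<open>The crude 2 is harmless: this only serves to show that a supremum is taken over a
  bounded set.\<close>

lemma cmod_cinner_le: "cmod (cinner x y) \<le> 2 * (norm x * norm y)"
proof -
  have "cmod (cinner x y) \<le> \<bar>inner x y\<bar> + \<bar>inner x (\<i> *\<^sub>C y)\<bar>"
    unfolding cinner_eq_Complex complex_norm by (rule sqrt_sum_squares_le_sum_abs)
  also have "\<dots> \<le> norm x * norm y + norm x * norm (\<i> *\<^sub>C y)" by (intro add_mono Cauchy_Schwarz_ineq2)
  finally show ?thesis by (simp add: norm_scaleC)
qed

lemma positive_op_sum_adjoint_comp:
  assumes "\<And>i. i \<in> I \<Longrightarrow> complex_linear_op (a i)"
  shows "positive_op (\<Sum>i\<in>I. op_adjoint (a i) o\<^sub>L a i)"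
  unfolding positive_op_iff
  by (intro conjI allI clin_sum clin_comp clin_adjoint assms)
    (auto simp: blinfun.sum_left inner_sum_left inner_sum_right inner_adjoint' inner_adjoint[symmetric] assms
      clin_adjoint intro!: sum_nonneg)

lemma norm_op_sqrt_sum_apply:
  assumes "\<And>i. i \<in> I \<Longrightarrow> complex_linear_op (a i)"
  shows "(norm (op_sqrt (\<Sum>i\<in>I. op_adjoint (a i) o\<^sub>L a i) h))\<^sup>2 = (\<Sum>i\<in>I. (norm (a i h))\<^sup>2)"
  by (subst norm_op_sqrt_apply, rule positive_op_sum_adjoint_comp)
    (simp_all add: blinfun.sum_left inner_sum_left inner_adjoint' assms dot_square_norm)

lemma norm_op_sqrt_sum_le_iff:
  assumes "\<And>i. i \<in> I \<Longrightarrow> complex_linear_op (a i)" "c \<ge> 0"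
  shows "norm (op_sqrt (\<Sum>i\<in>I. op_adjoint (a i) o\<^sub>L a i)) \<le> c \<longleftrightarrow> (\<forall>h. (\<Sum>i\<in>I. (norm (a i h))\<^sup>2) \<le> c\<^sup>2 * (norm h)\<^sup>2)"
    (is "norm ?S \<le> c \<longleftrightarrow> ?R")
proof
  assume S: "norm ?S \<le> c"
  show ?R
  proof
    fix h
    have "norm (?S h) \<le> c * norm h" using S by (rule order_trans[OF norm_blinfun mult_right_mono]) simp
    then have "(norm (?S h))\<^sup>2 \<le> (c * norm h)\<^sup>2" by (rule power_mono) simp
    then show "(\<Sum>i\<in>I. (norm (a i h))\<^sup>2) \<le> c\<^sup>2 * (norm h)\<^sup>2"
      by (simp add: norm_op_sqrt_sum_apply assms(1) power_mult_distrib)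
  qed
next
  assume R: ?R
  show "norm ?S \<le> c"
  proof (rule norm_blinfun_bound)
    fix h
    have "(norm (?S h))\<^sup>2 \<le> (c * norm h)\<^sup>2"
      using R by (simp add: norm_op_sqrt_sum_apply assms(1) power_mult_distrib)
    then show "norm (?S h) \<le> c * norm h" by (rule power2_le_imp_le) (use assms(2) in simp)
  qed (rule assms(2))
qed

text \<open>Without boundedness the real supremum in \<open>family_norm\<close> would carry no
  information.\<close>

lemma family_norm_bdd_above:
  fixes a :: "(nat \<Rightarrow> nat) \<Rightarrow> 'h :: complex_hilbert \<Rightarrow>\<^sub>L 'h"
  assumes "\<alpha> \<subseteq> {1..k}"
  shows "bdd_above ((\<lambda>(x, y). cmod (\<Sum>J\<in>multi_index n {1..k}.
      cinner (a J (x (restrict J \<alpha>))) (y (restrict J ({1..k} - \<alpha>))))) `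
    {(x, y). (\<Sum>l\<in>multi_index n \<alpha>. (norm (x l))\<^sup>2) \<le> 1 \<and> (\<Sum>m\<in>multi_index n ({1..k} - \<alpha>). (norm (y m))\<^sup>2) \<le> 1})"
proof (rule bdd_aboveI2, clarify)
  fix x y :: "(nat \<Rightarrow> nat) \<Rightarrow> 'h"
  assume x: "(\<Sum>l\<in>multi_index n \<alpha>. (norm (x l))\<^sup>2) \<le> 1" and y: "(\<Sum>m\<in>multi_index n ({1..k} - \<alpha>). (norm (y m))\<^sup>2) \<le> 1"
  have le1: "norm (z l) \<le> 1" if "(\<Sum>l\<in>multi_index n B. (norm (z l))\<^sup>2) \<le> 1" "l \<in> multi_index n B" "B \<subseteq> {1..k}" for z :: "(nat \<Rightarrow> nat) \<Rightarrow> 'h" and l B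
  proof -
    have "finite B" using that(3) finite_subset by blast
    then have "(norm (z l))\<^sup>2 \<le> (\<Sum>l\<in>multi_index n B. (norm (z l))\<^sup>2)"
      using that(2) by (intro member_le_sum) (auto simp: finite_multi_index)
    then have "(norm (z l))\<^sup>2 \<le> 1\<^sup>2" using that(1) by simp
    then show ?thesis by (rule power2_le_imp_le) simp
  qed
  \<comment> \<open>The constraints control x and y only on tuples with entries in [n], so the
    arguments must be seen to be such tuples.\<close>
  have restr: "restrict J B \<in> multi_index n B" if "J \<in> multi_index n {1..k}" "B \<subseteq> {1..k}" for J B
    using that unfolding multi_index_def by (auto simp: PiE_def Pi_def)
  have "cmod (\<Sum>J\<in>multi_index n {1..k}. cinner (a J (x (restrict J \<alpha>))) (y (restrict J ({1..k} - \<alpha>)))) \<le>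
      (\<Sum>J\<in>multi_index n {1..k}. 2 * norm (a J))"
  proof (intro order_trans[OF norm_sum] sum_mono)
    fix J assume J: "J \<in> multi_index n {1..k}"
    let ?x = "x (restrict J \<alpha>)" and ?y = "y (restrict J ({1..k} - \<alpha>))"
    have "norm (a J ?x) * norm ?y \<le> (norm (a J) * 1) * 1"
      using le1[OF x restr[OF J assms] assms] le1[OF y restr[OF J Diff_subset] Diff_subset]
      by (intro mult_mono order_trans[OF norm_blinfun] mult_left_mono) auto
    then show "cmod (cinner (a J ?x) ?y) \<le> 2 * norm (a J)" using cmod_cinner_le[of "a J ?x" ?y] by simp
  qed
  then show "cmod (\<Sum>J\<in>multi_index n {1..k}. cinner (a J (x (restrict J \<alpha>))) (y (restrict J ({1..k} - \<alpha>)))) \<le>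
      (\<Sum>J\<in>multi_index n {1..k}. 2 * norm (a J))" .
qed

lemma L2_set_scaleR:
  "L2_set (\<lambda>l. norm (r *\<^sub>R x l)) I = \<bar>r\<bar> * L2_set (\<lambda>l. norm (x l)) I"
  by (simp add: L2_set_def power_mult_distrib real_sqrt_mult flip: sum_distrib_left)

lemma pairing_bounded_family_norm:
  fixes a :: "(nat \<Rightarrow> nat) \<Rightarrow> 'h :: complex_hilbert \<Rightarrow>\<^sub>L 'h"
  assumes clin: "\<And>J. J \<in> multi_index n {1..k} \<Longrightarrow> complex_linear_op (a J)"
    and k: "k \<ge> 1" and \<alpha>: "\<alpha> \<subseteq> {1..k}"
  shows "pairing_bounded n {1..k} \<alpha> a (family_norm k n \<alpha> a)"
proof -
  let ?I = "multi_index n {1..k}"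
  have ne: "{1..k} \<noteq> {}" using k by auto
  consider "\<alpha> = {}" | "\<alpha> = {1..k}" | "\<alpha> \<noteq> {}" "\<alpha> \<noteq> {1..k}" by blast
  then show ?thesis
  proof cases
    case 1
    define S where "S = op_sqrt (\<Sum>J\<in>?I. op_adjoint (a J) o\<^sub>L a J)"
    have "\<forall>h. (\<Sum>J\<in>?I. (norm (a J h))\<^sup>2) \<le> (norm S)\<^sup>2 * (norm h)\<^sup>2"
      using norm_op_sqrt_sum_le_iff[of ?I a "norm S"] clin unfolding S_def by simp
    then have "pairing_bounded n {1..k} {} a (norm S)" by (subst pairing_bounded_empty_iff) auto
    then show ?thesis by (simp add: 1 family_norm_def S_def)
  next
    case 2
    define S where "S = op_sqrt (\<Sum>J\<in>?I. op_adjoint (op_adjoint (a J)) o\<^sub>L op_adjoint (a J))"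
    have "\<forall>h. (\<Sum>J\<in>?I. (norm (op_adjoint (a J) h))\<^sup>2) \<le> (norm S)\<^sup>2 * (norm h)\<^sup>2"
      using norm_op_sqrt_sum_le_iff[of ?I "\<lambda>J. op_adjoint (a J)" "norm S"] clin unfolding S_def by (simp add: clin_adjoint)
    then have "pairing_bounded n {1..k} {1..k} a (norm S)" by (subst pairing_bounded_full_iff) (auto simp: clin)
    moreover have "family_norm k n {1..k} a = norm S"
      using ne by (simp add: family_norm_def S_def adjoint_adjoint clin cong: sum.cong)
    ultimately show ?thesis by (simp add: 2)
  next
    case 3
    define Z where "Z x y = (\<Sum>J\<in>?I. cinner (a J (x (restrict J \<alpha>))) (y (restrict J ({1..k} - \<alpha>))))" for x y
    define ball where "ball = {(x :: (nat \<Rightarrow> nat) \<Rightarrow> 'h, y :: (nat \<Rightarrow> nat) \<Rightarrow> 'h).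
        (\<Sum>l\<in>multi_index n \<alpha>. (norm (x l))\<^sup>2) \<le> 1 \<and> (\<Sum>m\<in>multi_index n ({1..k} - \<alpha>). (norm (y m))\<^sup>2) \<le> 1}"
    have fn: "family_norm k n \<alpha> a = (SUP (x, y)\<in>ball. cmod (Z x y))"
      using 3 by (simp add: family_norm_def Z_def ball_def)
    have upper: "cmod (Z x y) \<le> family_norm k n \<alpha> a" if "(x, y) \<in> ball" for x y
      unfolding fn using cSUP_upper[OF that family_norm_bdd_above[OF \<alpha>, where n = n and a = a, folded Z_def ball_def]] by simp
    have re: "Re (Z x y) = (\<Sum>J\<in>?I. inner (a J (x (restrict J \<alpha>))) (y (restrict J ({1..k} - \<alpha>))))" for x y
      by (simp add: Z_def Re_cinner)
    have fin: "finite \<alpha>" "finite ({1..k} - \<alpha>)" using \<alpha> finite_subset by auto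
    show ?thesis unfolding pairing_bounded_def
    proof (intro allI)
      fix x y :: "(nat \<Rightarrow> nat) \<Rightarrow> 'h"
      define p where "p = L2_set (\<lambda>l. norm (x l)) (multi_index n \<alpha>)"
      define q where "q = L2_set (\<lambda>m. norm (y m)) (multi_index n ({1..k} - \<alpha>))"
      have restr: "restrict J B \<in> multi_index n B" if "J \<in> ?I" "B \<subseteq> {1..k}" for J B
        using that unfolding multi_index_def by (auto simp: PiE_def Pi_def)
      have "(\<Sum>J\<in>?I. inner (a J (x (restrict J \<alpha>))) (y (restrict J ({1..k} - \<alpha>)))) \<le> family_norm k n \<alpha> a * p * q"
      proof (cases "p = 0 \<or> q = 0")
        \<comment> \<open>A family of norm zero cannot be rescaled to norm one; here every term of
          the pairing vanishes.\<close>
        case True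
        have "inner (a J (x (restrict J \<alpha>))) (y (restrict J ({1..k} - \<alpha>))) = 0" if J: "J \<in> ?I" for J
          using True restr[OF J \<alpha>] restr[OF J Diff_subset] fin
          by (auto simp: p_def q_def L2_set_eq_0_iff finite_multi_index)
        then show ?thesis using True by auto
      next
        case False
        then have pq: "p > 0" "q > 0" by (auto simp: p_def q_def order_less_le L2_set_nonneg)
        define x' where "x' l = (1/p) *\<^sub>R x l" for l
        define y' where "y' m = (1/q) *\<^sub>R y m" for m
        have "L2_set (\<lambda>l. norm (x' l)) (multi_index n \<alpha>) = 1" "L2_set (\<lambda>m. norm (y' m)) (multi_index n ({1..k} - \<alpha>)) = 1"
          using pq unfolding x'_def y'_def L2_set_scaleR by (auto simp: p_def q_def)
        then have "(x', y') \<in> ball" by (simp add: ball_def flip: L2_set_sq)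
        then have "Re (Z x' y') \<le> family_norm k n \<alpha> a" using complex_Re_le_cmod upper order_trans by blast
        moreover have "Re (Z x' y') = (1 / (p * q)) * (\<Sum>J\<in>?I. inner (a J (x (restrict J \<alpha>))) (y (restrict J ({1..k} - \<alpha>))))"
          unfolding re x'_def y'_def by (simp add: blinfun.scaleR_right sum_distrib_left mult.commute)
        ultimately show ?thesis using pq by (simp add: field_simps)
      qed
      then show "(\<Sum>J\<in>?I. inner (a J (x (restrict J \<alpha>))) (y (restrict J ({1..k} - \<alpha>)))) \<le> family_norm k n \<alpha> a *
        L2_set (\<lambda>l. norm (x l)) (multi_index n \<alpha>) * L2_set (\<lambda>m. norm (y m)) (multi_index n ({1..k} - \<alpha>))"
        by (simp add: p_def q_def)
    qed
  qed
qed

lemma family_norm_le: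
  fixes a :: "(nat \<Rightarrow> nat) \<Rightarrow> 'h :: complex_hilbert \<Rightarrow>\<^sub>L 'h"
  assumes clin: "\<And>J. J \<in> multi_index n {1..k} \<Longrightarrow> complex_linear_op (a J)"
    and pb: "pairing_bounded n {1..k} \<alpha> a c" and c: "c \<ge> 0"
  shows "family_norm k n \<alpha> a \<le> c"
proof -
  let ?I = "multi_index n {1..k}"
  consider "\<alpha> = {}" | "\<alpha> = {1..k}" "\<alpha> \<noteq> {}" | "\<alpha> \<noteq> {}" "\<alpha> \<noteq> {1..k}" by blast
  then show ?thesis
  proof cases
    case 1
    then have "\<forall>h. (\<Sum>J\<in>?I. (norm (a J h))\<^sup>2) \<le> c\<^sup>2 * (norm h)\<^sup>2"
      using pb pairing_bounded_empty_iff[OF c, of n "{1..k}" a] by simp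
    then have "norm (op_sqrt (\<Sum>J\<in>?I. op_adjoint (a J) o\<^sub>L a J)) \<le> c"
      using norm_op_sqrt_sum_le_iff[of ?I a c] clin c by simp
    then show ?thesis by (simp add: family_norm_def 1)
  next
    case 2
    have "\<forall>h. (\<Sum>J\<in>?I. (norm (op_adjoint (a J) h))\<^sup>2) \<le> c\<^sup>2 * (norm h)\<^sup>2"
      using pb pairing_bounded_full_iff[where a = a and n = n and D = "{1..k}", OF c clin] unfolding 2(1) by simp
    then have "norm (op_sqrt (\<Sum>J\<in>?I. op_adjoint (op_adjoint (a J)) o\<^sub>L op_adjoint (a J))) \<le> c"
      using norm_op_sqrt_sum_le_iff[of ?I "\<lambda>J. op_adjoint (a J)" c] clin c by (simp add: clin_adjoint)
    moreover have "family_norm k n \<alpha> a = norm (op_sqrt (\<Sum>J\<in>?I. op_adjoint (op_adjoint (a J)) o\<^sub>L op_adjoint (a J)))"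
      using 2 by (simp add: family_norm_def adjoint_adjoint clin cong: sum.cong)
    ultimately show ?thesis by simp
  next
    case 3
    define Z where "Z x y = (\<Sum>J\<in>?I. cinner (a J (x (restrict J \<alpha>))) (y (restrict J ({1..k} - \<alpha>))))" for x y
    define ball where "ball = {(x :: (nat \<Rightarrow> nat) \<Rightarrow> 'h, y :: (nat \<Rightarrow> nat) \<Rightarrow> 'h).
        (\<Sum>l\<in>multi_index n \<alpha>. (norm (x l))\<^sup>2) \<le> 1 \<and> (\<Sum>m\<in>multi_index n ({1..k} - \<alpha>). (norm (y m))\<^sup>2) \<le> 1}"
    have fn: "family_norm k n \<alpha> a = (SUP (x, y)\<in>ball. cmod (Z x y))"
      using 3 by (simp add: family_norm_def Z_def ball_def)
    have le: "cmod (Z x y) \<le> c" if xy: "(x, y) \<in> ball" for x y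
    proof -
      \<comment> \<open>The phase e makes the pairing real and nonnegative and passes through
        \<open>a J\<close> by complex linearity. If Z x y = 0 then e = 0, so only
        \<open>cmod e \<le> 1\<close> is available.\<close>
      define e where "e = cnj (sgn (Z x y))"
      have Ze: "e * Z x y = complex_of_real (cmod (Z x y))"
        by (cases "Z x y = 0") (simp_all add: e_def sgn_eq complex_norm_square[symmetric] power2_eq_square field_simps)
      have e1: "cmod e \<le> 1" by (simp add: e_def norm_sgn)
      have "Z (\<lambda>l. e *\<^sub>C x l) y = e * Z x y"
        by (simp add: Z_def clinD[OF clin] cinner_scaleC_left sum_distrib_left cong: sum.cong)
      then have "cmod (Z x y) = Re (Z (\<lambda>l. e *\<^sub>C x l) y)" by (simp add: Ze)
      also have "\<dots> = (\<Sum>J\<in>?I. inner (a J (e *\<^sub>C x (restrict J \<alpha>))) (y (restrict J ({1..k} - \<alpha>))))"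
        by (simp add: Z_def Re_cinner)
      also have "\<dots> \<le> c * L2_set (\<lambda>l. norm (e *\<^sub>C x l)) (multi_index n \<alpha>) * L2_set (\<lambda>m. norm (y m)) (multi_index n ({1..k} - \<alpha>))"
        using pb[unfolded pairing_bounded_def, rule_format, of "\<lambda>l. e *\<^sub>C x l" y] .
      also have "\<dots> \<le> c * 1 * 1"
      proof (intro mult_mono)
        have "L2_set (\<lambda>l. norm (e *\<^sub>C x l)) (multi_index n \<alpha>) \<le> L2_set (\<lambda>l. norm (x l)) (multi_index n \<alpha>)"
          by (intro L2_set_mono) (auto simp: norm_scaleC intro: mult_left_le_one_le e1)
        also have "\<dots> \<le> 1" using xy by (simp add: ball_def L2_set_def)
        finally show "L2_set (\<lambda>l. norm (e *\<^sub>C x l)) (multi_index n \<alpha>) \<le> 1" .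
        show "L2_set (\<lambda>m. norm (y m)) (multi_index n ({1..k} - \<alpha>)) \<le> 1" using xy by (simp add: ball_def L2_set_def)
      qed (use c in \<open>auto simp: L2_set_nonneg\<close>)
      finally show ?thesis by simp
    qed
    have "(\<lambda>_. 0, \<lambda>_. 0) \<in> ball" by (simp add: ball_def)
    then show ?thesis unfolding fn using le by (intro cSUP_least) auto
  qed
qed

theorem theorem0:
  fixes k :: nat
  assumes "k \<ge> 1"
  shows "\<exists>K :: real. K \<le> 2 powr (3 * real k / 2 - 1) \<and>
    (\<forall>(A :: ('h :: complex_hilbert \<Rightarrow>\<^sub>L 'h) set) (B :: ('g :: complex_hilbert \<Rightarrow>\<^sub>L 'g) set) u n a.
       cstar_subalgebra A \<longrightarrow> cstar_subalgebra B \<longrightarrow> bounded_complex_linear_on A B u \<longrightarrow>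
       n \<ge> 1 \<longrightarrow> (\<forall>J\<in>multi_index n {1..k}. a J \<in> A) \<longrightarrow>
       max_norm k n (\<lambda>J. u (a J)) \<le> K * norm_on A u * max_norm k n a)"
proof (intro exI[of _ "2 powr (3 * real k / 2 - 1)"] conjI allI impI order_refl)
  fix A :: "('h \<Rightarrow>\<^sub>L 'h) set" and B :: "('g \<Rightarrow>\<^sub>L 'g) set"
    and u :: "('h \<Rightarrow>\<^sub>L 'h) \<Rightarrow> 'g \<Rightarrow>\<^sub>L 'g" and n :: nat and a :: "(nat \<Rightarrow> nat) \<Rightarrow> 'h \<Rightarrow>\<^sub>L 'h"
  assume cA: "cstar_subalgebra A" and cB: "cstar_subalgebra B" and bu: "bounded_complex_linear_on A B u"
    and aA: "\<forall>J\<in>multi_index n {1..k}. a J \<in> A"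
  have A: "star_algebra A" using cA by (simp add: cstar_subalgebra_def star_algebra_def)
  note D = star_algebraD[OF A]
  have uB: "u S \<in> B" "u (c *\<^sub>C S) = c *\<^sub>C u S" if "S \<in> A" for S c using bu that by (auto simp: bounded_complex_linear_on_def)
  have clin_u: "complex_linear_op (u S)" if "S \<in> A" for S
    using uB(1)[OF that] cB by (simp add: cstar_subalgebra_def)
  define M where "M = norm_on A u"
  \<comment> \<open>\<open>norm_on\<close> is a real supremum, so some bound for u is needed before
    it can act as the norm of u.\<close>
  have bdd: "bdd_above ((\<lambda>S. norm (u S)) ` {S \<in> A. norm S \<le> 1})"
  proof -
    obtain M' where M': "\<forall>S\<in>A. norm (u S) \<le> M' * norm S" using bu by (auto simp: bounded_complex_linear_on_def)
    have "norm (u S) \<le> \<bar>M'\<bar>" if "S \<in> A" "norm S \<le> 1" for S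
    proof -
      have "norm (u S) \<le> M' * norm S" using M' that by blast
      also have "\<dots> \<le> \<bar>M'\<bar> * 1" using that by (intro mult_mono) auto
      finally show ?thesis by simp
    qed
    then show ?thesis by (intro bdd_aboveI2) auto
  qed
  have M_upper: "norm (u S) \<le> M" if "S \<in> A" "norm S \<le> 1" for S
    unfolding M_def norm_on_def using that bdd by (intro cSUP_upper) auto
  have M0: "M \<ge> 0" by (rule order_trans[OF norm_ge_zero M_upper[OF D(2)]]) simp
  have "norm (u S) \<le> M * norm S" if S: "S \<in> A" for S
  proof (cases "S = 0")
    case True
    have "u 0 = 0" using uB(2)[OF D(2), of 0] by (simp add: scaleC_zero_right scaleC_of_real[of 0, simplified])
    then show ?thesis by (simp add: True)
  next
    case False
    have "norm (u ((1 / norm S) *\<^sub>R S)) \<le> M" using False S by (intro M_upper D) auto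
    also have "u ((1 / norm S) *\<^sub>R S) = (1 / norm S) *\<^sub>R u S"
      using uB(2)[OF S, of "complex_of_real (1 / norm S)"] by (simp only: scaleC_of_real)
    finally show ?thesis using False by (simp add: field_simps)
  qed
  then have u: "bounded_map_on A u M"
    using bu M0 clin_u by (simp add: bounded_map_on_def bounded_complex_linear_on_def)
  define c where "c = max_norm k n a"
  have c_ge: "family_norm k n \<alpha> a \<le> c" if "\<alpha> \<subseteq> {1..k}" for \<alpha>
    unfolding c_def max_norm_def using that by (intro Max_ge) auto
  have c0: "c \<ge> 0" using c_ge[of "{}"] by (auto simp: family_norm_def intro: order_trans[OF norm_ge_zero])
  have clin_a: "complex_linear_op (a J)" if "J \<in> multi_index n {1..k}" for J using aA that D by blast
  have pb: "pairing_bounded n {1..k} \<alpha> a c" if "\<alpha> \<subseteq> {1..k}" for \<alpha>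
    using pairing_bounded_family_norm[OF clin_a assms that] c_ge[OF that] unfolding pairing_bounded_def
    by (meson L2_set_nonneg mult_right_mono order_trans)
  \<comment> \<open>In powers of 2, the base case contributes 1/2 and each of the k - 1 induction
    steps 3/2.\<close>
  let ?K = "sqrt 2 * (2 * sqrt 2) ^ (card {1..k} - 1)"
  have K: "?K = 2 powr (3 * real k / 2 - 1)"
  proof -
    have s: "sqrt 2 = 2 powr (1/2)" by (simp add: powr_half_sqrt)
    have "2 * sqrt 2 = 2 powr (3/2)" using powr_add[of "2 :: real" 1 "1/2"] by (simp add: s)
    then have "?K = 2 powr (1/2) * 2 powr (3/2 * real (k - 1))" by (simp add: s powr_powr flip: powr_realpow)
    also have "\<dots> = 2 powr (1/2 + 3/2 * (real k - 1))" using assms by (simp add: powr_add of_nat_diff)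
    also have "1/2 + 3/2 * (real k - 1) = 3 * real k / 2 - 1" by (simp add: field_simps)
    finally show ?thesis .
  qed
  have "family_norm k n \<alpha> (\<lambda>J. u (a J)) \<le> 2 powr (3 * real k / 2 - 1) * M * c" if \<alpha>: "\<alpha> \<subseteq> {1..k}" for \<alpha>
  proof (rule family_norm_le)
    show "pairing_bounded n {1..k} \<alpha> (\<lambda>J. u (a J)) (2 powr (3 * real k / 2 - 1) * M * c)"
      unfolding K[symmetric] using aA assms by (intro pairing_bounded_map_general[OF _ _ A u _ c0 pb \<alpha>]) auto
  qed (use aA clin_u M0 c0 in auto)
  then show "max_norm k n (\<lambda>J. u (a J)) \<le> 2 powr (3 * real k / 2 - 1) * norm_on A u * max_norm k n a"
    unfolding max_norm_def[of k n "\<lambda>J. u (a J)"] M_def[symmetric] c_def[symmetric]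
    by (intro Max.boundedI) auto
qed

end
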